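(* Let $r\ge 2$, $c\ge 2$ be integers and let $R$ be a binomial domain. If $S$ is a ring such that $S\equiv R$ (as rings), then any abelian deformation of $N_{r,c}(S)$ is elementarily equivalent (as a group) to $N_{r,c}(R)$.
   Context: $\equiv$ denotes elementary equivalence (same first-order sentences). $\Gamma_1(G)=G$, $\Gamma_{i+1}(G)=[\Gamma_i(G),G]$ is the lower central series, and $[x,y]=x^{-1}y^{-1}xy$. Binomial domain: an integral domain $R$ of characteristic zero such that for all $a\in R$ and all positive integers $k$ the equation $a(a-1)\cdots(a-k+1)=x\,(k!)$ has a unique solution $x=\binom{a}{k}$ in $R$. (A ring elementarily equivalent to a binomial domain is a binomial domain.) $N_{r,c}(\mathbb Z)=F/\Gamma_{c+1}(F)$ with $F$ free of rank $r$ is the free nilpotent group of rank $r$ and class $c$. Let $\mathbf u=(u_{11},\dots,u_{1n_1},u_{21},\dots,u_{2n_2},\dots,u_{cn_c})$ be a Hall basic sequence: $n_1=r$, $u_{11},\dots,u_{1r}$ are free generators, $u_{i1},\dots,u_{in_i}$ are the Hall basic commutators of weight $i$ in these, and their cosets freely generate the free abelian group $\Gamma_i/\Gamma_{i+1}$. Each element is uniquely an ordered product $\mathbf u^{\mathbf a}=u_{11}^{a_{11}}\cdots u_{cn_c}^{a_{cn_c}}$ with $a_{ij}\in\mathbb Z$. By P. Hall there are rational polynomials $p_{ij}(\mathbf x,\mathbf y)$, $q_{ij}(\mathbf x,y)$ (integer combinations of products of binomial coefficients in the variables), the canonical polynomials, with $\mathbf u^{\mathbf a}\mathbf u^{\mathbf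 b}=\mathbf u^{\mathbf d}$, $d_{ij}=p_{ij}(\mathbf a,\mathbf b)$, and $(\mathbf u^{\mathbf a})^l=\mathbf u^{\mathbf m}$, $m_{ij}=q_{ij}(\mathbf a,l)$. For a binomial domain $R$, $N_{r,c}(R)$ (the P. Hall $R$-completion) is the set of formal products $\mathbf u^{\mathbf a}$ with $a_{ij}\in R$, with multiplication and $R$-exponentiation given by the same polynomials $p_{ij},q_{ij}$. Symmetric 2-cocycle $f:B\times B\to A$ ($A,B$ abelian, written additively): $f(x+y,z)+f(x,y)=f(x,y+z)+f(y,z)$, $f(0,x)=f(x,0)=0$, $f(x,y)=f(y,x)$. Abelian deformation: for symmetric 2-cocycles $f^1,\dots,f^r:R^+\times R^+\to\bigoplus_{j=1}^{n_c}R^+$, $f^k=(f^k_j)_{1\le j\le n_c}$, let $N_{r,c}(R,\bar f)=N_{r,c}(R,f^1,\dots,f^r)$ be the set of formal products $\mathbf u^{\mathbf a}$ ($a_{ij}\in R$) with operations $\mathbf u^{\mathbf a}\mathbf u^{\mathbf b}=\mathbf u^{\mathbf d}$, $(\mathbf u^{\mathbf a})^{-1}=\mathbf u^{\mathbf m}$, where $d_{ij}=p_{ij}(\mathbf a,\mathbf b)$, $m_{ij}=q_{ij}(\mathbf a,-1)$ for $1\le i\le c-1$, and $d_{cj}=p_{cj}(\mathbf a,\mathbf b)+\sum_{k=1}^r f^k_j(a_{1k},b_{1k})$, $m_{cj}=q_{cj}(\mathbf a,-1)-\sum_{k=1}^r f^k_j(a_{1k},-a_{1k})$. Any group isomorphic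 to some $N_{r,c}(R,\bar f)$ is called an abelian deformation of $N_{r,c}(R)$. *)

theory Defs
  imports "HOL-Algebra.Algebra"
begin

section \<open>First-order sentences over rings and groups\<close>

text \<open>Both languages have function symbols and equality only, so formulas are parametrised by the
  type \<open>'t\<close> of terms (whose variables are indexed by \<open>nat\<close>).\<close>

datatype 't fo_formula =
    Equal 't 't
  | Neg "'t fo_formula"
  | Conj "'t fo_formula" "'t fo_formula"
  | Forall nat "'t fo_formula"

primrec free_vars :: "('t \<Rightarrow> nat set) \<Rightarrow> 't fo_formula \<Rightarrow> nat set" where
  "free_vars tv (Equal s t) = tv s \<union> tv t"
| "free_vars tv (Neg \<phi>) = free_vars tv \<phi>"
| "free_vars tv (Conj \<phi> \<psi>) = free_vars tv \<phi> \<union> free_vars tv \<psi>"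
| "free_vars tv (Forall k \<phi>) = free_vars tv \<phi> - {k}"

primrec satisfies ::
  "'a set \<Rightarrow> ((nat \<Rightarrow> 'a) \<Rightarrow> 't \<Rightarrow> 'a) \<Rightarrow> (nat \<Rightarrow> 'a) \<Rightarrow> 't fo_formula \<Rightarrow> bool" where
  "satisfies D val v (Equal s t) \<longleftrightarrow> val v s = val v t"
| "satisfies D val v (Neg \<phi>) \<longleftrightarrow> \<not> satisfies D val v \<phi>"
| "satisfies D val v (Conj \<phi> \<psi>) \<longleftrightarrow> satisfies D val v \<phi> \<and> satisfies D val v \<psi>"
| "satisfies D val v (Forall k \<phi>) \<longleftrightarrow> (\<forall>x\<in>D. satisfies D val (v(k := x)) \<phi>)"

definition models :: "'a set \<Rightarrow> ((nat \<Rightarrow> 'a) \<Rightarrow> 't \<Rightarrow> 'a) \<Rightarrow> 't fo_formula \<Rightarrow> bool" where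
  "models D val \<phi> \<longleftrightarrow> (\<forall>v \<in> UNIV \<rightarrow> D. satisfies D val v \<phi>)"

datatype ring_term =
  RVar nat | RZero | ROne | RNeg ring_term | RAdd ring_term ring_term | RMul ring_term ring_term

primrec ring_term_vars :: "ring_term \<Rightarrow> nat set" where
  "ring_term_vars (RVar k) = {k}"
| "ring_term_vars RZero = {}"
| "ring_term_vars ROne = {}"
| "ring_term_vars (RNeg s) = ring_term_vars s"
| "ring_term_vars (RAdd s t) = ring_term_vars s \<union> ring_term_vars t"
| "ring_term_vars (RMul s t) = ring_term_vars s \<union> ring_term_vars t"

primrec ring_term_val :: "('a, 'm) ring_scheme \<Rightarrow> (nat \<Rightarrow> 'a) \<Rightarrow> ring_term \<Rightarrow> 'a" where
  "ring_term_val R v (RVar k) = v k"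
| "ring_term_val R v RZero = \<zero>\<^bsub>R\<^esub>"
| "ring_term_val R v ROne = \<one>\<^bsub>R\<^esub>"
| "ring_term_val R v (RNeg s) = \<ominus>\<^bsub>R\<^esub> ring_term_val R v s"
| "ring_term_val R v (RAdd s t) = ring_term_val R v s \<oplus>\<^bsub>R\<^esub> ring_term_val R v t"
| "ring_term_val R v (RMul s t) = ring_term_val R v s \<otimes>\<^bsub>R\<^esub> ring_term_val R v t"

definition ring_elem_equiv :: "('a, 'm) ring_scheme \<Rightarrow> ('b, 'k) ring_scheme \<Rightarrow> bool" where
  "ring_elem_equiv R S \<longleftrightarrow>
     (\<forall>\<phi>. free_vars ring_term_vars \<phi> = {} \<longrightarrow>
        (models (carrier R) (ring_term_val R) \<phi> \<longleftrightarrow> models (carrier S) (ring_term_val S) \<phi>))"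

datatype group_term = GVar nat | GOne | GInv group_term | GMul group_term group_term

primrec group_term_vars :: "group_term \<Rightarrow> nat set" where
  "group_term_vars (GVar k) = {k}"
| "group_term_vars GOne = {}"
| "group_term_vars (GInv s) = group_term_vars s"
| "group_term_vars (GMul s t) = group_term_vars s \<union> group_term_vars t"

primrec group_term_val :: "('a, 'm) monoid_scheme \<Rightarrow> (nat \<Rightarrow> 'a) \<Rightarrow> group_term \<Rightarrow> 'a" where
  "group_term_val G v (GVar k) = v k"
| "group_term_val G v GOne = \<one>\<^bsub>G\<^esub>"
| "group_term_val G v (GInv s) = inv\<^bsub>G\<^esub> group_term_val G v s"
| "group_term_val G v (GMul s t) = group_term_val G v s \<otimes>\<^bsub>G\<^esub> group_term_val G v t"

definition group_elem_equiv :: "('a, 'm) monoid_scheme \<Rightarrow> ('b, 'k) monoid_scheme \<Rightarrow> bool" where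
  "group_elem_equiv G H \<longleftrightarrow>
     (\<forall>\<phi>. free_vars group_term_vars \<phi> = {} \<longrightarrow>
        (models (carrier G) (group_term_val G) \<phi> \<longleftrightarrow> models (carrier H) (group_term_val H) \<phi>))"


section \<open>Binomial domains and integer combinations of products of binomial coefficients\<close>

definition falling_factorial :: "('a, 'm) ring_scheme \<Rightarrow> 'a \<Rightarrow> nat \<Rightarrow> 'a" where
  "falling_factorial R a k = finprod R (\<lambda>i. a \<ominus>\<^bsub>R\<^esub> ([i] \<cdot>\<^bsub>R\<^esub> \<one>\<^bsub>R\<^esub>)) {..<k}"

locale binomial_domain = domain R for R (structure) +
  assumes char_zero: "\<And>k::nat. k > 0 \<Longrightarrow> [k] \<cdot> \<one> \<noteq> \<zero>"
    and ex1_binom: "\<And>a k. \<lbrakk>a \<in> carrier R; k > 0\<rbrakk> \<Longrightarrow>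
      \<exists>!x. x \<in> carrier R \<and> falling_factorial R a k = x \<otimes> ([(fact k :: nat)] \<cdot> \<one>)"

definition ring_binom :: "('a, 'm) ring_scheme \<Rightarrow> 'a \<Rightarrow> nat \<Rightarrow> 'a" where
  "ring_binom R a k =
     (THE x. x \<in> carrier R \<and> falling_factorial R a k = x \<otimes>\<^bsub>R\<^esub> ([(fact k :: nat)] \<cdot>\<^bsub>R\<^esub> \<one>\<^bsub>R\<^esub>))"

text \<open>A formal integer combination of products of binomial coefficients in the variables \<open>'v\<close>:
  the exponent pattern \<open>e\<close> stands for the product of the \<open>binom (x v) (e v)\<close>. These products form a
  \<open>\<rat>\<close>-basis of the rational polynomials, and products of several binomial coefficients in one
  variable are integer combinations of single ones, so nothing is lost by this normal form.\<close>

type_synonym 'v binom_poly = "('v \<Rightarrow>\<^sub>0 nat) \<Rightarrow>\<^sub>0 int"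

definition poly_vars :: "'v binom_poly \<Rightarrow> 'v set" where
  "poly_vars P = (\<Union>e \<in> Poly_Mapping.keys P. Poly_Mapping.keys e)"

definition eval_binom_poly :: "('a, 'm) ring_scheme \<Rightarrow> 'v binom_poly \<Rightarrow> ('v \<Rightarrow> 'a) \<Rightarrow> 'a" where
  "eval_binom_poly R P x =
     finsum R (\<lambda>e. [(Poly_Mapping.lookup P e)] \<cdot>\<^bsub>R\<^esub>
         finprod R (\<lambda>v. ring_binom R (x v) (Poly_Mapping.lookup e v)) (Poly_Mapping.keys e))
       (Poly_Mapping.keys P)"


section \<open>The free nilpotent group of rank r and class c\<close>

text \<open>A letter \<open>(x, True)\<close> is the generator \<open>x\<close>, and \<open>(x, False)\<close> is its inverse. The elements of
  the free group are the freely reduced words.\<close>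

fun reduced :: "('x \<times> bool) list \<Rightarrow> bool" where
  "reduced (a # b # w) \<longleftrightarrow> \<not> (fst a = fst b \<and> snd a \<noteq> snd b) \<and> reduced (b # w)"
| "reduced _ \<longleftrightarrow> True"

fun reduced_Cons :: "'x \<times> bool \<Rightarrow> ('x \<times> bool) list \<Rightarrow> ('x \<times> bool) list" where
  "reduced_Cons a [] = [a]"
| "reduced_Cons a (b # w) = (if fst a = fst b \<and> snd a \<noteq> snd b then w else a # b # w)"

definition free_group :: "'x set \<Rightarrow> ('x \<times> bool) list monoid" where
  "free_group A =
     \<lparr>carrier = {w \<in> lists (A \<times> UNIV). reduced w},
      monoid.mult = (\<lambda>u w. foldr reduced_Cons u w),
      one = []\<rparr>"

definition commutator :: "('a, 'm) monoid_scheme \<Rightarrow> 'a \<Rightarrow> 'a \<Rightarrow> 'a" where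
  "commutator G x y = inv\<^bsub>G\<^esub> x \<otimes>\<^bsub>G\<^esub> inv\<^bsub>G\<^esub> y \<otimes>\<^bsub>G\<^esub> x \<otimes>\<^bsub>G\<^esub> y"

text \<open>The series is indexed from 1; the value at 0 is never used.\<close>

fun lower_central :: "('a, 'm) monoid_scheme \<Rightarrow> nat \<Rightarrow> 'a set" where
  "lower_central G 0 = carrier G"
| "lower_central G (Suc 0) = carrier G"
| "lower_central G (Suc (Suc i)) =
     generate G {commutator G x y | x y. x \<in> lower_central G (Suc i) \<and> y \<in> carrier G}"

definition free_nilpotent :: "nat \<Rightarrow> nat \<Rightarrow> (nat \<times> bool) list set monoid" where
  "free_nilpotent r c = free_group {1..r} Mod lower_central (free_group {1..r}) (Suc c)"

definition free_nilpotent_gen :: "nat \<Rightarrow> nat \<Rightarrow> nat \<Rightarrow> (nat \<times> bool) list set" where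
  "free_nilpotent_gen r c k =
     lower_central (free_group {1..r}) (Suc c) #>\<^bsub>free_group {1..r}\<^esub> [(k, True)]"


section \<open>Hall basic sequences and canonical polynomials\<close>

datatype comm = Gen nat | Br comm comm

primrec comm_value :: "('a, 'm) monoid_scheme \<Rightarrow> (nat \<Rightarrow> 'a) \<Rightarrow> comm \<Rightarrow> 'a" where
  "comm_value G x (Gen k) = x k"
| "comm_value G x (Br s t) = commutator G (comm_value G x s) (comm_value G x t)"

definition hall_index :: "nat \<Rightarrow> (nat \<Rightarrow> nat) \<Rightarrow> (nat \<times> nat) set" where
  "hall_index c n = (SIGMA i:{1..c}. {1..n i})"

definition hall_index_list :: "nat \<Rightarrow> (nat \<Rightarrow> nat) \<Rightarrow> (nat \<times> nat) list" where
  "hall_index_list c n = concat (map (\<lambda>i. map (Pair i) [1..<Suc (n i)]) [1..<Suc c])"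

abbreviation index_less :: "nat \<times> nat \<Rightarrow> nat \<times> nat \<Rightarrow> bool" (infix \<open>\<prec>\<close> 50) where
  "\<alpha> \<prec> \<beta> \<equiv> (\<alpha>, \<beta>) \<in> less_than <*lex*> less_than"

text \<open>The basic commutators of weight \<open>i\<close>, where \<open>h\<close> enumerates those of smaller weight and the
  order on basic commutators is that of their positions: \<open>Br x y\<close> is basic if \<open>x\<close>, \<open>y\<close> are basic,
  \<open>x > y\<close>, and \<open>t \<le> y\<close> whenever \<open>x = Br z t\<close>.\<close>

definition basic_commutators :: "nat \<Rightarrow> (nat \<Rightarrow> nat) \<Rightarrow> (nat \<times> nat \<Rightarrow> comm) \<Rightarrow> nat \<Rightarrow> comm set" where
  "basic_commutators r n h i =
     (if i = 1 then Gen ` {1..r}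
      else {Br (h \<alpha>) (h \<beta>) | \<alpha> \<beta>.
              \<alpha> \<in> hall_index (i - 1) n \<and> \<beta> \<in> hall_index (i - 1) n \<and> fst \<alpha> + fst \<beta> = i \<and> \<beta> \<prec> \<alpha> \<and>
              (\<forall>z. \<forall>\<gamma> \<in> hall_index (i - 1) n. h \<alpha> = Br z (h \<gamma>) \<longrightarrow> \<not> \<beta> \<prec> \<gamma>)})"

definition hall_element ::
  "nat \<Rightarrow> nat \<Rightarrow> (nat \<times> nat \<Rightarrow> comm) \<Rightarrow> nat \<times> nat \<Rightarrow> (nat \<times> bool) list set" where
  "hall_element r c h \<alpha> = comm_value (free_nilpotent r c) (free_nilpotent_gen r c) (h \<alpha>)"

text \<open>The last conjunct says that the cosets of the basic commutators of weight \<open>i\<close> freely generate the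
  abelian group \<open>\<Gamma>\<^sub>i/\<Gamma>\<^sub>i\<^sub>+\<^sub>1\<close>. By the theorems of P. Hall, M. Hall and Witt it follows from the first
  three, so it does not restrict the enumeration \<open>h\<close>.\<close>

definition hall_basic_sequence ::
  "nat \<Rightarrow> nat \<Rightarrow> (nat \<Rightarrow> nat) \<Rightarrow> (nat \<times> nat \<Rightarrow> comm) \<Rightarrow> bool" where
  "hall_basic_sequence r c n h \<longleftrightarrow>
     n 1 = r \<and> (\<forall>k\<in>{1..r}. h (1, k) = Gen k) \<and>
     (\<forall>i\<in>{1..c}. bij_betw (\<lambda>j. h (i, j)) {1..n i} (basic_commutators r n h i)) \<and>
     (\<forall>i\<in>{1..c}.
        let G = free_nilpotent r c;
            Q = G\<lparr>carrier := lower_central G i\<rparr> Mod lower_central G (Suc i)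
        in \<exists>\<phi> \<in> iso (free_Abelian_group {1..n i}) Q.
             \<forall>j\<in>{1..n i}. \<phi> (frag_of j) = lower_central G (Suc i) #>\<^bsub>G\<^esub> hall_element r c h (i, j))"

definition hall_product ::
  "nat \<Rightarrow> nat \<Rightarrow> (nat \<Rightarrow> nat) \<Rightarrow> (nat \<times> nat \<Rightarrow> comm) \<Rightarrow> (nat \<times> nat \<Rightarrow> int) \<Rightarrow> (nat \<times> bool) list set"
where
  "hall_product r c n h a =
     foldr (\<lambda>\<alpha> g. (hall_element r c h \<alpha> [^]\<^bsub>free_nilpotent r c\<^esub> a \<alpha>) \<otimes>\<^bsub>free_nilpotent r c\<^esub> g)
       (hall_index_list c n) \<one>\<^bsub>free_nilpotent r c\<^esub>"

text \<open>In \<open>p\<close> the variables \<open>Inl \<alpha>\<close>, \<open>Inr \<alpha>\<close> are the coordinates of the left and the right factor; in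
  \<open>q\<close> the variable \<open>Inr ()\<close> is the exponent.\<close>

definition canonical_polynomials ::
  "nat \<Rightarrow> nat \<Rightarrow> (nat \<Rightarrow> nat) \<Rightarrow> (nat \<times> nat \<Rightarrow> comm) \<Rightarrow>
   (nat \<times> nat \<Rightarrow> (nat \<times> nat + nat \<times> nat) binom_poly) \<Rightarrow>
   (nat \<times> nat \<Rightarrow> (nat \<times> nat + unit) binom_poly) \<Rightarrow> bool" where
  "canonical_polynomials r c n h p q \<longleftrightarrow>
     (\<forall>\<alpha> \<in> hall_index c n.
        poly_vars (p \<alpha>) \<subseteq> hall_index c n <+> hall_index c n \<and>
        poly_vars (q \<alpha>) \<subseteq> hall_index c n <+> UNIV) \<and>
     (\<forall>a \<in> hall_index c n \<rightarrow>\<^sub>E UNIV. \<forall>b \<in> hall_index c n \<rightarrow>\<^sub>E UNIV.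
        hall_product r c n h a \<otimes>\<^bsub>free_nilpotent r c\<^esub> hall_product r c n h b =
        hall_product r c n h (\<lambda>\<alpha> \<in> hall_index c n. eval_binom_poly \<Z> (p \<alpha>) (case_sum a b))) \<and>
     (\<forall>a \<in> hall_index c n \<rightarrow>\<^sub>E UNIV. \<forall>l::int.
        hall_product r c n h a [^]\<^bsub>free_nilpotent r c\<^esub> l =
        hall_product r c n h (\<lambda>\<alpha> \<in> hall_index c n. eval_binom_poly \<Z> (q \<alpha>) (case_sum a (\<lambda>_. l))))"


section \<open>Hall completions and abelian deformations\<close>

text \<open>A formal product is represented by its family of exponents.\<close>

record ('a, 's) exp_group = "'a monoid" +
  expo :: "'a \<Rightarrow> 's \<Rightarrow> 'a"

definition hall_completion ::
  "nat \<Rightarrow> (nat \<Rightarrow> nat) \<Rightarrow> (nat \<times> nat \<Rightarrow> (nat \<times> nat + nat \<times> nat) binom_poly) \<Rightarrow>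
   (nat \<times> nat \<Rightarrow> (nat \<times> nat + unit) binom_poly) \<Rightarrow> ('a, 'm) ring_scheme \<Rightarrow>
   (nat \<times> nat \<Rightarrow> 'a, 'a) exp_group" where
  "hall_completion c n p q R =
     \<lparr>carrier = hall_index c n \<rightarrow>\<^sub>E carrier R,
      monoid.mult = (\<lambda>a b. \<lambda>\<alpha> \<in> hall_index c n. eval_binom_poly R (p \<alpha>) (case_sum a b)),
      one = (\<lambda>\<alpha> \<in> hall_index c n. \<zero>\<^bsub>R\<^esub>),
      expo = (\<lambda>a l. \<lambda>\<alpha> \<in> hall_index c n. eval_binom_poly R (q \<alpha>) (case_sum a (\<lambda>_. l)))\<rparr>"

definition symmetric_cocycle ::
  "('b, 'm) monoid_scheme \<Rightarrow> ('a, 'k) monoid_scheme \<Rightarrow> ('b \<Rightarrow> 'b \<Rightarrow> 'a) \<Rightarrow> bool" where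
  "symmetric_cocycle B A f \<longleftrightarrow>
     f \<in> carrier B \<rightarrow> carrier B \<rightarrow> carrier A \<and>
     (\<forall>x\<in>carrier B. \<forall>y\<in>carrier B. \<forall>z\<in>carrier B.
        f (x \<otimes>\<^bsub>B\<^esub> y) z \<otimes>\<^bsub>A\<^esub> f x y = f x (y \<otimes>\<^bsub>B\<^esub> z) \<otimes>\<^bsub>A\<^esub> f y z) \<and>
     (\<forall>x\<in>carrier B. f \<one>\<^bsub>B\<^esub> x = \<one>\<^bsub>A\<^esub> \<and> f x \<one>\<^bsub>B\<^esub> = \<one>\<^bsub>A\<^esub>) \<and>
     (\<forall>x\<in>carrier B. \<forall>y\<in>carrier B. f x y = f y x)"

record 'a inv_monoid = "'a monoid" +
  inv_op :: "'a \<Rightarrow> 'a"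

definition deformation ::
  "nat \<Rightarrow> nat \<Rightarrow> (nat \<Rightarrow> nat) \<Rightarrow> (nat \<times> nat \<Rightarrow> (nat \<times> nat + nat \<times> nat) binom_poly) \<Rightarrow>
   (nat \<times> nat \<Rightarrow> (nat \<times> nat + unit) binom_poly) \<Rightarrow> ('a, 'm) ring_scheme \<Rightarrow>
   (nat \<Rightarrow> 'a \<Rightarrow> 'a \<Rightarrow> nat \<Rightarrow> 'a) \<Rightarrow> (nat \<times> nat \<Rightarrow> 'a) inv_monoid" where
  "deformation r c n p q R f =
     \<lparr>carrier = hall_index c n \<rightarrow>\<^sub>E carrier R,
      monoid.mult = (\<lambda>a b. \<lambda>(i, j) \<in> hall_index c n.
        if i < c then eval_binom_poly R (p (i, j)) (case_sum a b)
        else eval_binom_poly R (p (c, j)) (case_sum a b)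
               \<oplus>\<^bsub>R\<^esub> finsum R (\<lambda>k. f k (a (1, k)) (b (1, k)) j) {1..r}),
      one = (\<lambda>\<alpha> \<in> hall_index c n. \<zero>\<^bsub>R\<^esub>),
      inv_op = (\<lambda>a. \<lambda>(i, j) \<in> hall_index c n.
        if i < c then eval_binom_poly R (q (i, j)) (case_sum a (\<lambda>_. \<ominus>\<^bsub>R\<^esub> \<one>\<^bsub>R\<^esub>))
        else eval_binom_poly R (q (c, j)) (case_sum a (\<lambda>_. \<ominus>\<^bsub>R\<^esub> \<one>\<^bsub>R\<^esub>))
               \<ominus>\<^bsub>R\<^esub> finsum R (\<lambda>k. f k (a (1, k)) (\<ominus>\<^bsub>R\<^esub> a (1, k)) j) {1..r})\<rparr>"

text \<open>The isomorphism respects the multiplication (by \<^const>\<open>iso\<close>) and also the explicitly given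
  inverse operation.\<close>

definition abelian_deformation ::
  "nat \<Rightarrow> nat \<Rightarrow> (nat \<Rightarrow> nat) \<Rightarrow> (nat \<times> nat \<Rightarrow> (nat \<times> nat + nat \<times> nat) binom_poly) \<Rightarrow>
   (nat \<times> nat \<Rightarrow> (nat \<times> nat + unit) binom_poly) \<Rightarrow> ('a, 'm) ring_scheme \<Rightarrow>
   ('h, 'k) monoid_scheme \<Rightarrow> bool" where
  "abelian_deformation r c n p q R H \<longleftrightarrow>
     group H \<and>
     (\<exists>f. (\<forall>k\<in>{1..r}. symmetric_cocycle (add_monoid R) (sum_group {1..n c} (\<lambda>_. add_monoid R)) (f k)) \<and>
        (\<exists>\<phi> \<in> iso H (deformation r c n p q R f).
           \<forall>x\<in>carrier H. \<phi> (inv\<^bsub>H\<^esub> x) = inv_op (deformation r c n p q R f) (\<phi> x)))"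

end

theory Submission
  imports Defs
begin

text \<open>Write \<open>N(R)\<close> for the Hall completion over \<open>R\<close>. Elementary equivalence of an abelian deformation
over \<open>S\<close> with \<open>N(R)\<close> has two independent reasons: the deforming cocycles disappear in an ultrapower, and
\<open>N(S)\<close> is interpreted in the ring \<open>S\<close> by formulas that do not depend on \<open>S\<close>.

Let \<open>U\<close> be a free ultrafilter on the natural numbers. In the ultrapower of an abelian group every system of
equations \<open>x n = x (n + 1) ^ k n * a n\<close> has a solution: at place \<open>i\<close> solve the equations with index at most
\<open>i\<close> (\<open>ultrapower_countably_solvable\<close>). Such a group is cotorsion, that is, homomorphisms into it
extend from every subgroup of an abelian group whose quotient is torsion-free
(\<open>hom_extends_across_torsion_free_quotient\<close>): by Zorn's lemma it is enough to pass to the pure closure of one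
more element in the quotient, and this is a union of a chain of cyclic groups, along which the extension asks for the solution of a system of that kind. A symmetric cocycle on a torsion-free group therefore
becomes a coboundary \<open>g x + g y - g (x + y)\<close> in the ultrapower
(\<open>cocycle_splits_in_ultrapower\<close>). The additive group of \<open>S\<close> is torsion-free. Adding the values of the splitting
maps \<open>g\<close> to the coordinates of the last layer is then an isomorphism, up to \<open>U\<close>, from sequences in the
deformation to sequences in \<open>N(S)\<close> (\<open>ultra_iso_to_completion\<close>), and such a map preserves
the truth of all formulas (\<open>models_iff\<close>, a form of the theorem of Los).

By clearing denominators, the coordinates of the value of a group term in \<open>N(S)\<close> are quotients of values of
ring terms by positive integers, and the same terms and integers serve for all binomial domains. So each group formula
translates into a ring formula (\<open>group_formula_translation\<close>), and \<open>N(S)\<close> and \<open>N(R)\<close> are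
elementarily equivalent (\<open>hall_completion_models_iff\<close>). Here \<open>S\<close> is a binomial domain because the axioms
of binomial domains are first-order (\<open>binomial_domain_elementary\<close>).

Both parts rest on properties of the canonical polynomials: they define a group, are additive on the first layer, and
depend on the last layer only through sums. Over the integers these are properties of the free nilpotent group, where
exponents are unique (\<open>exponents_unique\<close>) and the commutators of weight \<open>c\<close> are central
(\<open>integer_identities\<close>). They hold over all binomial domains, because a polynomial
that vanishes at all integers vanishes in every domain of characteristic zero (\<open>rational_identity_from_int\<close>).\<close>

abbreviation sequences :: "('a, 'm) partial_object_scheme \<Rightarrow> (nat \<Rightarrow> 'a) set" where
  "sequences A \<equiv> UNIV \<rightarrow> carrier A"

abbreviation group_satisfies :: "('a, 'm) monoid_scheme \<Rightarrow> (nat \<Rightarrow> 'a) \<Rightarrow> group_term fo_formula \<Rightarrow> bool" where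
  "group_satisfies G \<equiv> satisfies (carrier G) (group_term_val G)"

abbreviation ring_satisfies :: "('a, 'm) ring_scheme \<Rightarrow> (nat \<Rightarrow> 'a) \<Rightarrow> ring_term fo_formula \<Rightarrow> bool" where
  "ring_satisfies R \<equiv> satisfies (carrier R) (ring_term_val R)"

section \<open>Free ultrafilters on the natural numbers\<close>

text \<open>The first assumption makes \<open>U\<close> a proper filter (take \<open>P\<close> constantly true) and an ultrafilter; the
second one makes it free.\<close>

locale free_ultrafilter =
  fixes U :: "nat filter"
  assumes not_ev_iff: "\<And>P. \<not> eventually P U \<longleftrightarrow> eventually (\<lambda>i. \<not> P i) U"
    and ev_ge: "\<And>n. eventually (\<lambda>i. n \<le> i) U"
begin

text \<open>The quantifier step of the theorem of Los: counterexamples can be chosen place by place.\<close>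

lemma ev_Ball_iff:
  "eventually (\<lambda>i. \<forall>x\<in>D. P i x) U \<longleftrightarrow> (\<forall>x\<in>UNIV \<rightarrow> D. eventually (\<lambda>i. P i (x i)) U)"
  if "D \<noteq> {}"
proof
  assume "eventually (\<lambda>i. \<forall>x\<in>D. P i x) U"
  then show "\<forall>x\<in>UNIV \<rightarrow> D. eventually (\<lambda>i. P i (x i)) U"
    by (auto elim!: eventually_mono simp: Pi_iff)
next
  assume *: "\<forall>x\<in>UNIV \<rightarrow> D. eventually (\<lambda>i. P i (x i)) U"
  \<comment> \<open>a sequence of counterexamples, wherever there is one\<close>
  define x where "x i = (if \<exists>y\<in>D. \<not> P i y then SOME y. y \<in> D \<and> \<not> P i y else SOME y. y \<in> D)" for i
  have x: "x i \<in> D" "(\<exists>y\<in>D. \<not> P i y) \<Longrightarrow> \<not> P i (x i)" for i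
  proof -
    have "\<exists>y\<in>D. \<not> P i y \<Longrightarrow> x i \<in> D \<and> \<not> P i (x i)"
      unfolding x_def by simp (rule someI_ex, blast)
    moreover have "\<not> (\<exists>y\<in>D. \<not> P i y) \<Longrightarrow> x i \<in> D"
      using that unfolding x_def by (auto intro: someI)
    ultimately show "x i \<in> D" "(\<exists>y\<in>D. \<not> P i y) \<Longrightarrow> \<not> P i (x i)" by blast+
  qed
  then have "eventually (\<lambda>i. P i (x i)) U" using * by auto
  then show "eventually (\<lambda>i. \<forall>x\<in>D. P i x) U"
    by (rule eventually_mono) (use x(2) in blast)
qed

end

text \<open>By Zorn's lemma there is a maximal family of sets whose finite intersections are all infinite. By maximality,
a set outside the family meets some finite intersection of members in a finite set; hence the family decides every set
and contains every set that includes a finite intersection of members up to finitely many elements.\<close>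

lemma free_ultrafilter_exists: "\<exists>U. free_ultrafilter U"
proof -
  define \<A> :: "nat set set set" where
    "\<A> = {M. \<forall>F. finite F \<longrightarrow> F \<subseteq> M \<longrightarrow> infinite (\<Inter>F)}"
  have "\<exists>M\<in>\<A>. \<forall>F\<in>\<A>. M \<subseteq> F \<longrightarrow> F = M"
  proof (rule subset_Zorn_nonempty)
    have "{} \<in> \<A>" by (auto simp: \<A>_def)
    then show "\<A> \<noteq> {}" by blast
  next
    fix \<C> assume \<C>: "\<C> \<noteq> {}" "subset.chain \<A> \<C>"
    have "infinite (\<Inter>F)" if F: "finite F" "F \<subseteq> \<Union>\<C>" for F
    proof -
      obtain M where "M \<in> \<C>" "F \<subseteq> M"
        using finite_subset_Union_chain[OF F \<C>] by blast
      then show ?thesis using \<C>(2) F(1) by (auto simp: \<A>_def subset.chain_def)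
    qed
    then show "\<Union>\<C> \<in> \<A>" by (auto simp: \<A>_def)
  qed
  then obtain M where M: "M \<in> \<A>" and max: "\<And>F. F \<in> \<A> \<Longrightarrow> M \<subseteq> F \<Longrightarrow> F = M" by blast
  have inf: "infinite (\<Inter>F)" if "finite F" "F \<subseteq> M" for F
    using M that by (auto simp: \<A>_def)
  have out: "\<exists>F. finite F \<and> F \<subseteq> M \<and> finite (\<Inter>F \<inter> A)" if "A \<notin> M" for A
  proof -
    have "insert A M \<notin> \<A>" using max[of "insert A M"] that by blast
    then obtain Y where Y: "finite Y" "Y \<subseteq> insert A M" "finite (\<Inter>Y)"
      by (auto simp: \<A>_def)
    have "\<Inter>(Y - {A}) \<inter> A \<subseteq> \<Inter>Y" by auto
    with Y show ?thesis by (intro exI[of _ "Y - {A}"]) (auto intro: finite_subset)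
  qed
  have large: "A \<in> M" if F: "finite F" "F \<subseteq> M" and A: "finite (\<Inter>F - A)" for F A
  proof (rule ccontr)
    assume "A \<notin> M"
    then obtain Y where Y: "finite Y" "Y \<subseteq> M" "finite (\<Inter>Y \<inter> A)" using out by blast
    have "\<Inter>(F \<union> Y) \<subseteq> (\<Inter>F - A) \<union> (\<Inter>Y \<inter> A)" by auto
    then have "finite (\<Inter>(F \<union> Y))" using A Y(3) by (meson finite_UnI finite_subset)
    then show False using inf[of "F \<union> Y"] F Y by auto
  qed
  have is_filter: "is_filter (\<lambda>P. {i. P i} \<in> M)"
  proof
    show "{i. True} \<in> M" using large[of "{}"] by simp
    show "{i. P i \<and> Q i} \<in> M" if "{i. P i} \<in> M" "{i. Q i} \<in> M" for P Q
      by (rule large[of "{{i. P i}, {i. Q i}}"]) (use that in \<open>auto intro: finite_subset[of _ "{}"]\<close>)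
    show "{i. Q i} \<in> M" if "\<forall>i. P i \<longrightarrow> Q i" "{i. P i} \<in> M" for P Q
      by (rule large[of "{{i. P i}}"]) (use that in \<open>auto intro: finite_subset[of _ "{}"]\<close>)
  qed
  define U where "U = Abs_filter (\<lambda>P. {i. P i} \<in> M)"
  have ev: "eventually P U \<longleftrightarrow> {i. P i} \<in> M" for P
    unfolding U_def by (rule eventually_Abs_filter[OF is_filter])
  have "free_ultrafilter U"
  proof
    fix P :: "nat \<Rightarrow> bool"
    show "\<not> eventually P U \<longleftrightarrow> eventually (\<lambda>i. \<not> P i) U"
    proof
      assume "\<not> eventually P U"
      then obtain F where F: "finite F" "F \<subseteq> M" "finite (\<Inter>F \<inter> {i. P i})"
        using out unfolding ev by blast
      have "\<Inter>F - {i. \<not> P i} = \<Inter>F \<inter> {i. P i}" by auto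
      then show "eventually (\<lambda>i. \<not> P i) U" using large[OF F(1,2)] F(3) by (simp add: ev)
    next
      assume *: "eventually (\<lambda>i. \<not> P i) U"
      show "\<not> eventually P U"
      proof
        assume "eventually P U"
        with * have "{{i. \<not> P i}, {i. P i}} \<subseteq> M" by (auto simp: ev)
        from inf[OF _ this] have "infinite ({i. \<not> P i} \<inter> {i. P i})" by simp
        moreover have "{i. \<not> P i} \<inter> {i. P i} = {}" by auto
        ultimately show False by simp
      qed
    qed
    show "eventually (\<lambda>i. n \<le> i) U" for n
      unfolding ev by (rule large[of "{}"]) (auto intro: finite_subset[of _ "{..<n}"])
  qed
  then show ?thesis ..
qed

section \<open>Groups that are isomorphic up to an ultrafilter\<close>

text \<open>A map of sequences that induces an isomorphism between the ultrapowers of \<open>G\<close> and \<open>H\<close>.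
Equality in an ultrapower is equality of sequences at almost all places, so that no quotient has to be formed.\<close>

locale ultra_iso = free_ultrafilter U + G: group G + H: group H
  for U and G :: "('g, 'm) monoid_scheme" and H :: "('h, 'n) monoid_scheme" +
  fixes T :: "(nat \<Rightarrow> 'g) \<Rightarrow> (nat \<Rightarrow> 'h)"
  assumes T_closed: "x \<in> sequences G \<Longrightarrow> T x \<in> sequences H"
    and T_eq_iff: "\<lbrakk>x \<in> sequences G; y \<in> sequences G\<rbrakk> \<Longrightarrow>
      eventually (\<lambda>i. T x i = T y i) U \<longleftrightarrow> eventually (\<lambda>i. x i = y i) U"
    and T_mult: "\<lbrakk>x \<in> sequences G; y \<in> sequences G\<rbrakk> \<Longrightarrow>
      eventually (\<lambda>i. T (\<lambda>i. x i \<otimes>\<^bsub>G\<^esub> y i) i = T x i \<otimes>\<^bsub>H\<^esub> T y i) U"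
    and T_surj: "z \<in> sequences H \<Longrightarrow>
      \<exists>x \<in> sequences G. eventually (\<lambda>i. T x i = z i) U"
begin

lemma T_one: "eventually (\<lambda>i. T (\<lambda>i. \<one>\<^bsub>G\<^esub>) i = \<one>\<^bsub>H\<^esub>) U"
proof -
  have "T (\<lambda>i. \<one>\<^bsub>G\<^esub>) i \<in> carrier H" for i using T_closed[of "\<lambda>i. \<one>\<^bsub>G\<^esub>"] by auto
  then show ?thesis
    using T_mult[of "\<lambda>i. \<one>\<^bsub>G\<^esub>" "\<lambda>i. \<one>\<^bsub>G\<^esub>"]
    by (auto elim!: eventually_mono simp: H.l_cancel_one' eq_commute)
qed

lemma T_inv:
  assumes x: "x \<in> sequences G"
  shows "eventually (\<lambda>i. T (\<lambda>i. inv\<^bsub>G\<^esub> x i) i = inv\<^bsub>H\<^esub> T x i) U"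
proof -
  have i: "(\<lambda>i. inv\<^bsub>G\<^esub> x i) \<in> sequences G" using x by auto
  have e: "(\<lambda>i. inv\<^bsub>G\<^esub> x i \<otimes>\<^bsub>G\<^esub> x i) = (\<lambda>i. \<one>\<^bsub>G\<^esub>)" using x by (auto simp: fun_eq_iff Pi_iff)
  have c: "T (\<lambda>i. inv\<^bsub>G\<^esub> x i) i \<in> carrier H" "T x i \<in> carrier H" for i
    using T_closed[OF i] T_closed[OF x] by auto
  show ?thesis using T_mult[OF i x, unfolded e] T_one
    by eventually_elim (use c H.inv_equality in auto)
qed

lemma T_term_val:
  assumes v: "\<And>k. v k \<in> sequences G" and w: "\<And>k. w k \<in> sequences H"
    and vw: "\<And>k. eventually (\<lambda>i. T (v k) i = w k i) U"
  shows "(\<lambda>i. group_term_val G (\<lambda>k. v k i) t) \<in> sequences G \<and>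
    eventually (\<lambda>i. T (\<lambda>i. group_term_val G (\<lambda>k. v k i) t) i = group_term_val H (\<lambda>k. w k i) t) U"
proof (induction t)
  case (GVar k)
  then show ?case using v[of k] vw[of k] by auto
next
  case GOne
  then show ?case using T_one by auto
next
  case (GInv t)
  then have "eventually (\<lambda>i. T (\<lambda>i. inv\<^bsub>G\<^esub> group_term_val G (\<lambda>k. v k i) t) i =
      inv\<^bsub>H\<^esub> T (\<lambda>i. group_term_val G (\<lambda>k. v k i) t) i) U"
    by (intro T_inv) auto
  with GInv show ?case by (auto elim: eventually_elim2)
next
  case (GMul s t)
  then have "eventually (\<lambda>i. T (\<lambda>i. group_term_val G (\<lambda>k. v k i) s \<otimes>\<^bsub>G\<^esub> group_term_val G (\<lambda>k. v k i) t) i =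
      T (\<lambda>i. group_term_val G (\<lambda>k. v k i) s) i \<otimes>\<^bsub>H\<^esub> T (\<lambda>i. group_term_val G (\<lambda>k. v k i) t) i) U"
    by (intro T_mult) auto
  moreover have "eventually (\<lambda>i. T (\<lambda>i. group_term_val G (\<lambda>k. v k i) s) i = group_term_val H (\<lambda>k. w k i) s) U"
    "eventually (\<lambda>i. T (\<lambda>i. group_term_val G (\<lambda>k. v k i) t) i = group_term_val H (\<lambda>k. w k i) t) U"
    using GMul by auto
  ultimately have "eventually (\<lambda>i. T (\<lambda>i. group_term_val G (\<lambda>k. v k i) (GMul s t)) i =
      group_term_val H (\<lambda>k. w k i) (GMul s t)) U"
    by eventually_elim simp
  with GMul show ?case by auto
qed

text \<open>The theorem of Los for both groups at once; surjectivity up to \<open>U\<close> is what the quantifier step takes.\<close>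

lemma satisfies_iff:
  assumes "\<And>k. v k \<in> sequences G" and "\<And>k. w k \<in> sequences H"
    and "\<And>k. eventually (\<lambda>i. T (v k) i = w k i) U"
  shows "eventually (\<lambda>i. group_satisfies G (\<lambda>k. v k i) \<phi>) U \<longleftrightarrow>
    eventually (\<lambda>i. group_satisfies H (\<lambda>k. w k i) \<phi>) U"
  using assms
proof (induction \<phi> arbitrary: v w)
  case (Equal s t)
  let ?s = "\<lambda>i. group_term_val G (\<lambda>k. v k i) s" and ?t = "\<lambda>i. group_term_val G (\<lambda>k. v k i) t"
  let ?s' = "\<lambda>i. group_term_val H (\<lambda>k. w k i) s" and ?t' = "\<lambda>i. group_term_val H (\<lambda>k. w k i) t"
  have s: "?s \<in> sequences G" "eventually (\<lambda>i. T ?s i = ?s' i) U"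
    and t: "?t \<in> sequences G" "eventually (\<lambda>i. T ?t i = ?t' i) U"
    using T_term_val[of v w] Equal.prems by auto
  have "eventually (\<lambda>i. ?s i = ?t i) U \<longleftrightarrow> eventually (\<lambda>i. T ?s i = T ?t i) U"
    using T_eq_iff[OF s(1) t(1)] by simp
  also have "\<dots> \<longleftrightarrow> eventually (\<lambda>i. ?s' i = ?t' i) U"
    by (rule eventually_cong[OF eventually_conj[OF s(2) t(2)]]) auto
  finally show ?case by simp
next
  case (Neg \<phi>)
  then show ?case by (simp flip: not_ev_iff)
next
  case (Conj \<phi> \<psi>)
  show ?case
    by (simp only: satisfies.simps eventually_conj_iff Conj.IH(1)[OF Conj.prems] Conj.IH(2)[OF Conj.prems])
next
  case (Forall k \<phi>)
  let ?P = "\<lambda>i x. group_satisfies G ((\<lambda>k. v k i)(k := x)) \<phi>"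
  let ?Q = "\<lambda>i y. group_satisfies H ((\<lambda>k. w k i)(k := y)) \<phi>"
  have *: "eventually (\<lambda>i. ?P i (x i)) U \<longleftrightarrow> eventually (\<lambda>i. ?Q i (y i)) U"
    if "x \<in> sequences G" "y \<in> sequences H" "eventually (\<lambda>i. T x i = y i) U" for x y
  proof -
    have "(\<lambda>k'. (v(k := x)) k' i) = (\<lambda>k. v k i)(k := x i)"
      "(\<lambda>k'. (w(k := y)) k' i) = (\<lambda>k. w k i)(k := y i)" for i by auto
    then show ?thesis
      using Forall.IH[of "v(k := x)" "w(k := y)"] that Forall.prems by (simp add: Pi_iff)
  qed
  have "(\<forall>x\<in>sequences G. eventually (\<lambda>i. ?P i (x i)) U) \<longleftrightarrow>
      (\<forall>y\<in>sequences H. eventually (\<lambda>i. ?Q i (y i)) U)"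
  proof (intro iffI ballI)
    fix y :: "nat \<Rightarrow> 'h" assume G: "\<forall>x\<in>sequences G. eventually (\<lambda>i. ?P i (x i)) U"
      and y: "y \<in> sequences H"
    from T_surj[OF y] obtain x where "x \<in> sequences G" "eventually (\<lambda>i. T x i = y i) U" ..
    with *[OF _ y] G show "eventually (\<lambda>i. ?Q i (y i)) U" by blast
  next
    fix x :: "nat \<Rightarrow> 'g" assume H: "\<forall>y\<in>sequences H. eventually (\<lambda>i. ?Q i (y i)) U"
      and x: "x \<in> sequences G"
    from *[OF x T_closed[OF x]] H T_closed[OF x] show "eventually (\<lambda>i. ?P i (x i)) U" by simp
  qed
  moreover have "carrier G \<noteq> {}" "carrier H \<noteq> {}" by auto
  ultimately show ?case by (simp add: ev_Ball_iff)
qed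

text \<open>An assignment in one of the groups, read as a constant sequence, corresponds to a sequence of assignments in the
other one.\<close>

lemma models_iff:
  "models (carrier G) (group_term_val G) \<phi> \<longleftrightarrow> models (carrier H) (group_term_val H) \<phi>"
proof
  assume G: "models (carrier G) (group_term_val G) \<phi>"
  show "models (carrier H) (group_term_val H) \<phi>"
    unfolding models_def
  proof
    fix w :: "nat \<Rightarrow> 'h" assume w: "w \<in> sequences H"
    have "\<forall>k. \<exists>x \<in> sequences G. eventually (\<lambda>i. T x i = w k) U"
      using T_surj[of "\<lambda>i. w _"] w by (auto simp: Pi_iff)
    then obtain v where v: "\<And>k. v k \<in> sequences G" "\<And>k. eventually (\<lambda>i. T (v k) i = w k) U"
      by metis
    have "eventually (\<lambda>i. group_satisfies G (\<lambda>k. v k i) \<phi>) U"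
      using G v(1) by (auto simp: models_def Pi_iff)
    moreover have w': "(\<lambda>i::nat. w k) \<in> sequences H" for k using w by auto
    ultimately have "eventually (\<lambda>i::nat. group_satisfies H w \<phi>) U"
      by (simp only: satisfies_iff[OF v(1) w' v(2)])
    then show "group_satisfies H w \<phi>"
      using not_ev_iff[of "\<lambda>_. True"] by (cases "group_satisfies H w \<phi>") auto
  qed
next
  assume H: "models (carrier H) (group_term_val H) \<phi>"
  show "models (carrier G) (group_term_val G) \<phi>"
    unfolding models_def
  proof
    fix v :: "nat \<Rightarrow> 'g" assume v: "v \<in> sequences G"
    have c: "T (\<lambda>i. v k) \<in> sequences H" for k using v by (intro T_closed) auto
    have "eventually (\<lambda>i. group_satisfies H (\<lambda>k. T (\<lambda>i. v k) i) \<phi>) U"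
      using H c by (auto simp: models_def Pi_iff)
    moreover have "(\<lambda>i::nat. v k) \<in> sequences G" for k using v by auto
    note satisfies_iff[where v = "\<lambda>k i. v k" and w = "\<lambda>k. T (\<lambda>i. v k)" and \<phi> = \<phi>, OF this c]
    ultimately have "eventually (\<lambda>i::nat. group_satisfies G v \<phi>) U"
      by simp
    then show "group_satisfies G v \<phi>"
      using not_ev_iff[of "\<lambda>_. True"] by (cases "group_satisfies G v \<phi>") auto
  qed
qed

end

section \<open>Extending homomorphisms across torsion-free quotients\<close>

lemma (in group) rcos_eq_iff:
  assumes "subgroup P G" "x \<in> carrier G" "y \<in> carrier G"
  shows "P #> x = P #> y \<longleftrightarrow> x \<otimes> inv y \<in> P"
proof -
  interpret P: subgroup P G by fact
  have "P #> x = P #> y \<longleftrightarrow> x \<in> P #> y"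
    using assms repr_independence[of x P y] rcos_self by (metis repr_independence)
  then show ?thesis using P.rcos_module[OF group_axioms] assms by simp
qed

text \<open>The pure closure of \<open>e\<close> is the union over \<open>n\<close> of the groups of those \<open>z\<close> for which
\<open>z\<close> to the power \<open>n!\<close> is a power of \<open>e\<close>. Since there is no torsion, such a \<open>z\<close> is determined by
the exponent \<open>t\<close> of \<open>e\<close>, which embeds the \<open>n\<close>-th group in the integers; so it is cyclic, and
\<open>b n\<close> generates it.\<close>

lemma (in comm_group) torsion_free_rank_one:
  assumes torsion_free: "\<forall>x\<in>carrier G. \<forall>m::int. m \<noteq> 0 \<longrightarrow> x [^] m = \<one> \<longrightarrow> x = \<one>"
    and e: "e \<in> carrier G" "e \<noteq> \<one>"
  shows "\<exists>(b :: nat \<Rightarrow> 'a) (k :: nat \<Rightarrow> int). \<forall>n. b n \<in> carrier G \<and> b n \<noteq> \<one> \<and> b n = b (Suc n) [^] k n \<and>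
    (\<exists>d::int. b n [^] (fact n :: int) = e [^] d) \<and>
    (\<forall>z\<in>carrier G. \<forall>t::int. z [^] (fact n :: int) = e [^] t \<longrightarrow> (\<exists>s::int. z = b n [^] s))"
proof -
  have tf: "x = \<one>" if "x \<in> carrier G" "m \<noteq> 0" "x [^] m = \<one>" for x and m :: int
    using torsion_free that by blast
  have "\<exists>b. b \<in> carrier G \<and> b \<noteq> \<one> \<and> (\<exists>d::int. b [^] (fact n :: int) = e [^] d) \<and>
     (\<forall>z\<in>carrier G. \<forall>t::int. z [^] (fact n :: int) = e [^] t \<longrightarrow> (\<exists>s::int. z = b [^] s))" for n :: nat
  proof -
    \<comment> \<open>the exponents that occur are the multiples of the least positive one\<close>
    define P where "P d \<longleftrightarrow> d > 0 \<and> (\<exists>z\<in>carrier G. z [^] (fact n :: int) = e [^] int d)" for d :: nat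
    define d where "d = (LEAST d. P d)"
    have "P (fact n)" using e by (auto simp: P_def intro: bexI[of _ e])
    then have "P d" and least: "\<And>d'. P d' \<Longrightarrow> d \<le> d'"
      unfolding d_def by (auto intro: LeastI Least_le)
    then obtain b where d: "d > 0" and b: "b \<in> carrier G" "b [^] (fact n :: int) = e [^] int d"
      by (auto simp: P_def)
    have "b \<noteq> \<one>"
      using tf[OF e(1), of "int d"] e(2) d b(2) by (auto simp: int_pow_one)
    moreover have "\<exists>s::int. z = b [^] s"
      if z: "z \<in> carrier G" "z [^] (fact n :: int) = e [^] t" for z and t :: int
    proof -
      define s where "s = t div int d"
      define y where "y = z \<otimes> b [^] (- s)"
      have y: "y \<in> carrier G" using z b by (simp add: y_def)
      have "y [^] (fact n :: int) = z [^] (fact n :: int) \<otimes> (b [^] (fact n :: int)) [^] (- s)"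
        using z(1) b(1) by (simp add: y_def int_pow_distrib int_pow_pow mult.commute)
      also have "\<dots> = e [^] (t mod int d)"
        using e z b by (simp add: int_pow_pow minus_mult_div_eq_mod s_def flip: int_pow_mult)
      finally have yn: "y [^] (fact n :: int) = e [^] (t mod int d)" .
      have "t mod int d = 0"
      proof (rule ccontr)
        assume "t mod int d \<noteq> 0"
        with d have "P (nat (t mod int d))" using y yn by (auto simp: P_def intro: order.not_eq_order_implies_strict)
        with least have "d \<le> nat (t mod int d)" .
        then show False using d pos_mod_bound[of "int d" t] pos_mod_sign[of "int d" t] by linarith
      qed
      with yn y have "y = \<one>" using tf[OF y, of "fact n"] by simp
      then have "z = b [^] s"
        using z(1) b(1) unfolding y_def by (simp add: int_pow_neg inv_equality inv_solve_right')
      then show ?thesis ..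
    qed
    ultimately show ?thesis using b by blast
  qed
  then obtain b where b: "\<And>n::nat. b n \<in> carrier G" "\<And>n. b n \<noteq> \<one>"
      and d: "\<And>n. \<exists>d::int. b n [^] (fact n :: int) = e [^] d"
      and gen: "\<And>n z t::int. \<lbrakk>z \<in> carrier G; z [^] (fact n :: int) = e [^] t\<rbrakk> \<Longrightarrow> \<exists>s::int. z = b n [^] s"
    by metis
  have "\<exists>s::int. b n = b (Suc n) [^] s" for n
  proof -
    obtain d :: int where "b n [^] (fact n :: int) = e [^] d" using d by blast
    then have "(b n [^] (fact n :: int)) [^] (1 + int n) = e [^] (d * (1 + int n))"
      using e by (simp add: int_pow_pow)
    then have "b n [^] (fact (Suc n) :: int) = e [^] (d * (1 + int n))"
      using b by (simp add: int_pow_pow algebra_simps)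
    then show ?thesis using gen b(1) by blast
  qed
  then obtain k where "\<And>n. b n = b (Suc n) [^] (k n :: int)" by metis
  with b d gen show ?thesis by (intro exI[of _ b] exI[of _ k]) blast
qed

text \<open>By assumption \<open>step\<close> the subgroups generated by \<open>M\<close> and \<open>w n\<close> increase with \<open>n\<close>, so
their union is a subgroup.\<close>

lemma (in comm_group) subgroup_chain_of_cyclic_extensions:
  assumes M: "subgroup M G" and w: "\<And>n. w n \<in> carrier G"
    and step: "\<And>n. w n \<otimes> inv (w (Suc n) [^] (k n :: int)) \<in> M"
  shows "subgroup {z \<otimes> w n [^] (m::int) | z n m. z \<in> M} G"
proof -
  interpret M: subgroup M G by fact
  define A where "A n = {z \<otimes> w n [^] (m::int) | z m. z \<in> M}" for n :: nat
  have A_Suc: "A n \<subseteq> A (Suc n)" for n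
  proof
    fix x assume "x \<in> A n"
    then obtain z m where z: "z \<in> M" and x: "x = z \<otimes> w n [^] (m::int)" by (auto simp: A_def)
    define y where "y = w n \<otimes> inv (w (Suc n) [^] k n)"
    have y: "y \<in> M" "y \<in> carrier G" using step by (auto simp: y_def)
    have "w n = y \<otimes> w (Suc n) [^] k n" using w by (simp add: y_def m_assoc)
    then have "x = (z \<otimes> y [^] m) \<otimes> w (Suc n) [^] (k n * m)"
      using w y z by (simp add: x int_pow_distrib int_pow_pow m_assoc)
    moreover have "z \<otimes> y [^] m \<in> M" using z y M by (simp add: subgroup_int_pow_closed)
    ultimately show "x \<in> A (Suc n)" by (auto simp: A_def)
  qed
  then have mono: "A n \<subseteq> A n'" if "n \<le> n'" for n n'
    using that by (rule lift_Suc_mono_le)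
  have U: "{z \<otimes> w n [^] (m::int) | z n m. z \<in> M} = (\<Union>n. A n)" by (auto simp: A_def)
  show ?thesis unfolding U
  proof
    show "(\<Union>n. A n) \<subseteq> carrier G" using w by (auto simp: A_def)
    have "\<one> \<in> A 0"
      unfolding A_def by (rule CollectI, rule exI[of _ \<one>], rule exI[of _ "0::int"]) simp
    then show "\<one> \<in> (\<Union>n. A n)" by blast
  next
    fix x y assume "x \<in> (\<Union>n. A n)" "y \<in> (\<Union>n. A n)"
    then obtain i j where "x \<in> A i" "y \<in> A j" by blast
    then have "x \<in> A (max i j)" "y \<in> A (max i j)"
      using mono[of i "max i j"] mono[of j "max i j"] by (auto simp del: max.bounded_iff)
    then obtain z m z' m' where "z \<in> M" "z' \<in> M" "x = z \<otimes> w (max i j) [^] (m::int)"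
      "y = z' \<otimes> w (max i j) [^] (m'::int)" by (auto simp: A_def)
    then have "x \<otimes> y = (z \<otimes> z') \<otimes> w (max i j) [^] (m + m')" "z \<otimes> z' \<in> M"
      using w by (auto simp: int_pow_mult m_ac)
    then show "x \<otimes> y \<in> (\<Union>n. A n)" by (auto simp: A_def)
  next
    fix x assume "x \<in> (\<Union>n. A n)"
    then obtain z n m where "z \<in> M" "x = z \<otimes> w n [^] (m::int)" by (auto simp: A_def)
    then have "inv x = inv z \<otimes> w n [^] (- m)" "inv z \<in> M"
      using w by (auto simp: inv_mult int_pow_neg)
    then show "inv x \<in> (\<Union>n. A n)" by (auto simp: A_def)
  qed
qed

text \<open>These systems of equations express that values can be found along a chain of cyclic groups in which the
\<open>n\<close>-th generator is, up to elements whose values are known, the power \<open>k n\<close> of the next one. An abelian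
group that solves all of them is cotorsion.\<close>

definition countably_solvable :: "('a, 'm) monoid_scheme \<Rightarrow> bool" where
  "countably_solvable Q \<longleftrightarrow> (\<forall>a\<in>sequences Q. \<forall>k. \<exists>x\<in>sequences Q.
     \<forall>n::nat. x n = x (Suc n) [^]\<^bsub>Q\<^esub> (k n :: int) \<otimes>\<^bsub>Q\<^esub> a n)"

text \<open>The assumption \<open>isolated\<close> says that \<open>E / P\<close> is torsion-free. Zorn's lemma is applied to the graphs of
homomorphisms whose domains have the same property, as subgroups of \<open>E \<times> Q\<close>.
Suppose that the domain \<open>D\<close> of a maximal graph \<open>M\<close> does not contain \<open>e\<close>. In the torsion-free group
\<open>E / D\<close> the pure closure of \<open>e\<close> is the union of a chain of cyclic groups. Representatives
\<open>b n\<close> of their generators satisfy \<open>b n = b (n + 1) ^ k n * d n\<close> with \<open>d n\<close> in \<open>D\<close>,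
and a solution \<open>x\<close> of the corresponding equations in \<open>Q\<close> provides values for them: \<open>M\<close> together with
the pairs \<open>(b n, x n)\<close> generates a larger graph.\<close>

theorem hom_extends_across_torsion_free_quotient:
  fixes E :: "('a, 'm) monoid_scheme" (structure) and Q :: "('b, 'n) monoid_scheme"
  assumes E: "comm_group E" and Q: "comm_group Q" and sol: "countably_solvable Q"
    and P: "subgroup P E" and isolated: "\<And>x m::int. \<lbrakk>x \<in> carrier E; m \<noteq> 0; x [^] m \<in> P\<rbrakk> \<Longrightarrow> x \<in> P"
    and h: "h \<in> hom (E\<lparr>carrier := P\<rparr>) Q"
  shows "\<exists>g \<in> hom E Q. \<forall>x\<in>P. g x = h x"
proof -
  interpret E: comm_group E by fact
  interpret Q: comm_group Q by fact
  define W where "W = E \<times>\<times> Q"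
  have W: "comm_group W"
  proof -
    interpret W: group W unfolding W_def by (rule DirProd_group) unfold_locales
    show ?thesis
      by (rule W.group_comm_groupI) (auto simp: W_def E.m_comm Q.m_comm)
  qed
  then interpret W: comm_group W .
  have fst: "fst \<in> hom W E" and snd: "snd \<in> hom W Q" by (auto simp: hom_def W_def mult_DirProd')
  have fst_pow: "fst (w [^]\<^bsub>W\<^esub> m) = fst w [^] m" if "w \<in> carrier W" for w and m :: int
    using hom_int_pow[OF fst that] by (simp add: E.is_group W.is_group)
  have fst_mult: "fst (w \<otimes>\<^bsub>W\<^esub> z) = fst w \<otimes> fst z" for w z by (simp add: W_def mult_DirProd')
  define graphs where "graphs = {M. subgroup M W \<and> (\<forall>q. (\<one>, q) \<in> M \<longrightarrow> q = \<one>\<^bsub>Q\<^esub>) \<and>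
     (\<forall>x\<in>carrier E. \<forall>m::int. m \<noteq> 0 \<longrightarrow> x [^] m \<in> fst ` M \<longrightarrow> x \<in> fst ` M)}"
  have graphsI: "M \<in> graphs" if "subgroup M W" "\<And>q. (\<one>, q) \<in> M \<Longrightarrow> q = \<one>\<^bsub>Q\<^esub>"
      "\<And>x m::int. \<lbrakk>x \<in> carrier E; m \<noteq> 0; x [^] m \<in> fst ` M\<rbrakk> \<Longrightarrow> x \<in> fst ` M" for M
    using that unfolding graphs_def by blast
  define M0 where "M0 = (\<lambda>x. (x, h x)) ` P"
  have P_group: "group (E\<lparr>carrier := P\<rparr>)" using P E.subgroup_imp_group by blast
  interpret P: subgroup P E by fact
  have h_one: "h \<one> = \<one>\<^bsub>Q\<^esub>" using hom_one[OF h P_group Q.is_group] by simp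
  have M0: "M0 \<in> graphs"
  proof -
    have "subgroup M0 W"
    proof
      show "M0 \<subseteq> carrier W" using h by (auto simp: M0_def W_def hom_def)
      show "\<one>\<^bsub>W\<^esub> \<in> M0" using h_one by (auto simp: M0_def W_def)
      show "x \<otimes>\<^bsub>W\<^esub> y \<in> M0" if "x \<in> M0" "y \<in> M0" for x y
        using that h by (auto simp: M0_def W_def hom_def intro!: image_eqI[OF _ P.m_closed])
      show "inv\<^bsub>W\<^esub> x \<in> M0" if x: "x \<in> M0" for x
      proof -
        obtain p where p: "p \<in> P" "x = (p, h p)" using x by (auto simp: M0_def)
        interpret h: group_hom "E\<lparr>carrier := P\<rparr>" Q h
          by (rule group_hom.intro[OF P_group Q.is_group]) (simp add: group_hom_axioms_def h)
        have "h (inv p) = inv\<^bsub>Q\<^esub> (h p)"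
          using h.hom_inv[of p] p E.m_inv_consistent[OF P p(1)] by simp
        moreover have "h p \<in> carrier Q" using h p by (auto simp: hom_def)
        ultimately show ?thesis using p by (auto simp: M0_def W_def inv_DirProd E.is_group Q.is_group)
      qed
    qed
    moreover have M0P: "fst ` M0 = P" by (auto simp: M0_def image_image)
    have "\<forall>x\<in>carrier E. \<forall>m::int. m \<noteq> 0 \<longrightarrow> x [^] m \<in> fst ` M0 \<longrightarrow> x \<in> fst ` M0"
      unfolding M0P using isolated by blast
    moreover have "\<forall>q. (\<one>, q) \<in> M0 \<longrightarrow> q = \<one>\<^bsub>Q\<^esub>" using h_one by (auto simp: M0_def)
    ultimately show ?thesis unfolding graphs_def by blast
  qed
  have "\<exists>M\<in>{M \<in> graphs. M0 \<subseteq> M}. \<forall>N\<in>{M \<in> graphs. M0 \<subseteq> M}. M \<subseteq> N \<longrightarrow> N = M"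
  proof (rule subset_Zorn_nonempty)
    show "{M \<in> graphs. M0 \<subseteq> M} \<noteq> {}" using M0 by blast
  next
    fix \<C> assume ne: "\<C> \<noteq> {}" and chain: "subset.chain {M \<in> graphs. M0 \<subseteq> M} \<C>"
    then have C: "\<And>M. M \<in> \<C> \<Longrightarrow> M \<in> graphs \<and> M0 \<subseteq> M"
      and total: "\<And>M N. M \<in> \<C> \<Longrightarrow> N \<in> \<C> \<Longrightarrow> M \<subseteq> N \<or> N \<subseteq> M"
      unfolding subset_chain_def by blast+
    then have sub: "\<And>M. M \<in> \<C> \<Longrightarrow> subgroup M W" by (auto simp: graphs_def)
    have U1: "subgroup (\<Union>\<C>) W"
    proof
      show "\<Union>\<C> \<subseteq> carrier W" using sub subgroup.subset by blast
      show "\<one>\<^bsub>W\<^esub> \<in> \<Union>\<C>" using ne sub subgroup.one_closed by blast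
      show "x \<otimes>\<^bsub>W\<^esub> y \<in> \<Union>\<C>" if "x \<in> \<Union>\<C>" "y \<in> \<Union>\<C>" for x y
      proof -
        obtain M N where "M \<in> \<C>" "N \<in> \<C>" "x \<in> M" "y \<in> N" using \<open>x \<in> \<Union>\<C>\<close> \<open>y \<in> \<Union>\<C>\<close> by blast
        with total[of M N] sub subgroup.m_closed show ?thesis by (metis UnionI subsetD)
      qed
      show "inv\<^bsub>W\<^esub> x \<in> \<Union>\<C>" if "x \<in> \<Union>\<C>" for x
        using that sub subgroup.m_inv_closed by (metis UnionE UnionI)
    qed
    have U3: "x \<in> fst ` \<Union>\<C>" if "x \<in> carrier E" "m \<noteq> 0" "x [^] m \<in> fst ` \<Union>\<C>" for x and m :: int
    proof -
      obtain M where "M \<in> \<C>" "x [^] m \<in> fst ` M" using \<open>x [^] m \<in> fst ` \<Union>\<C>\<close> by blast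
      with C that show ?thesis unfolding graphs_def by blast
    qed
    have U2: "M0 \<subseteq> \<Union>\<C>" "\<And>q. (\<one>, q) \<in> \<Union>\<C> \<Longrightarrow> q = \<one>\<^bsub>Q\<^esub>"
      using ne C unfolding graphs_def by blast+
    have "\<Union>\<C> \<in> graphs" by (rule graphsI[OF U1 U2(2) U3])
    with U2(1) show "\<Union>\<C> \<in> {M \<in> graphs. M0 \<subseteq> M}" by simp
  qed
  then obtain M where "M \<in> {M \<in> graphs. M0 \<subseteq> M}"
    and max': "\<forall>N\<in>{M \<in> graphs. M0 \<subseteq> M}. M \<subseteq> N \<longrightarrow> N = M" by (rule bexE)
  then have Mg: "M \<in> graphs" "M0 \<subseteq> M" by simp_all
  have max: "N = M" if "N \<in> graphs" "M \<subseteq> N" for N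
    using bspec[OF max', of N] that Mg(2) by simp
  have M: "subgroup M W" and sv: "\<And>q. (\<one>, q) \<in> M \<Longrightarrow> q = \<one>\<^bsub>Q\<^esub>"
    and pM: "\<And>x m::int. \<lbrakk>x \<in> carrier E; m \<noteq> 0; x [^] m \<in> fst ` M\<rbrakk> \<Longrightarrow> x \<in> fst ` M"
    using Mg(1) unfolding graphs_def by blast+
  interpret M: subgroup M W by fact
  define D where "D = fst ` M"
  have D: "subgroup D E"
  proof -
    have "group_hom W E fst" by (simp add: group_hom_def group_hom_axioms_def fst W.is_group E.is_group)
    then show ?thesis unfolding D_def by (rule group_hom.subgroup_img_is_subgroup) fact
  qed
  interpret D: subgroup D E by fact
  have total: "carrier E \<subseteq> D"
  proof (rule ccontr)
    assume "\<not> carrier E \<subseteq> D"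
    then obtain e where e: "e \<in> carrier E" "e \<notin> D" by blast
    define B where "B = E Mod D"
    define \<pi> where "\<pi> x = D #> x" for x
    interpret N: normal D E using E.subgroup_imp_normal[OF D] .
    have "comm_group B" unfolding B_def by (rule E.abelian_FactGroup[OF D])
    then interpret B: comm_group B .
    have \<pi>: "\<pi> \<in> hom E B" unfolding \<pi>_def B_def by (rule N.r_coset_hom_Mod)
    have \<pi>_closed: "\<pi> x \<in> carrier B" if "x \<in> carrier E" for x using \<pi> that by (auto simp: hom_def)
    have \<pi>_mult: "\<pi> (x \<otimes> y) = \<pi> x \<otimes>\<^bsub>B\<^esub> \<pi> y" if "x \<in> carrier E" "y \<in> carrier E" for x y
      using \<pi> that by (auto simp: hom_def)
    have \<pi>_pow: "\<pi> (x [^] m) = \<pi> x [^]\<^bsub>B\<^esub> m" if "x \<in> carrier E" for x and m :: int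
      using hom_int_pow[OF \<pi> that E.is_group B.is_group] .
    have \<pi>_eq: "\<pi> x = \<pi> y \<longleftrightarrow> x \<otimes> inv y \<in> D" if "x \<in> carrier E" "y \<in> carrier E" for x y
      unfolding \<pi>_def by (rule E.rcos_eq_iff[OF D that])
    have \<pi>_one: "\<pi> \<one> = \<one>\<^bsub>B\<^esub>" using hom_one[OF \<pi>] E.is_group B.is_group by blast
    have \<pi>_1: "\<pi> x = \<one>\<^bsub>B\<^esub> \<longleftrightarrow> x \<in> D" if "x \<in> carrier E" for x
      using \<pi>_eq[OF that, of "\<one>"] that by (simp add: \<pi>_one)
    have surj: "\<exists>x\<in>carrier E. y = \<pi> x" if "y \<in> carrier B" for y
      using that by (auto simp: B_def \<pi>_def FactGroup_def RCOSETS_def)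
    have tf: "y = \<one>\<^bsub>B\<^esub>" if y: "y \<in> carrier B" "m \<noteq> 0" "y [^]\<^bsub>B\<^esub> m = \<one>\<^bsub>B\<^esub>" for y and m :: int
    proof -
      obtain x where x: "x \<in> carrier E" "y = \<pi> x" using surj[OF y(1)] by blast
      with y have "x [^] m \<in> D" by (simp add: \<pi>_pow flip: \<pi>_1)
      with pM[OF x(1) y(2)] have "x \<in> D" by (simp add: D_def)
      with x show ?thesis using \<pi>_1 by simp
    qed
    have tf': "\<forall>y\<in>carrier B. \<forall>m::int. m \<noteq> 0 \<longrightarrow> y [^]\<^bsub>B\<^esub> m = \<one>\<^bsub>B\<^esub> \<longrightarrow> y = \<one>\<^bsub>B\<^esub>"
      using tf by blast
    have e': "\<pi> e \<noteq> \<one>\<^bsub>B\<^esub>" using e \<pi>_1 by simp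
    obtain b' k where "\<forall>n. b' n \<in> carrier B \<and> b' n \<noteq> \<one>\<^bsub>B\<^esub> \<and> b' n = b' (Suc n) [^]\<^bsub>B\<^esub> (k n :: int) \<and>
      (\<exists>d::int. b' n [^]\<^bsub>B\<^esub> (fact n :: int) = \<pi> e [^]\<^bsub>B\<^esub> d) \<and> (\<forall>z\<in>carrier B. \<forall>t::int.
         z [^]\<^bsub>B\<^esub> (fact n :: int) = \<pi> e [^]\<^bsub>B\<^esub> t \<longrightarrow> (\<exists>s::int. z = b' n [^]\<^bsub>B\<^esub> s))"
      using B.torsion_free_rank_one[OF tf' \<pi>_closed[OF e(1)] e'] by (elim exE) (erule that)
    note bk = spec[OF this]
    have b': "\<And>n. b' n \<in> carrier B" "\<And>n. b' n \<noteq> \<one>\<^bsub>B\<^esub>"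
      "\<And>n. b' n = b' (Suc n) [^]\<^bsub>B\<^esub> (k n :: int)"
      "\<And>n. \<exists>d::int. b' n [^]\<^bsub>B\<^esub> (fact n :: int) = \<pi> e [^]\<^bsub>B\<^esub> d"
      "\<And>n z t::int. \<lbrakk>z \<in> carrier B; z [^]\<^bsub>B\<^esub> (fact n :: int) = \<pi> e [^]\<^bsub>B\<^esub> t\<rbrakk> \<Longrightarrow>
         \<exists>s::int. z = b' n [^]\<^bsub>B\<^esub> s"
      subgoal for n using bk[of n] by (elim conjE)
      subgoal for n using bk[of n] by (elim conjE)
      subgoal for n using bk[of n] by (elim conjE)
      subgoal for n using bk[of n] by (elim conjE)
      subgoal for n z t using bk[of n] by (elim conjE) blast
      done
    obtain b where b: "\<And>n. b n \<in> carrier E" "\<And>n. \<pi> (b n) = b' n"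
      using surj[OF b'(1)] by metis
    have "b n \<otimes> inv (b (Suc n) [^] k n) \<in> D" for n
      using \<pi>_eq[of "b n" "b (Suc n) [^] k n"] b b'(3)[of n] by (simp add: \<pi>_pow)
    then have "\<exists>a. (b n \<otimes> inv (b (Suc n) [^] k n), a) \<in> M" for n
      unfolding D_def by force
    then obtain a where a: "\<And>n. (b n \<otimes> inv (b (Suc n) [^] k n), a n) \<in> M" by metis
    have a_closed: "a n \<in> carrier Q" for n using a[of n] M.subset by (auto simp: W_def)
    obtain x where x: "\<And>n. x n \<in> carrier Q" "\<And>n. x n = x (Suc n) [^]\<^bsub>Q\<^esub> k n \<otimes>\<^bsub>Q\<^esub> a n"
      using sol a_closed unfolding countably_solvable_def by (metis Pi_I Pi_iff UNIV_I)
    define w where "w n = (b n, x n)" for n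
    have w: "w n \<in> carrier W" for n using b(1) x(1) by (simp add: w_def W_def)
    have pow: "(u, v) [^]\<^bsub>W\<^esub> m = (u [^] m, v [^]\<^bsub>Q\<^esub> m)"
      if "u \<in> carrier E" "v \<in> carrier Q" for u v and m :: int
      using fst_pow[of "(u, v)" m] hom_int_pow[OF snd, of "(u, v)" m] that
      by (simp add: W_def prod_eq_iff W.is_group[unfolded W_def] Q.is_group)
    have step: "w n \<otimes>\<^bsub>W\<^esub> inv\<^bsub>W\<^esub> (w (Suc n) [^]\<^bsub>W\<^esub> k n) \<in> M" for n
    proof -
      have "x n \<otimes>\<^bsub>Q\<^esub> inv\<^bsub>Q\<^esub> (x (Suc n) [^]\<^bsub>Q\<^esub> k n) = a n"
        using x(1)[of n] x(1)[of "Suc n"] a_closed[of n] Q.m_comm[of "a n"]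
        by (subst x(2)) (simp add: Q.m_assoc flip: Q.m_comm[of "a n"])
      then have "w n \<otimes>\<^bsub>W\<^esub> inv\<^bsub>W\<^esub> (w (Suc n) [^]\<^bsub>W\<^esub> k n) =
          (b n \<otimes> inv (b (Suc n) [^] k n), a n)"
        using b x(1) by (simp add: w_def pow) (simp add: W_def inv_DirProd E.is_group Q.is_group)
      with a show ?thesis by simp
    qed
    define M' where "M' = {z \<otimes>\<^bsub>W\<^esub> w n [^]\<^bsub>W\<^esub> (m::int) | z n m. z \<in> M}"
    have fst_M': "fst ` M' = {y \<in> carrier E. \<exists>n. \<exists>m::int. \<pi> y = b' n [^]\<^bsub>B\<^esub> m}"
    proof (intro equalityI subsetI)
      fix y assume "y \<in> fst ` M'"
      then obtain z n m where z: "z \<in> M" "y = fst (z \<otimes>\<^bsub>W\<^esub> w n [^]\<^bsub>W\<^esub> (m::int))" by (auto simp: M'_def)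
      then have "y = fst z \<otimes> b n [^] m" "fst z \<in> D" "fst z \<in> carrier E"
        using w by (auto simp: fst_mult fst_pow w_def D_def intro!: D.mem_carrier[unfolded D_def])
      then show "y \<in> {y \<in> carrier E. \<exists>n. \<exists>m::int. \<pi> y = b' n [^]\<^bsub>B\<^esub> m}"
        using b b'(1) \<pi>_1[of "fst z"] by (auto simp: \<pi>_mult \<pi>_pow)
    next
      fix y assume "y \<in> {y \<in> carrier E. \<exists>n. \<exists>m::int. \<pi> y = b' n [^]\<^bsub>B\<^esub> m}"
      then obtain n and m :: int where y: "y \<in> carrier E" "\<pi> y = \<pi> (b n [^] m)"
        using b by (auto simp: \<pi>_pow)
      then have "y \<otimes> inv (b n [^] m) \<in> D" using \<pi>_eq b by simp
      then obtain z where z: "z \<in> M" "fst z = y \<otimes> inv (b n [^] m)" by (auto simp: D_def)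
      then have "y = fst (z \<otimes>\<^bsub>W\<^esub> w n [^]\<^bsub>W\<^esub> m)"
        using y b fst_pow[OF w] by (simp add: fst_mult w_def E.m_assoc)
      moreover have "z \<otimes>\<^bsub>W\<^esub> w n [^]\<^bsub>W\<^esub> m \<in> M'" unfolding M'_def using z(1) by blast
      ultimately show "y \<in> fst ` M'" by blast
    qed
    have "M' \<in> graphs"
    proof -
      have 1: "subgroup M' W"
        unfolding M'_def by (rule W.subgroup_chain_of_cyclic_extensions[where w = w and k = k, OF M w step])
      have 2: "q = \<one>\<^bsub>Q\<^esub>" if "(\<one>, q) \<in> M'" for q
      proof -
        have "\<exists>z n. \<exists>m::int. (\<one>, q) = z \<otimes>\<^bsub>W\<^esub> w n [^]\<^bsub>W\<^esub> m \<and> z \<in> M"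
          using that by (simp only: M'_def mem_Collect_eq)
        then obtain z n m where z: "z \<in> M" "(\<one>, q) = z \<otimes>\<^bsub>W\<^esub> w n [^]\<^bsub>W\<^esub> (m::int)"
          by (elim exE conjE) (rule that)
        then have zc: "fst z \<in> D" "z \<in> carrier W" by (auto simp: D_def)
        have "\<one> = fst z \<otimes> b n [^] m"
          using arg_cong[OF z(2), of fst] w by (simp add: fst_mult fst_pow w_def)
        then have "\<one>\<^bsub>B\<^esub> = \<pi> (fst z) \<otimes>\<^bsub>B\<^esub> b' n [^]\<^bsub>B\<^esub> m"
          using zc b by (metis D.mem_carrier E.int_pow_closed \<pi>_mult \<pi>_one \<pi>_pow)
        moreover have "\<pi> (fst z) = \<one>\<^bsub>B\<^esub>" using zc \<pi>_1 D.mem_carrier by blast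
        ultimately have "b' n [^]\<^bsub>B\<^esub> m = \<one>\<^bsub>B\<^esub>" using b'(1) by (metis B.int_pow_closed B.l_one)
        then have "m = 0" using tf[OF b'(1)] b'(2)[of n] by metis
        then have "(\<one>, q) \<in> M" using z zc by simp
        then show ?thesis by (rule sv)
      qed
      have 3: "y \<in> fst ` M'" if y: "y \<in> carrier E" "m \<noteq> 0" "y [^] m \<in> fst ` M'" for y and m :: int
      proof -
        from y(1,3) obtain n and s :: int where "\<pi> y [^]\<^bsub>B\<^esub> m = b' n [^]\<^bsub>B\<^esub> s"
          unfolding fst_M' by (auto simp: \<pi>_pow)
        then have "(\<pi> y [^]\<^bsub>B\<^esub> m) [^]\<^bsub>B\<^esub> (fact n :: int) = (b' n [^]\<^bsub>B\<^esub> (fact n :: int)) [^]\<^bsub>B\<^esub> s"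
          using b'(1) by (simp add: B.int_pow_pow mult.commute)
        moreover obtain d :: int where "b' n [^]\<^bsub>B\<^esub> (fact n :: int) = \<pi> e [^]\<^bsub>B\<^esub> d"
          using b'(4) by blast
        ultimately have N: "\<pi> y [^]\<^bsub>B\<^esub> (m * fact n) = \<pi> e [^]\<^bsub>B\<^esub> (d * s)"
          using \<pi>_closed[OF y(1)] \<pi>_closed[OF e(1)] by (simp add: B.int_pow_pow)
        \<comment> \<open>every non-zero integer divides the factorial of its absolute value\<close>
        define N where "N = nat \<bar>m * fact n\<bar>"
        have "m * fact n \<noteq> 0" using y(2) by simp
        then have "N \<ge> 1" unfolding N_def by linarith
        then have "N dvd fact N" by (rule dvd_fact) simp
        then have "int N dvd int (fact N)" by (simp only: int_dvd_int_iff)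
        then have "\<bar>m * fact n\<bar> dvd fact N" by (simp add: N_def)
        then have "m * fact n dvd fact N" by (simp only: abs_dvd_iff)
        then obtain l where l: "fact N = (m * fact n) * l" by (rule dvdE)
        have "\<pi> y [^]\<^bsub>B\<^esub> (fact N :: int) = \<pi> e [^]\<^bsub>B\<^esub> (d * s * l)"
          using \<pi>_closed[OF y(1)] \<pi>_closed[OF e(1)] N by (simp add: l flip: B.int_pow_pow)
        from b'(5)[OF \<pi>_closed[OF y(1)] this] show ?thesis unfolding fst_M' using y(1) by blast
      qed
      show ?thesis by (rule graphsI[OF 1 2 3])
    qed
    moreover have "M \<subseteq> M'"
    proof
      fix z assume "z \<in> M"
      then show "z \<in> M'"
        unfolding M'_def
        by (intro CollectI exI[of _ z] exI[of _ 0] exI[of _ "0::int"]) simp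
    qed
    ultimately have "M' = M" by (rule max)
    then have "D = fst ` M'" by (simp add: D_def)
    moreover have "e \<in> fst ` M'"
      using b'(5)[of "\<pi> e" 0 1] \<pi>_closed[OF e(1)] e(1) unfolding fst_M' by auto
    ultimately show False using e by simp
  qed
  have single: "q = q'" if "(x, q) \<in> M" "(x, q') \<in> M" for x q q'
  proof -
    have c: "x \<in> carrier E" "q \<in> carrier Q" "q' \<in> carrier Q" using that M.subset by (auto simp: W_def)
    have "(x, q) \<otimes>\<^bsub>W\<^esub> inv\<^bsub>W\<^esub> (x, q') \<in> M" using that by blast
    then have "q \<otimes>\<^bsub>Q\<^esub> inv\<^bsub>Q\<^esub> q' = \<one>\<^bsub>Q\<^esub>"
      using c by (intro sv) (simp add: W_def inv_DirProd E.is_group Q.is_group)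
    then show ?thesis using c by (metis Q.inv_closed Q.inv_equality Q.inv_inv)
  qed
  define g where "g x = (THE q. (x, q) \<in> M)" for x
  have g: "(x, g x) \<in> M" if x: "x \<in> carrier E" for x
  proof -
    from total x obtain q where "(x, q) \<in> M" by (force simp: D_def)
    then show ?thesis unfolding g_def using single by (metis theI)
  qed
  have g_eq: "g x = q" if "(x, q) \<in> M" for x q
    using single[OF g that] that M.subset by (auto simp: W_def)
  have "g \<in> hom E Q"
  proof (rule homI)
    show "g x \<in> carrier Q" if "x \<in> carrier E" for x using g[OF that] M.subset by (auto simp: W_def)
    show "g (x \<otimes> y) = g x \<otimes>\<^bsub>Q\<^esub> g y" if "x \<in> carrier E" "y \<in> carrier E" for x y
      using M.m_closed[OF g[OF that(1)] g[OF that(2)]] by (intro g_eq) (simp add: W_def)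
  qed
  moreover have "\<forall>x\<in>P. g x = h x" using Mg(2) by (auto simp: M0_def intro!: g_eq)
  ultimately show ?thesis by blast
qed

section \<open>Symmetric cocycles split in ultrapowers\<close>

definition sequence_group :: "('a, 'm) monoid_scheme \<Rightarrow> (nat \<Rightarrow> 'a) monoid" where
  "sequence_group A = \<lparr>carrier = sequences A, monoid.mult = (\<lambda>a b i. a i \<otimes>\<^bsub>A\<^esub> b i), one = (\<lambda>i. \<one>\<^bsub>A\<^esub>)\<rparr>"

lemma comm_group_sequence_group:
  assumes "comm_group A"
  shows "comm_group (sequence_group A)"
proof -
  interpret A: comm_group A by fact
  show ?thesis
  proof (rule comm_groupI)
    fix a assume "a \<in> carrier (sequence_group A)"
    then show "\<exists>b\<in>carrier (sequence_group A). b \<otimes>\<^bsub>sequence_group A\<^esub> a = \<one>\<^bsub>sequence_group A\<^esub>"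
      by (intro bexI[of _ "\<lambda>i. inv\<^bsub>A\<^esub> a i"]) (auto simp: sequence_group_def Pi_iff)
  qed (auto simp: sequence_group_def Pi_iff A.m_ac)
qed

context free_ultrafilter
begin

definition null_sequences :: "('a, 'm) monoid_scheme \<Rightarrow> (nat \<Rightarrow> 'a) set" where
  "null_sequences A = {a \<in> sequences A. eventually (\<lambda>i. a i = \<one>\<^bsub>A\<^esub>) U}"

definition ultrapower :: "('a, 'm) monoid_scheme \<Rightarrow> (nat \<Rightarrow> 'a) set monoid" where
  "ultrapower A = sequence_group A Mod null_sequences A"

definition ultra_class :: "('a, 'm) monoid_scheme \<Rightarrow> (nat \<Rightarrow> 'a) \<Rightarrow> (nat \<Rightarrow> 'a) set" where
  "ultra_class A a = null_sequences A #>\<^bsub>sequence_group A\<^esub> a"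

context
  fixes A :: "('a, 'm) monoid_scheme" (structure)
  assumes A: "comm_group A"
begin

interpretation A: comm_group A by (rule A)
interpretation P: comm_group "sequence_group A" by (rule comm_group_sequence_group[OF A])

lemma inv_sequence_group:
  assumes "a \<in> sequences A"
  shows "inv\<^bsub>sequence_group A\<^esub> a = (\<lambda>i. inv a i)"
  by (rule P.inv_equality) (use assms in \<open>auto simp: sequence_group_def Pi_iff\<close>)

lemma subgroup_null_sequences: "subgroup (null_sequences A) (sequence_group A)"
proof
  show "null_sequences A \<subseteq> carrier (sequence_group A)"
    by (auto simp: null_sequences_def sequence_group_def)
  show "a \<otimes>\<^bsub>sequence_group A\<^esub> b \<in> null_sequences A" if "a \<in> null_sequences A" "b \<in> null_sequences A" for a b
    using that by (auto simp: null_sequences_def sequence_group_def Pi_iff elim: eventually_elim2)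
  show "\<one>\<^bsub>sequence_group A\<^esub> \<in> null_sequences A"
    by (auto simp: null_sequences_def sequence_group_def)
  show "inv\<^bsub>sequence_group A\<^esub> a \<in> null_sequences A" if "a \<in> null_sequences A" for a
    using that by (auto simp: null_sequences_def inv_sequence_group Pi_iff elim!: eventually_mono)
qed

lemma comm_group_ultrapower: "comm_group (ultrapower A)"
  unfolding ultrapower_def by (rule P.abelian_FactGroup[OF subgroup_null_sequences])

lemma ultra_class_hom: "ultra_class A \<in> hom (sequence_group A) (ultrapower A)"
  using normal.r_coset_hom_Mod[OF P.subgroup_imp_normal[OF subgroup_null_sequences]]
  unfolding ultrapower_def ultra_class_def[abs_def] .

lemma ultra_class_closed: "a \<in> sequences A \<Longrightarrow> ultra_class A a \<in> carrier (ultrapower A)"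
  using ultra_class_hom by (auto simp: hom_def sequence_group_def)

lemma ultra_class_mult:
  "\<lbrakk>a \<in> sequences A; b \<in> sequences A\<rbrakk> \<Longrightarrow>
    ultra_class A (\<lambda>i. a i \<otimes> b i) = ultra_class A a \<otimes>\<^bsub>ultrapower A\<^esub> ultra_class A b"
  using ultra_class_hom by (auto simp: hom_def sequence_group_def)

lemma ultra_class_surj:
  "y \<in> carrier (ultrapower A) \<Longrightarrow> \<exists>a\<in>sequences A. y = ultra_class A a"
  by (auto simp: ultrapower_def carrier_FactGroup sequence_group_def ultra_class_def)

lemma ultra_class_eq_iff:
  assumes a: "a \<in> sequences A" and b: "b \<in> sequences A"
  shows "ultra_class A a = ultra_class A b \<longleftrightarrow> eventually (\<lambda>i. a i = b i) U"
proof -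
  have "ultra_class A a = ultra_class A b \<longleftrightarrow> (\<lambda>i. a i \<otimes> inv b i) \<in> null_sequences A"
    using P.rcos_eq_iff[OF subgroup_null_sequences, of a b] a b
    unfolding ultra_class_def inv_sequence_group[OF b] by (simp add: sequence_group_def)
  also have "\<dots> \<longleftrightarrow> eventually (\<lambda>i. a i \<otimes> inv b i = \<one>) U"
    using a b by (auto simp: null_sequences_def Pi_iff)
  also have "\<dots> \<longleftrightarrow> eventually (\<lambda>i. a i = b i) U"
  proof (rule eventually_cong[OF always_eventually])
    show "\<forall>i. True" by simp
    show "(a i \<otimes> inv b i = \<one>) = (a i = b i)" for i
      using a b by (metis A.inv_closed A.inv_equality A.inv_inv A.r_inv PiE UNIV_I)
  qed
  finally show ?thesis .
qed

lemma sequence_group_int_pow: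
  assumes "a \<in> sequences A"
  shows "(a [^]\<^bsub>sequence_group A\<^esub> (m::int)) i = a i [^] m"
proof -
  have "(\<lambda>a. a i) \<in> hom (sequence_group A) A" by (auto simp: hom_def sequence_group_def)
  from hom_int_pow[OF this, of a m] assms show ?thesis
    by (simp add: P.is_group A.is_group) (simp add: sequence_group_def)
qed

text \<open>Finitely many of the equations can be solved by backward substitution. Each single equation is among those that
are solved at place \<open>i\<close> as soon as \<open>i\<close> is large enough.\<close>

theorem ultrapower_countably_solvable: "countably_solvable (ultrapower A)"
  unfolding countably_solvable_def
proof (intro ballI allI)
  fix y :: "nat \<Rightarrow> (nat \<Rightarrow> 'a) set" and k :: "nat \<Rightarrow> int"
  assume y: "y \<in> UNIV \<rightarrow> carrier (ultrapower A)"
  have "\<forall>n. \<exists>a\<in>sequences A. y n = ultra_class A a" using y by (auto intro: ultra_class_surj)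
  then obtain a where a: "\<And>n. a n \<in> sequences A" "\<And>n. y n = ultra_class A (a n)" by metis
  have a': "a n i \<in> carrier A" for n i using a(1)[of n] by auto
  \<comment> \<open>at place \<open>i\<close> the equations with index at most \<open>i\<close> are solved backwards, starting from \<open>x (i + 1) = \<one>\<close>\<close>
  define s where "s i = rec_nat \<one> (\<lambda>d z. z [^] k (i - d) \<otimes> a (i - d) i)" for i
  have s_Suc: "s i (Suc d) = s i d [^] k (i - d) \<otimes> a (i - d) i" for i d by (simp add: s_def)
  have s: "s i d \<in> carrier A" for i d
    by (induction d) (simp_all add: s_Suc a', simp add: s_def)
  \<comment> \<open>counting \<open>d\<close> downwards from \<open>i + 1\<close>, the solution at index \<open>n\<close> is reached after \<open>i + 1 - n\<close> steps\<close>
  define x where "x n i = s i (Suc i - n)" for n i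
  have x: "x n \<in> sequences A" for n by (auto simp: x_def s)
  have eq: "ultra_class A (x n) = ultra_class A (x (Suc n)) [^]\<^bsub>ultrapower A\<^esub> k n \<otimes>\<^bsub>ultrapower A\<^esub> y n" for n
  proof -
    let ?b = "x (Suc n) [^]\<^bsub>sequence_group A\<^esub> k n"
    have b: "?b \<in> sequences A"
      using P.int_pow_closed[of "x (Suc n)" "k n"] x by (simp add: sequence_group_def)
    have "x n i = ?b i \<otimes> a n i" if "n \<le> i" for i
    proof -
      have "s i (Suc (i - n)) = s i (i - n) [^] k n \<otimes> a n i" using s_Suc[of i "i - n"] that by simp
      then show ?thesis using that by (simp add: sequence_group_int_pow[OF x] x_def Suc_diff_le)
    qed
    then have "eventually (\<lambda>i. x n i = ?b i \<otimes> a n i) U"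
      by (intro eventually_mono[OF ev_ge[of n]])
    then have "ultra_class A (x n) = ultra_class A (\<lambda>i. ?b i \<otimes> a n i)"
      using x b a' by (subst ultra_class_eq_iff) (auto simp: Pi_iff)
    also have "\<dots> = ultra_class A ?b \<otimes>\<^bsub>ultrapower A\<^esub> y n"
      unfolding a(2) by (rule ultra_class_mult[OF b a(1)])
    also have "ultra_class A ?b = ultra_class A (x (Suc n)) [^]\<^bsub>ultrapower A\<^esub> k n"
    proof (rule hom_int_pow[OF ultra_class_hom])
      show "x (Suc n) \<in> carrier (sequence_group A)" using x by (simp add: sequence_group_def)
      show "group (sequence_group A)" by (rule P.is_group)
      show "group (ultrapower A)" using comm_group_ultrapower by (rule comm_group.axioms(2))
    qed
    finally show ?thesis .
  qed
  show "\<exists>x\<in>UNIV \<rightarrow> carrier (ultrapower A).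
      \<forall>n. x n = x (Suc n) [^]\<^bsub>ultrapower A\<^esub> k n \<otimes>\<^bsub>ultrapower A\<^esub> y n"
  proof (rule bexI[where x = "\<lambda>n. ultra_class A (x n)"])
    show "\<forall>n. ultra_class A (x n) = ultra_class A (x (Suc n)) [^]\<^bsub>ultrapower A\<^esub> k n \<otimes>\<^bsub>ultrapower A\<^esub> y n"
      by (rule allI) (rule eq)
    show "(\<lambda>n. ultra_class A (x n)) \<in> UNIV \<rightarrow> carrier (ultrapower A)"
      by (intro funcsetI ultra_class_closed x)
  qed
qed

end

text \<open>The cocycle makes \<open>E\<close>, the product of the groups of sequences, an abelian extension of the sequences in
\<open>B\<close> by the sequences in \<open>A\<close>. The pairs whose second component is trivial almost everywhere form a subgroup
\<open>K\<close>, with torsion-free quotient because \<open>B\<close> is torsion-free, and on \<open>K\<close> the first component is a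
homomorphism to the ultrapower of \<open>A\<close>. Evaluated on the section \<open>x \<mapsto> (1, x)\<close>, an extension of it
to \<open>E\<close> yields \<open>g\<close>.\<close>

theorem cocycle_splits_in_ultrapower:
  fixes A :: "('a, 'm) monoid_scheme" (structure) and B :: "('b, 'n) monoid_scheme"
  assumes A: "comm_group A" and B: "comm_group B"
    and torsion_free: "\<And>x m::int. \<lbrakk>x \<in> carrier B; m \<noteq> 0; x [^]\<^bsub>B\<^esub> m = \<one>\<^bsub>B\<^esub>\<rbrakk> \<Longrightarrow> x = \<one>\<^bsub>B\<^esub>"
    and f: "symmetric_cocycle B A f"
  shows "\<exists>g. (\<forall>x\<in>sequences B. g x \<in> sequences A) \<and>
    (\<forall>x\<in>sequences B. \<forall>y\<in>sequences B. eventually (\<lambda>i.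
       f (x i) (y i) \<otimes> g (\<lambda>i. x i \<otimes>\<^bsub>B\<^esub> y i) i = g x i \<otimes> g y i) U) \<and>
    (\<forall>x\<in>sequences B. \<forall>y\<in>sequences B.
       eventually (\<lambda>i. x i = y i) U \<longrightarrow> eventually (\<lambda>i. g x i = g y i) U)"
proof -
  interpret A: comm_group A by (rule A)
  interpret B: comm_group B by (rule B)
  interpret Q: comm_group "ultrapower A" by (rule comm_group_ultrapower[OF A])
  let ?SA = "sequences A :: (nat \<Rightarrow> 'a) set" and ?SB = "sequences B :: (nat \<Rightarrow> 'b) set"
  have fc: "f x y \<in> carrier A" if "x \<in> carrier B" "y \<in> carrier B" for x y
    using f that by (auto simp: symmetric_cocycle_def)
  have f1: "f \<one>\<^bsub>B\<^esub> x = \<one>" "f x \<one>\<^bsub>B\<^esub> = \<one>" if "x \<in> carrier B" for x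
    using f that by (auto simp: symmetric_cocycle_def)
  have fs: "f x y = f y x" if "x \<in> carrier B" "y \<in> carrier B" for x y
    using f that by (auto simp: symmetric_cocycle_def)
  have cocycle: "f (x \<otimes>\<^bsub>B\<^esub> y) z \<otimes> f x y = f x (y \<otimes>\<^bsub>B\<^esub> z) \<otimes> f y z"
    if "x \<in> carrier B" "y \<in> carrier B" "z \<in> carrier B" for x y z
    using f that by (auto simp: symmetric_cocycle_def)
  define E :: "((nat \<Rightarrow> 'a) \<times> (nat \<Rightarrow> 'b)) monoid" where
    "E = \<lparr>carrier = ?SA \<times> ?SB,
      monoid.mult = (\<lambda>(a, x) (b, y). (\<lambda>i. a i \<otimes> b i \<otimes> f (x i) (y i), \<lambda>i. x i \<otimes>\<^bsub>B\<^esub> y i)),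
      one = (\<lambda>i. \<one>, \<lambda>i. \<one>\<^bsub>B\<^esub>)\<rparr>"
  have E_mult: "(a, x) \<otimes>\<^bsub>E\<^esub> (b, y) = (\<lambda>i. a i \<otimes> b i \<otimes> f (x i) (y i), \<lambda>i. x i \<otimes>\<^bsub>B\<^esub> y i)" for a x b y
    by (simp add: E_def)
  have E_carrier: "(a, x) \<in> carrier E \<longleftrightarrow> a \<in> ?SA \<and> x \<in> ?SB" for a x by (simp add: E_def)
  have E_one: "\<one>\<^bsub>E\<^esub> = (\<lambda>i. \<one>, \<lambda>i. \<one>\<^bsub>B\<^esub>)" by (simp add: E_def)
  have E: "comm_group E"
  proof (rule comm_groupI)
    fix u v assume "u \<in> carrier E" "v \<in> carrier E"
    then obtain a x b y where u: "u = (a, x)" "a \<in> ?SA" "x \<in> ?SB" and v: "v = (b, y)" "b \<in> ?SA" "y \<in> ?SB"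
      by (cases u, cases v) (auto simp: E_carrier)
    show "u \<otimes>\<^bsub>E\<^esub> v \<in> carrier E" using u v by (auto simp: E_mult E_carrier Pi_iff fc)
    show "u \<otimes>\<^bsub>E\<^esub> v = v \<otimes>\<^bsub>E\<^esub> u"
      using u v by (auto simp: E_mult Pi_iff fun_eq_iff A.m_comm B.m_comm fs)
    fix w assume "w \<in> carrier E"
    then obtain d z where w: "w = (d, z)" "d \<in> ?SA" "z \<in> ?SB" by (cases w) (auto simp: E_carrier)
    have "a i \<otimes> b i \<otimes> f (x i) (y i) \<otimes> d i \<otimes> f (x i \<otimes>\<^bsub>B\<^esub> y i) (z i) =
        a i \<otimes> (b i \<otimes> d i \<otimes> f (y i) (z i)) \<otimes> f (x i) (y i \<otimes>\<^bsub>B\<^esub> z i)" for i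
    proof -
      have c: "a i \<in> carrier A" "b i \<in> carrier A" "d i \<in> carrier A" "x i \<in> carrier B" "y i \<in> carrier B" "z i \<in> carrier B"
        using u v w by auto
      have "a i \<otimes> b i \<otimes> f (x i) (y i) \<otimes> d i \<otimes> f (x i \<otimes>\<^bsub>B\<^esub> y i) (z i) =
          a i \<otimes> b i \<otimes> d i \<otimes> (f (x i \<otimes>\<^bsub>B\<^esub> y i) (z i) \<otimes> f (x i) (y i))"
        using c by (simp add: fc A.m_ac)
      also have "\<dots> = a i \<otimes> b i \<otimes> d i \<otimes> (f (x i) (y i \<otimes>\<^bsub>B\<^esub> z i) \<otimes> f (y i) (z i))"
        using c by (simp add: cocycle)
      also have "\<dots> = a i \<otimes> (b i \<otimes> d i \<otimes> f (y i) (z i)) \<otimes> f (x i) (y i \<otimes>\<^bsub>B\<^esub> z i)"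
        using c by (simp add: fc A.m_ac)
      finally show ?thesis .
    qed
    then show "u \<otimes>\<^bsub>E\<^esub> v \<otimes>\<^bsub>E\<^esub> w = u \<otimes>\<^bsub>E\<^esub> (v \<otimes>\<^bsub>E\<^esub> w)"
      using u v w by (auto simp: E_mult fun_eq_iff Pi_iff B.m_assoc)
  next
    show "\<one>\<^bsub>E\<^esub> \<in> carrier E" by (auto simp: E_one E_carrier)
  next
    fix u assume "u \<in> carrier E"
    then obtain a x where u: "u = (a, x)" "a \<in> ?SA" "x \<in> ?SB" by (cases u) (auto simp: E_carrier)
    show "\<one>\<^bsub>E\<^esub> \<otimes>\<^bsub>E\<^esub> u = u" using u by (auto simp: E_one E_mult fun_eq_iff Pi_iff f1)
    let ?b = "\<lambda>i. inv (a i \<otimes> f (inv\<^bsub>B\<^esub> x i) (x i))"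
    have "?b i \<otimes> a i \<otimes> f (inv\<^bsub>B\<^esub> x i) (x i) = \<one>" for i
    proof -
      have "a i \<in> carrier A" "f (inv\<^bsub>B\<^esub> x i) (x i) \<in> carrier A" using u by (auto intro!: fc)
      then show ?thesis by (simp add: A.m_assoc)
    qed
    then have "(?b, \<lambda>i. inv\<^bsub>B\<^esub> x i) \<otimes>\<^bsub>E\<^esub> u = \<one>\<^bsub>E\<^esub>"
      using u by (auto simp: E_one E_mult fun_eq_iff Pi_iff)
    moreover have "(?b, \<lambda>i. inv\<^bsub>B\<^esub> x i) \<in> carrier E" using u by (auto simp: E_carrier Pi_iff fc)
    ultimately show "\<exists>v\<in>carrier E. v \<otimes>\<^bsub>E\<^esub> u = \<one>\<^bsub>E\<^esub>" by blast
  qed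
  interpret E: comm_group E by (rule E)
  have snd_pow: "snd (u [^]\<^bsub>E\<^esub> m) i = snd u i [^]\<^bsub>B\<^esub> m" if "u \<in> carrier E" for u i and m :: int
  proof -
    have "(\<lambda>u. snd u i) \<in> hom E B" by (auto simp: hom_def E_def)
    from hom_int_pow[OF this that] show ?thesis by (simp add: E.is_group B.is_group)
  qed
  define K where "K = {(a, x) \<in> carrier E. eventually (\<lambda>i. x i = \<one>\<^bsub>B\<^esub>) U}"
  have K: "subgroup K E"
  proof
    show "K \<subseteq> carrier E" by (auto simp: K_def)
    show "\<one>\<^bsub>E\<^esub> \<in> K" using E.one_closed by (auto simp: K_def E_one)
    show "u \<otimes>\<^bsub>E\<^esub> v \<in> K" if uv: "u \<in> K" "v \<in> K" for u v
    proof -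
      obtain a x b y where u: "u = (a, x)" "u \<in> carrier E" "eventually (\<lambda>i. x i = \<one>\<^bsub>B\<^esub>) U"
        and v: "v = (b, y)" "v \<in> carrier E" "eventually (\<lambda>i. y i = \<one>\<^bsub>B\<^esub>) U"
        using uv by (cases u, cases v) (simp add: K_def)
      have "eventually (\<lambda>i. x i \<otimes>\<^bsub>B\<^esub> y i = \<one>\<^bsub>B\<^esub>) U"
        using u(3) v(3) by eventually_elim simp
      with E.m_closed[OF u(2) v(2)] show ?thesis by (simp add: K_def u(1) v(1) E_mult)
    qed
    show "inv\<^bsub>E\<^esub> u \<in> K" if uK: "u \<in> K" for u
    proof -
      obtain a x where u: "u = (a, x)" "u \<in> carrier E" "eventually (\<lambda>i. x i = \<one>\<^bsub>B\<^esub>) U"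
        using uK by (cases u) (simp add: K_def)
      have "snd (inv\<^bsub>E\<^esub> u) i = inv\<^bsub>B\<^esub> (x i)" for i
        using snd_pow[OF u(2), of "- 1" i] u by (simp add: E.int_pow_neg B.int_pow_neg E_carrier Pi_iff)
      then have "eventually (\<lambda>i. snd (inv\<^bsub>E\<^esub> u) i = \<one>\<^bsub>B\<^esub>) U"
        using u(3) by (auto elim: eventually_mono)
      with E.inv_closed[OF u(2)] show ?thesis by (auto simp: K_def split: prod.split)
    qed
  qed
  have isolated: "u \<in> K" if u: "u \<in> carrier E" and m: "m \<noteq> 0" and um: "u [^]\<^bsub>E\<^esub> m \<in> K" for u and m :: int
  proof -
    have "eventually (\<lambda>i. snd (u [^]\<^bsub>E\<^esub> m) i = \<one>\<^bsub>B\<^esub>) U" using um by (auto simp: K_def)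
    moreover have "snd u i \<in> carrier B" for i using u by (auto simp: E_def)
    ultimately have "eventually (\<lambda>i. snd u i = \<one>\<^bsub>B\<^esub>) U"
      by (elim eventually_mono) (use torsion_free[OF _ m] snd_pow[OF u] in auto)
    with u show ?thesis by (auto simp: K_def)
  qed
  have h: "(\<lambda>u. ultra_class A (fst u)) \<in> hom (E\<lparr>carrier := K\<rparr>) (ultrapower A)"
  proof (rule homI)
    fix u assume "u \<in> carrier (E\<lparr>carrier := K\<rparr>)"
    then show "ultra_class A (fst u) \<in> carrier (ultrapower A)"
      by (auto simp: K_def E_carrier intro: ultra_class_closed[OF A])
  next
    fix u v assume "u \<in> carrier (E\<lparr>carrier := K\<rparr>)" "v \<in> carrier (E\<lparr>carrier := K\<rparr>)"
    then obtain a x b y where u: "u = (a, x)" "a \<in> ?SA" "x \<in> ?SB" "eventually (\<lambda>i. x i = \<one>\<^bsub>B\<^esub>) U"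
      and v: "v = (b, y)" "b \<in> ?SA" "y \<in> ?SB"
      by (cases u, cases v) (simp add: K_def E_carrier)
    have "eventually (\<lambda>i. a i \<otimes> b i \<otimes> f (x i) (y i) = a i \<otimes> b i) U"
      using u(4) by eventually_elim (use u v in \<open>auto simp: f1 Pi_iff\<close>)
    then have "ultra_class A (\<lambda>i. a i \<otimes> b i \<otimes> f (x i) (y i)) = ultra_class A (\<lambda>i. a i \<otimes> b i)"
      by (subst ultra_class_eq_iff[OF A]) (use u v in \<open>auto simp: fc Pi_iff\<close>)
    also have "\<dots> = ultra_class A a \<otimes>\<^bsub>ultrapower A\<^esub> ultra_class A b"
      by (rule ultra_class_mult[OF A u(2) v(2)])
    finally show "ultra_class A (fst (u \<otimes>\<^bsub>E\<lparr>carrier := K\<rparr>\<^esub> v)) =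
        ultra_class A (fst u) \<otimes>\<^bsub>ultrapower A\<^esub> ultra_class A (fst v)"
      by (simp add: u v E_mult)
  qed
  have "\<exists>\<rho>\<in>hom E (ultrapower A). \<forall>u\<in>K. \<rho> u = ultra_class A (fst u)"
    by (rule hom_extends_across_torsion_free_quotient[OF E comm_group_ultrapower[OF A]
        ultrapower_countably_solvable[OF A] K _ h]) (rule isolated)
  then obtain \<rho> where \<rho>: "\<rho> \<in> hom E (ultrapower A)" and \<rho>K: "\<forall>u\<in>K. \<rho> u = ultra_class A (fst u)"
    by (rule bexE)
  have \<rho>_mult: "\<rho> (u \<otimes>\<^bsub>E\<^esub> v) = \<rho> u \<otimes>\<^bsub>ultrapower A\<^esub> \<rho> v" if "u \<in> carrier E" "v \<in> carrier E" for u v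
    using \<rho> that by (auto simp: hom_def)
  let ?s = "\<lambda>x :: nat \<Rightarrow> 'b. (\<lambda>i. \<one>, x)"
  have s: "?s x \<in> carrier E" if "x \<in> ?SB" for x using that by (simp add: E_carrier)
  have "\<forall>x. \<exists>a. x \<in> ?SB \<longrightarrow> a \<in> ?SA \<and> \<rho> (?s x) = ultra_class A a"
    using \<rho> s ultra_class_surj[OF A] by (metis hom_in_carrier)
  then obtain g where g: "\<And>x. x \<in> ?SB \<Longrightarrow> g x \<in> ?SA" "\<And>x. x \<in> ?SB \<Longrightarrow> \<rho> (?s x) = ultra_class A (g x)"
    by metis
  have "eventually (\<lambda>i. f (x i) (y i) \<otimes> g (\<lambda>i. x i \<otimes>\<^bsub>B\<^esub> y i) i = g x i \<otimes> g y i) U"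
    if x: "x \<in> ?SB" and y: "y \<in> ?SB" for x y
  proof -
    let ?xy = "\<lambda>i. x i \<otimes>\<^bsub>B\<^esub> y i" and ?f = "\<lambda>i. f (x i) (y i)"
    have xy: "?xy \<in> ?SB" and fxy: "?f \<in> ?SA" using x y by (auto simp: fc Pi_iff)
    have fK: "(?f, \<lambda>i. \<one>\<^bsub>B\<^esub>) \<in> K" using fxy by (auto simp: K_def E_carrier)
    \<comment> \<open>the cocycle is the failure of the section to be multiplicative\<close>
    have "?s x \<otimes>\<^bsub>E\<^esub> ?s y = (?f, \<lambda>i. \<one>\<^bsub>B\<^esub>) \<otimes>\<^bsub>E\<^esub> ?s ?xy"
      using x y fxy xy by (auto simp: E_mult fun_eq_iff Pi_iff f1)
    then have "\<rho> (?s x) \<otimes>\<^bsub>ultrapower A\<^esub> \<rho> (?s y) = \<rho> (?f, \<lambda>i. \<one>\<^bsub>B\<^esub>) \<otimes>\<^bsub>ultrapower A\<^esub> \<rho> (?s ?xy)"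
      by (simp only: \<rho>_mult[OF subgroup.mem_carrier[OF K fK] s[OF xy]] flip: \<rho>_mult[OF s[OF x] s[OF y]])
    then have "ultra_class A (\<lambda>i. ?f i \<otimes> g ?xy i) = ultra_class A (\<lambda>i. g x i \<otimes> g y i)"
      using g x y xy fxy bspec[OF \<rho>K fK] by (simp add: ultra_class_mult[OF A])
    then show ?thesis
      by (subst (asm) ultra_class_eq_iff[OF A]) (use g(1)[OF x] g(1)[OF y] g(1)[OF xy] fxy in \<open>auto simp: Pi_iff\<close>)
  qed
  moreover have "eventually (\<lambda>i. g x i = g y i) U"
    if x: "x \<in> ?SB" and y: "y \<in> ?SB" and ev: "eventually (\<lambda>i. x i = y i) U" for x y
  proof -
    \<comment> \<open>both elements of the section differ by a pair in \<open>K\<close> with first component trivial almost everywhere\<close>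
    let ?z = "\<lambda>i. x i \<otimes>\<^bsub>B\<^esub> inv\<^bsub>B\<^esub> y i" and ?d = "\<lambda>i. inv f (x i \<otimes>\<^bsub>B\<^esub> inv\<^bsub>B\<^esub> y i) (y i)"
    have c: "x i \<in> carrier B" "y i \<in> carrier B" "f (x i \<otimes>\<^bsub>B\<^esub> inv\<^bsub>B\<^esub> y i) (y i) \<in> carrier A" for i
      using x y by (auto simp: Pi_iff intro!: fc)
    have z: "?z \<in> ?SB" and d: "?d \<in> ?SA" using c by auto
    have evz: "eventually (\<lambda>i. ?z i = \<one>\<^bsub>B\<^esub>) U" using ev by eventually_elim (use c in simp)
    then have evd: "eventually (\<lambda>i. ?d i = \<one>) U" by eventually_elim (use c in \<open>simp add: f1\<close>)
    have dK: "(?d, ?z) \<in> K" using evz z d by (simp add: K_def E_carrier)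
    have "?s x = (?d, ?z) \<otimes>\<^bsub>E\<^esub> ?s y"
      using c by (auto simp: E_mult fun_eq_iff B.m_assoc)
    then have "\<rho> (?s x) = \<rho> (?d, ?z) \<otimes>\<^bsub>ultrapower A\<^esub> \<rho> (?s y)"
      by (simp only: \<rho>_mult[OF subgroup.mem_carrier[OF K dK] s[OF y]])
    also have "\<dots> = ultra_class A ?d \<otimes>\<^bsub>ultrapower A\<^esub> ultra_class A (g y)"
      using bspec[OF \<rho>K dK] g(2)[OF y] by simp
    also have "\<dots> = ultra_class A (\<lambda>i. ?d i \<otimes> g y i)" by (rule ultra_class_mult[OF A d g(1)[OF y], symmetric])
    finally have "ultra_class A (g x) = ultra_class A (\<lambda>i. ?d i \<otimes> g y i)" using g(2)[OF x] by simp
    then have "eventually (\<lambda>i. g x i = ?d i \<otimes> g y i) U"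
      by (subst (asm) ultra_class_eq_iff[OF A]) (use g(1)[OF x] g(1)[OF y] d in \<open>auto simp: Pi_iff\<close>)
    then show ?thesis using evd by eventually_elim (use g(1)[OF y] in \<open>auto simp: Pi_iff\<close>)
  qed
  ultimately show ?thesis using g(1) by (intro exI[of _ g]) blast
qed

end

section \<open>Terms over rings of characteristic zero\<close>

primrec nat_term :: "nat \<Rightarrow> ring_term" where
  "nat_term 0 = RZero"
| "nat_term (Suc n) = RAdd (nat_term n) ROne"

definition int_term :: "int \<Rightarrow> ring_term" where
  "int_term z = (if z \<ge> 0 then nat_term (nat z) else RNeg (nat_term (nat (- z))))"

context ring
begin

lemma ring_term_val_closed [simp]:
  "v \<in> sequences R \<Longrightarrow> ring_term_val R v t \<in> carrier R"
  by (induction t) auto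

lemma nat_embed_closed [simp]: "[(n::nat)] \<cdot> \<one> \<in> carrier R"
  by simp

lemma nat_embed_mult: "[(m * n :: nat)] \<cdot> \<one> = [m] \<cdot> \<one> \<otimes> [n] \<cdot> \<one>"
  using add.nat_pow_pow[of "\<one>" m n] by (simp add: add_pow_ldistr mult.commute)

lemma int_embed_mult: "[(m * n :: int)] \<cdot> \<one> = [m] \<cdot> \<one> \<otimes> [n] \<cdot> \<one>"
  using add.int_pow_pow[of "\<one>" m n] by (simp add: add_pow_ldistr_int mult.commute)

lemma int_embed_add: "[(m + n :: int)] \<cdot> \<one> = [m] \<cdot> \<one> \<oplus> [n] \<cdot> \<one>"
  by (simp add: add.int_pow_mult)

lemma int_embed_minus: "[(- m :: int)] \<cdot> \<one> = \<ominus> ([m] \<cdot> \<one>)"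
  by (simp add: add.int_pow_neg)

lemma int_embed_of_nat: "[int n] \<cdot> \<one> = [n] \<cdot> \<one>"
  by (simp add: add_pow_int_ge)

lemma int_embed_scale: "x \<in> carrier R \<Longrightarrow> [(z::int)] \<cdot> x = [z] \<cdot> \<one> \<otimes> x"
  by (simp add: add_pow_ldistr_int)

lemma int_embed_0: "[(0::int)] \<cdot> \<one> = \<zero>"
  by (simp add: add_pow_int_ge)

lemma int_embed_1: "[(1::int)] \<cdot> \<one> = \<one>"
  by (simp add: add_pow_int_ge)

lemma nat_term_val: "ring_term_val R v (nat_term n) = [n] \<cdot> \<one>"
  by (induction n) simp_all

lemma int_term_val: "ring_term_val R v (int_term z) = [z] \<cdot> \<one>"
  by (simp add: int_term_def nat_term_val add_pow_int_ge add_pow_int_lt)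

end

lemma int_nat_embed [simp]: "[(n::nat)] \<cdot>\<^bsub>\<Z>\<^esub> (1::int) = int n"
proof (induction n)
  case (Suc n)
  have "[Suc n] \<cdot>\<^bsub>\<Z>\<^esub> (1::int) = [n] \<cdot>\<^bsub>\<Z>\<^esub> (1::int) + 1"
    by (simp add: add_pow_def)
  with Suc show ?case by simp
qed (simp add: add_pow_def)

lemma ring_term_val_cong:
  "(\<And>k. k \<in> ring_term_vars t \<Longrightarrow> v k = w k) \<Longrightarrow> ring_term_val R v t = ring_term_val R w t"
  by (induction t) auto

lemma finite_ring_term_vars: "finite (ring_term_vars t)"
  by (induction t) auto

lemma (in ring) ring_term_val_int_embed:
  "ring_term_val R (\<lambda>k. [v k] \<cdot> \<one>) t = [ring_term_val \<Z> v t] \<cdot> \<one>"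
proof (induction t)
  case (RNeg t)
  have "\<ominus>\<^bsub>\<Z>\<^esub> x = - x" for x by (rule int_a_inv_eq)
  with RNeg show ?case by (simp add: int_embed_minus)
qed (simp_all add: int_embed_mult int_embed_add int_embed_0 int_embed_1)

lemma (in domain) ring_term_univariate_poly:
  assumes v: "v \<in> sequences R"
  shows "\<exists>p \<in> carrier (poly_ring R). \<forall>x\<in>carrier R. eval p x = ring_term_val R (v(k := x)) t"
proof -
  have K: "subring (carrier R) R" by (rule carrier_is_subring)
  interpret P: ring "poly_ring R" using univ_poly_is_ring[OF K] .
  have hom: "ring_hom_ring (poly_ring R) R (\<lambda>p. eval p x)" if "x \<in> carrier R" for x
    by (rule eval_ring_hom[OF K that])
  have const: "\<exists>p \<in> carrier (poly_ring R). \<forall>x\<in>carrier R. eval p x = a" if a: "a \<in> carrier R" for a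
  proof (cases "a = \<zero>")
    case True
    then show ?thesis by (intro bexI[of _ "[]"]) (auto simp: univ_poly_def)
  next
    case False
    with a show ?thesis by (intro bexI[of _ "[a]"]) (auto simp: univ_poly_def polynomial_def)
  qed
  show ?thesis
  proof (induction t)
    case (RVar j)
    show ?case
    proof (cases "j = k")
      case True
      then show ?thesis
        using var_closed(1)[OF K] eval_var by (intro bexI[of _ "var R"]) auto
    next
      case False
      then show ?thesis using const[of "v j"] v by auto
    qed
  next
    case RZero
    then show ?case using const by simp
  next
    case ROne
    then show ?case using const by simp
  next
    case (RNeg t)
    then obtain p where p: "p \<in> carrier (poly_ring R)"
      "\<forall>x\<in>carrier R. eval p x = ring_term_val R (v(k := x)) t" by blast
    have "eval (\<ominus>\<^bsub>poly_ring R\<^esub> p) x = \<ominus> (eval p x)" if "x \<in> carrier R" for x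
    proof -
      interpret h: ring_hom_ring "poly_ring R" R "\<lambda>p. eval p x" by (rule hom[OF that])
      show ?thesis using p by simp
    qed
    with p show ?case by (intro bexI[of _ "\<ominus>\<^bsub>poly_ring R\<^esub> p"]) (auto simp: fun_upd_def)
  next
    case (RAdd s t)
    then obtain p q where p: "p \<in> carrier (poly_ring R)"
      "\<forall>x\<in>carrier R. eval p x = ring_term_val R (v(k := x)) s"
      and q: "q \<in> carrier (poly_ring R)"
      "\<forall>x\<in>carrier R. eval q x = ring_term_val R (v(k := x)) t" by blast
    have "eval (p \<oplus>\<^bsub>poly_ring R\<^esub> q) x = eval p x \<oplus> eval q x" if "x \<in> carrier R" for x
    proof -
      interpret h: ring_hom_ring "poly_ring R" R "\<lambda>p. eval p x" by (rule hom[OF that])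
      show ?thesis using p q by simp
    qed
    with p q show ?case by (intro bexI[of _ "p \<oplus>\<^bsub>poly_ring R\<^esub> q"]) (auto simp: fun_upd_def)
  next
    case (RMul s t)
    then obtain p q where p: "p \<in> carrier (poly_ring R)"
      "\<forall>x\<in>carrier R. eval p x = ring_term_val R (v(k := x)) s"
      and q: "q \<in> carrier (poly_ring R)"
      "\<forall>x\<in>carrier R. eval q x = ring_term_val R (v(k := x)) t" by blast
    have "eval (p \<otimes>\<^bsub>poly_ring R\<^esub> q) x = eval p x \<otimes> eval q x" if "x \<in> carrier R" for x
    proof -
      interpret h: ring_hom_ring "poly_ring R" R "\<lambda>p. eval p x" by (rule hom[OF that])
      show ?thesis using p q by simp
    qed
    with p q show ?case by (intro bexI[of _ "p \<otimes>\<^bsub>poly_ring R\<^esub> q"]) (auto simp: fun_upd_def)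
  qed
qed

text \<open>The variables are released from the integers one at a time: as a function of one variable the term is a
polynomial, and all images of natural numbers, of which there are infinitely many, are roots of it.\<close>

lemma (in domain) ring_term_zero_if_zero_on_ints:
  assumes char0: "\<And>k::nat. k > 0 \<Longrightarrow> [k] \<cdot> \<one> \<noteq> \<zero>"
    and zero: "\<And>v. ring_term_val \<Z> v t = 0"
    and v: "v \<in> sequences R"
  shows "ring_term_val R v t = \<zero>"
proof -
  have inj: "inj (\<lambda>n::nat. [n] \<cdot> \<one>)"
  proof (rule linorder_injI)
    fix m n :: nat assume "m < n"
    then have "[n] \<cdot> \<one> = [m] \<cdot> \<one> \<oplus> [(n - m)] \<cdot> \<one>" by (simp add: add.nat_pow_mult)
    moreover have "[(n - m)] \<cdot> \<one> \<noteq> \<zero>" using char0 \<open>m < n\<close> by simp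
    ultimately show "[m] \<cdot> \<one> \<noteq> [n] \<cdot> \<one>"
      using add.r_cancel_one'[of "[(n - m)] \<cdot> \<one>" "[m] \<cdot> \<one>"] by simp
  qed
  have "ring_term_val R v t = \<zero>"
    if "finite A" "v \<in> sequences R" "\<forall>k\<in>ring_term_vars t - A. \<exists>z::int. v k = [z] \<cdot> \<one>" for A v
    using that
  proof (induction A arbitrary: v rule: finite_induct)
    case empty
    then obtain z :: "nat \<Rightarrow> int" where "\<And>k. k \<in> ring_term_vars t \<Longrightarrow> v k = [z k] \<cdot> \<one>" by simp metis
    then have "ring_term_val R v t = ring_term_val R (\<lambda>k. [z k] \<cdot> \<one>) t" by (rule ring_term_val_cong)
    then show ?case by (simp add: ring_term_val_int_embed zero int_embed_0)
  next
    case (insert k A)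
    obtain p where p: "p \<in> carrier (poly_ring R)"
      "\<forall>x\<in>carrier R. eval p x = ring_term_val R (v(k := x)) t"
      using ring_term_univariate_poly[OF insert.prems(1)] by blast
    have "eval p ([n] \<cdot> \<one>) = \<zero>" for n :: nat
    proof -
      have "ring_term_val R (v(k := [n] \<cdot> \<one>)) t = \<zero>"
      proof (rule insert.IH)
        show "v(k := [n] \<cdot> \<one>) \<in> sequences R" using insert.prems by auto
        show "\<forall>j\<in>ring_term_vars t - A. \<exists>z::int. (v(k := [n] \<cdot> \<one>)) j = [z] \<cdot> \<one>"
          using insert.prems(2) int_embed_of_nat[of n] by (auto split: if_splits intro: exI[of _ "int n"])
      qed
      with p show ?thesis by simp
    qed
    then have "range (\<lambda>n::nat. [n] \<cdot> \<one>) \<subseteq> {x. is_root p x}" if "p \<noteq> []"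
      using that by (auto simp: is_root_def)
    then have "p = []"
      using finite_number_of_roots[OF p(1)] inj finite_imageD[of "\<lambda>n::nat. [n] \<cdot> \<one>" UNIV]
      by (meson finite_subset infinite_UNIV_nat)
    moreover have "v k \<in> carrier R" using insert.prems(1) by auto
    ultimately show ?case using bspec[OF p(2), of "v k"] by simp
  qed
  from this[OF finite_ring_term_vars[of t] v] show ?thesis by simp
qed

lemma falling_factorial_int: "falling_factorial \<Z> a k = (\<Prod>i<k. a - int i)"
proof -
  have "comm_monoid \<Z>" by unfold_locales
  then have "finprod \<Z> f A = prod f A" for f :: "nat \<Rightarrow> int" and A
    by (induction A rule: infinite_finite_induct) (simp_all add: comm_monoid.finprod_insert comm_monoid.finprod_empty comm_monoid.finprod_infinite)
  then show ?thesis
    by (simp add: falling_factorial_def a_minus_def int_a_inv_eq)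
qed

lemma binomial_domain_int: "binomial_domain \<Z>"
proof
  show "[k] \<cdot>\<^bsub>\<Z>\<^esub> \<one>\<^bsub>\<Z>\<^esub> \<noteq> \<zero>\<^bsub>\<Z>\<^esub>" if "k > 0" for k :: nat using that by simp
  show "\<exists>!x. x \<in> carrier \<Z> \<and> falling_factorial \<Z> a k = x \<otimes>\<^bsub>\<Z>\<^esub> ([(fact k :: nat)] \<cdot>\<^bsub>\<Z>\<^esub> \<one>\<^bsub>\<Z>\<^esub>)"
    for a k
  proof -
    obtain w :: int where f: "falling_factorial \<Z> a k = w * fact k"
      using gbinomial_int_mult_fact'[of a k, symmetric]
      unfolding falling_factorial_int atLeast0LessThan by blast
    show ?thesis by (rule ex1I, rule conjI, simp, simp add: f, simp add: f)
  qed
qed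

section \<open>Functions given by rational polynomials\<close>

text \<open>In a domain of characteristic zero a positive \<open>N\<close> can be cancelled, so that \<open>N\<close> and \<open>t\<close>
then determine \<open>F\<close>.\<close>

definition is_fraction :: "('a, 'm) ring_scheme \<Rightarrow> ((nat \<Rightarrow> 'a) \<Rightarrow> 'a) \<Rightarrow> nat \<Rightarrow> ring_term \<Rightarrow> bool" where
  "is_fraction R F N t \<longleftrightarrow> (\<forall>v\<in>sequences R.
     F v \<in> carrier R \<and> [N] \<cdot>\<^bsub>R\<^esub> \<one>\<^bsub>R\<^esub> \<otimes>\<^bsub>R\<^esub> F v = ring_term_val R v t)"

text \<open>The numerator of the falling factorial of the fraction \<open>t / N\<close>; its denominator is \<open>N ^ k\<close>.\<close>

primrec falling_term :: "ring_term \<Rightarrow> nat \<Rightarrow> nat \<Rightarrow> ring_term" where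
  "falling_term t N 0 = ROne"
| "falling_term t N (Suc k) = RMul (falling_term t N k) (RAdd t (RNeg (nat_term (N * k))))"

lemma is_fractionD:
  assumes "is_fraction R F N t" "v \<in> sequences R"
  shows "F v \<in> carrier R" "[N] \<cdot>\<^bsub>R\<^esub> \<one>\<^bsub>R\<^esub> \<otimes>\<^bsub>R\<^esub> F v = ring_term_val R v t"
  using assms by (auto simp: is_fraction_def)

context binomial_domain
begin

lemma ring_binom:
  assumes a: "a \<in> carrier R"
  shows "ring_binom R a k \<in> carrier R"
    and "falling_factorial R a k = ring_binom R a k \<otimes> [(fact k :: nat)] \<cdot> \<one>"
proof -
  let ?P = "\<lambda>x. x \<in> carrier R \<and> falling_factorial R a k = x \<otimes> [(fact k :: nat)] \<cdot> \<one>"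
  have "\<exists>!x. ?P x"
  proof (cases "k = 0")
    case True
    show ?thesis
      by (rule ex1I[where a = \<one>]) (auto simp: True falling_factorial_def)
  next
    case False
    then show ?thesis using ex1_binom[OF a, of k] by simp
  qed
  from theI'[OF this] show "ring_binom R a k \<in> carrier R"
    "falling_factorial R a k = ring_binom R a k \<otimes> [(fact k :: nat)] \<cdot> \<one>"
    by (simp_all add: ring_binom_def)
qed

lemma falling_factorial_Suc:
  "a \<in> carrier R \<Longrightarrow> falling_factorial R a (Suc k) = falling_factorial R a k \<otimes> (a \<ominus> [k] \<cdot> \<one>)"
  unfolding falling_factorial_def lessThan_Suc
  by (subst finprod_insert) (auto simp: m_comm)

lemma is_fraction_var: "is_fraction R (\<lambda>v. v k) 1 (RVar k)"
  by (auto simp: is_fraction_def Pi_iff)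

lemma is_fraction_int: "is_fraction R (\<lambda>v. [z] \<cdot> \<one>) 1 (int_term z)"
  by (auto simp: is_fraction_def int_term_val)

lemma is_fraction_add:
  assumes F: "is_fraction R F N s" and G: "is_fraction R G M t"
  shows "is_fraction R (\<lambda>v. F v \<oplus> G v) (N * M) (RAdd (RMul (nat_term M) s) (RMul (nat_term N) t))"
  unfolding is_fraction_def
proof
  fix v :: "nat \<Rightarrow> 'a" assume v: "v \<in> sequences R"
  note f = is_fractionD[OF F v] and g = is_fractionD[OF G v]
  show "F v \<oplus> G v \<in> carrier R \<and> [(N * M)] \<cdot> \<one> \<otimes> (F v \<oplus> G v) =
      ring_term_val R v (RAdd (RMul (nat_term M) s) (RMul (nat_term N) t))"
    using f(1) g(1) by (simp add: nat_term_val nat_embed_mult r_distr m_ac flip: f(2) g(2))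
qed

lemma is_fraction_mult:
  assumes F: "is_fraction R F N s" and G: "is_fraction R G M t"
  shows "is_fraction R (\<lambda>v. F v \<otimes> G v) (N * M) (RMul s t)"
  unfolding is_fraction_def
proof
  fix v :: "nat \<Rightarrow> 'a" assume v: "v \<in> sequences R"
  note f = is_fractionD[OF F v] and g = is_fractionD[OF G v]
  show "F v \<otimes> G v \<in> carrier R \<and> [(N * M)] \<cdot> \<one> \<otimes> (F v \<otimes> G v) = ring_term_val R v (RMul s t)"
    using f(1) g(1) by (simp add: nat_embed_mult m_ac flip: f(2) g(2))
qed

lemma is_fraction_falling_factorial:
  assumes F: "is_fraction R F N t"
  shows "is_fraction R (\<lambda>v. falling_factorial R (F v) k) (N ^ k) (falling_term t N k)"
proof (induction k)
  case 0
  then show ?case by (simp add: is_fraction_def falling_factorial_def)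
next
  case (Suc k)
  show ?case
    unfolding is_fraction_def
  proof
    fix v :: "nat \<Rightarrow> 'a" assume v: "v \<in> sequences R"
    note f = is_fractionD[OF F v] and g = is_fractionD[OF Suc v]
    have "[N] \<cdot> \<one> \<otimes> (F v \<ominus> [k] \<cdot> \<one>) = ring_term_val R v (RAdd t (RNeg (nat_term (N * k))))"
      using f(1) by (simp add: nat_term_val nat_embed_mult a_minus_def r_distr r_minus flip: f(2))
    moreover have "[(N ^ Suc k)] \<cdot> \<one> \<otimes> (falling_factorial R (F v) k \<otimes> (F v \<ominus> [k] \<cdot> \<one>)) =
        ([(N ^ k)] \<cdot> \<one> \<otimes> falling_factorial R (F v) k) \<otimes> ([N] \<cdot> \<one> \<otimes> (F v \<ominus> [k] \<cdot> \<one>))"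
      using f(1) g(1) by (simp add: nat_embed_mult m_ac)
    ultimately show "falling_factorial R (F v) (Suc k) \<in> carrier R \<and>
        [(N ^ Suc k)] \<cdot> \<one> \<otimes> falling_factorial R (F v) (Suc k) =
        ring_term_val R v (falling_term t N (Suc k))"
      using f(1) g by (simp only: falling_factorial_Suc falling_term.simps ring_term_val.simps) simp
  qed
qed

lemma is_fraction_binom:
  assumes F: "is_fraction R F N t"
  shows "is_fraction R (\<lambda>v. ring_binom R (F v) k) (N ^ k * fact k) (falling_term t N k)"
  unfolding is_fraction_def
proof
  fix v :: "nat \<Rightarrow> 'a" assume v: "v \<in> sequences R"
  note f = is_fractionD[OF F v] and g = is_fractionD[OF is_fraction_falling_factorial[OF F] v]
  show "ring_binom R (F v) k \<in> carrier R \<and>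
      [(N ^ k * fact k :: nat)] \<cdot> \<one> \<otimes> ring_binom R (F v) k = ring_term_val R v (falling_term t N k)"
    using ring_binom[OF f(1), of k] by (simp add: nat_embed_mult m_ac flip: g(2))
qed

lemma nat_embed_cancel:
  assumes "(N::nat) > 0" "x \<in> carrier R" "y \<in> carrier R" "[N] \<cdot> \<one> \<otimes> x = [N] \<cdot> \<one> \<otimes> y"
  shows "x = y"
  using assms(2-) m_lcancel[of "[N] \<cdot> \<one>" x y] char_zero[OF assms(1)] by simp

lemma fraction_eq_iff:
  assumes F: "is_fraction R F N t" and F': "is_fraction R F' N' t'" and N: "N > 0" "N' > 0"
    and v: "v \<in> sequences R"
  shows "F v = F' v \<longleftrightarrow>
    ring_term_val R v (RMul (nat_term N') t) = ring_term_val R v (RMul (nat_term N) t')"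
proof -
  note f = is_fractionD[OF F v] and f' = is_fractionD[OF F' v]
  have "N * N' > 0" using N by simp
  from nat_embed_cancel[OF this f(1) f'(1)]
  have "F v = F' v \<longleftrightarrow> [(N * N')] \<cdot> \<one> \<otimes> F v = [(N * N')] \<cdot> \<one> \<otimes> F' v" by auto
  then show ?thesis
    using f(1) f'(1) by (simp add: nat_term_val nat_embed_mult m_ac flip: f(2) f'(2))
qed

end

text \<open>The point is that the same term and the same denominator serve for both rings. For two rings whose theories are to
be compared this gives common translations into ring formulas; when the first ring consists of the integers, it
transfers identities to the second one.\<close>

definition uniformly_rational ::
  "('a, 'm) ring_scheme \<Rightarrow> ('b, 'n) ring_scheme \<Rightarrow> ((nat \<Rightarrow> 'a) \<Rightarrow> 'a) \<Rightarrow> ((nat \<Rightarrow> 'b) \<Rightarrow> 'b) \<Rightarrow> bool" where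
  "uniformly_rational R S F G \<longleftrightarrow> (\<exists>N>0. \<exists>t. is_fraction R F N t \<and> is_fraction S G N t)"

locale binomial_domain_pair = R: binomial_domain R + S: binomial_domain S
  for R :: "('a, 'm) ring_scheme" and S :: "('b, 'n) ring_scheme"
begin

abbreviation "rational \<equiv> uniformly_rational R S"

lemma rational_var: "rational (\<lambda>v. v k) (\<lambda>v. v k)"
  unfolding uniformly_rational_def
  by (rule exI[of _ 1]) (use R.is_fraction_var S.is_fraction_var in auto)

lemma rational_int: "rational (\<lambda>v. [(z::int)] \<cdot>\<^bsub>R\<^esub> \<one>\<^bsub>R\<^esub>) (\<lambda>v. [z] \<cdot>\<^bsub>S\<^esub> \<one>\<^bsub>S\<^esub>)"
  unfolding uniformly_rational_def
  by (rule exI[of _ 1]) (use R.is_fraction_int S.is_fraction_int in auto)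

lemma rational_add:
  assumes "rational F G" "rational F' G'"
  shows "rational (\<lambda>v. F v \<oplus>\<^bsub>R\<^esub> F' v) (\<lambda>v. G v \<oplus>\<^bsub>S\<^esub> G' v)"
proof -
  from assms obtain N t N' t' where "N > 0" "is_fraction R F N t" "is_fraction S G N t"
    "N' > 0" "is_fraction R F' N' t'" "is_fraction S G' N' t'"
    unfolding uniformly_rational_def by blast
  then show ?thesis
    unfolding uniformly_rational_def
    by (intro exI[of _ "N * N'"] conjI) (auto intro: R.is_fraction_add S.is_fraction_add)
qed

lemma rational_mult:
  assumes "rational F G" "rational F' G'"
  shows "rational (\<lambda>v. F v \<otimes>\<^bsub>R\<^esub> F' v) (\<lambda>v. G v \<otimes>\<^bsub>S\<^esub> G' v)"
proof -
  from assms obtain N t N' t' where "N > 0" "is_fraction R F N t" "is_fraction S G N t"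
    "N' > 0" "is_fraction R F' N' t'" "is_fraction S G' N' t'"
    unfolding uniformly_rational_def by blast
  then show ?thesis
    unfolding uniformly_rational_def
    by (intro exI[of _ "N * N'"] conjI) (auto intro: R.is_fraction_mult S.is_fraction_mult)
qed

lemma rational_binom:
  assumes "rational F G"
  shows "rational (\<lambda>v. ring_binom R (F v) k) (\<lambda>v. ring_binom S (G v) k)"
proof -
  from assms obtain N t where "N > 0" "is_fraction R F N t" "is_fraction S G N t"
    unfolding uniformly_rational_def by blast
  then show ?thesis
    unfolding uniformly_rational_def
    by (intro exI[of _ "N ^ k * fact k"] conjI) (auto intro: R.is_fraction_binom S.is_fraction_binom)
qed

lemma rational_closed:
  assumes "rational F G"
  shows "v \<in> sequences R \<Longrightarrow> F v \<in> carrier R" "w \<in> sequences S \<Longrightarrow> G w \<in> carrier S"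
  using assms by (auto simp: uniformly_rational_def is_fraction_def)

lemma rational_cong:
  assumes "rational F G" "\<And>v. v \<in> sequences R \<Longrightarrow> F v = F' v" "\<And>v. v \<in> sequences S \<Longrightarrow> G v = G' v"
  shows "rational F' G'"
  using assms by (simp add: uniformly_rational_def is_fraction_def)

lemma rational_zero: "rational (\<lambda>v. \<zero>\<^bsub>R\<^esub>) (\<lambda>v. \<zero>\<^bsub>S\<^esub>)"
  using rational_int[of 0] by (simp add: R.int_embed_0 S.int_embed_0)

lemma rational_one: "rational (\<lambda>v. \<one>\<^bsub>R\<^esub>) (\<lambda>v. \<one>\<^bsub>S\<^esub>)"
  using rational_int[of 1] by (simp add: R.int_embed_1 S.int_embed_1)

lemma rational_minus_one: "rational (\<lambda>v. \<ominus>\<^bsub>R\<^esub> \<one>\<^bsub>R\<^esub>) (\<lambda>v. \<ominus>\<^bsub>S\<^esub> \<one>\<^bsub>S\<^esub>)"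
  using rational_int[of "- 1"] by (simp add: R.int_embed_minus S.int_embed_minus R.int_embed_1 S.int_embed_1)

lemma rational_int_scale:
  assumes "rational F G"
  shows "rational (\<lambda>v. [(z::int)] \<cdot>\<^bsub>R\<^esub> F v) (\<lambda>v. [z] \<cdot>\<^bsub>S\<^esub> G v)"
  by (rule rational_cong[OF rational_mult[OF rational_int[of z] assms]])
    (simp_all add: R.int_embed_scale[symmetric] S.int_embed_scale[symmetric] rational_closed[OF assms])

lemma rational_finprod:
  assumes "finite A" "\<And>x. x \<in> A \<Longrightarrow> rational (F x) (G x)"
  shows "rational (\<lambda>v. finprod R (\<lambda>x. F x v) A) (\<lambda>v. finprod S (\<lambda>x. G x v) A)"
  using assms
proof (induction A rule: finite_induct)
  case empty
  then show ?case using rational_one by simp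
next
  case (insert x A)
  then have r: "rational (\<lambda>v. F x v \<otimes>\<^bsub>R\<^esub> finprod R (\<lambda>x. F x v) A) (\<lambda>v. G x v \<otimes>\<^bsub>S\<^esub> finprod S (\<lambda>x. G x v) A)"
    by (intro rational_mult) auto
  show ?case
    by (rule rational_cong[OF r]; subst R.finprod_insert S.finprod_insert)
      (use insert.hyps rational_closed[OF insert.prems] in auto)
qed

lemma rational_finsum:
  assumes "finite A" "\<And>x. x \<in> A \<Longrightarrow> rational (F x) (G x)"
  shows "rational (\<lambda>v. finsum R (\<lambda>x. F x v) A) (\<lambda>v. finsum S (\<lambda>x. G x v) A)"
  using assms
proof (induction A rule: finite_induct)
  case empty
  then show ?case using rational_zero by simp
next
  case (insert x A)
  then have r: "rational (\<lambda>v. F x v \<oplus>\<^bsub>R\<^esub> finsum R (\<lambda>x. F x v) A) (\<lambda>v. G x v \<oplus>\<^bsub>S\<^esub> finsum S (\<lambda>x. G x v) A)"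
    by (intro rational_add) auto
  show ?case
    by (rule rational_cong[OF r]; subst R.finsum_insert S.finsum_insert)
      (use insert.hyps rational_closed[OF insert.prems] in auto)
qed

lemma rational_eval_binom_poly:
  assumes "\<And>x. x \<in> poly_vars P \<Longrightarrow> rational (F x) (G x)"
  shows "rational (\<lambda>v. eval_binom_poly R P (\<lambda>x. F x v)) (\<lambda>v. eval_binom_poly S P (\<lambda>x. G x v))"
  unfolding eval_binom_poly_def
  by (intro rational_finsum rational_int_scale rational_finprod rational_binom assms)
    (auto simp: poly_vars_def)

text \<open>Multiplying crosswise by the denominators loses nothing.\<close>

lemma rational_eq_iff_term_eq:
  assumes "rational F G" "rational F' G'"
  shows "\<exists>s t. (\<forall>v\<in>sequences R. F v = F' v \<longleftrightarrow> ring_term_val R v s = ring_term_val R v t) \<and>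
    (\<forall>v\<in>sequences S. G v = G' v \<longleftrightarrow> ring_term_val S v s = ring_term_val S v t)"
proof -
  from assms obtain N t N' t' where N: "N > 0" "N' > 0" and F: "is_fraction R F N t" "is_fraction R F' N' t'"
    and G: "is_fraction S G N t" "is_fraction S G' N' t'"
    unfolding uniformly_rational_def by blast
  then show ?thesis
    by (intro exI[of _ "RMul (nat_term N') t"] exI[of _ "RMul (nat_term N) t'"] conjI ballI)
      (rule R.fraction_eq_iff[OF F N] S.fraction_eq_iff[OF G N], assumption)+
qed

end

text \<open>After clearing denominators the identity is one between ring terms, that is, between polynomials with integer
coefficients.\<close>

theorem (in binomial_domain) rational_identity_from_int:
  assumes r: "uniformly_rational \<Z> R F G" "uniformly_rational \<Z> R F' G'" and eq: "\<And>v. F v = F' v"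
    and v: "v \<in> sequences R"
  shows "G v = G' v"
proof -
  interpret Z: binomial_domain \<Z> by (rule binomial_domain_int)
  interpret P: binomial_domain_pair \<Z> R by unfold_locales
  from P.rational_eq_iff_term_eq[OF r] obtain s t
    where Z: "\<forall>v\<in>UNIV \<rightarrow> carrier \<Z>. F v = F' v \<longleftrightarrow> ring_term_val \<Z> v s = ring_term_val \<Z> v t"
      and R: "\<forall>v\<in>sequences R. G v = G' v \<longleftrightarrow> ring_term_val R v s = ring_term_val R v t"
    by blast
  have "ring_term_val \<Z> v (RAdd s (RNeg t)) = 0" for v
    using Z eq by (simp add: int_a_inv_eq)
  then have "ring_term_val R v (RAdd s (RNeg t)) = \<zero>"
    using ring_term_zero_if_zero_on_ints[OF char_zero _ v] by blast
  then have "ring_term_val R v s = ring_term_val R v t"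
    using v by (simp add: minus_equality minus_minus eq_neg_iff_add_eq_0 flip: a_minus_def)
  then show ?thesis using R v by simp
qed

section \<open>Free groups\<close>

lemma reduced_tl: "reduced (a # w) \<Longrightarrow> reduced w"
  by (cases w) auto

lemma reduced_reduced_Cons: "reduced w \<Longrightarrow> reduced (reduced_Cons a w)"
  by (cases w) (auto dest: reduced_tl)

lemma reduced_Cons_cancel:
  assumes "reduced w" "fst a = fst b" "snd a \<noteq> snd b"
  shows "reduced_Cons a (reduced_Cons b w) = w"
proof (cases w)
  case (Cons c w')
  show ?thesis
  proof (cases "fst b = fst c \<and> snd b \<noteq> snd c")
    case True
    then have "a = c" using assms by (auto simp: prod_eq_iff)
    moreover from this have "reduced_Cons a w' = a # w'"
      using assms(1) Cons by (cases w') auto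
    ultimately show ?thesis using True Cons by simp
  qed (use Cons assms in auto)
qed (use assms in auto)

lemma reduced_foldr_reduced_Cons: "reduced w \<Longrightarrow> reduced (foldr reduced_Cons u w)"
  by (induction u) (auto intro: reduced_reduced_Cons)

text \<open>On reduced words a letter undoes the action of its inverse. So a word acts in the same way before and after
its reduction.\<close>

lemma foldr_reduced_Cons_assoc:
  assumes w: "reduced w" and z: "reduced z"
  shows "foldr reduced_Cons (foldr reduced_Cons u w) z = foldr reduced_Cons u (foldr reduced_Cons w z)"
proof (induction u)
  case (Cons a u)
  have "foldr reduced_Cons (reduced_Cons a y) z = reduced_Cons a (foldr reduced_Cons y z)" for y
    by (cases y) (auto simp: reduced_Cons_cancel reduced_foldr_reduced_Cons z)
  with Cons show ?case by simp
qed simp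

lemma set_reduced_Cons: "set (reduced_Cons a w) \<subseteq> insert a (set w)"
  by (cases w) auto

lemma set_foldr_reduced_Cons: "set (foldr reduced_Cons u w) \<subseteq> set u \<union> set w"
proof (induction u)
  case (Cons a u)
  with set_reduced_Cons[of a "foldr reduced_Cons u w"] show ?case by auto
qed simp

lemma group_free_group: "group (free_group A)"
proof (rule groupI)
  fix u w z assume u: "u \<in> carrier (free_group A)" and w: "w \<in> carrier (free_group A)"
    and z: "z \<in> carrier (free_group A)"
  show "u \<otimes>\<^bsub>free_group A\<^esub> w \<in> carrier (free_group A)"
    using u w set_foldr_reduced_Cons[of u w] reduced_foldr_reduced_Cons[of w u]
    by (fastforce simp: free_group_def lists_eq_set)
  show "u \<otimes>\<^bsub>free_group A\<^esub> w \<otimes>\<^bsub>free_group A\<^esub> z = u \<otimes>\<^bsub>free_group A\<^esub> (w \<otimes>\<^bsub>free_group A\<^esub> z)"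
    using w z by (simp add: free_group_def foldr_reduced_Cons_assoc)
next
  show "\<one>\<^bsub>free_group A\<^esub> \<in> carrier (free_group A)" by (simp add: free_group_def)
next
  fix u assume u: "u \<in> carrier (free_group A)"
  show "\<one>\<^bsub>free_group A\<^esub> \<otimes>\<^bsub>free_group A\<^esub> u = u" by (simp add: free_group_def)
  \<comment> \<open>acting on the empty word brings the formal inverse into reduced form\<close>
  define u' where "u' = rev (map (\<lambda>(x, b). (x, \<not> b)) u)"
  have red: "foldr reduced_Cons (rev (map (\<lambda>(x, b). (x, \<not> b)) w)) w = []" if "reduced w" for w :: "('a \<times> bool) list"
    using that
  proof (induction w)
    case (Cons a w)
    obtain x b where a: "a = (x, b)" by force
    have "reduced_Cons (x, \<not> b) (a # w) = w"
      by (simp add: a)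
    with Cons a show ?case by (auto dest: reduced_tl)
  qed simp
  have "foldr reduced_Cons u' [] \<in> carrier (free_group A)"
    using u set_foldr_reduced_Cons[of u' "[]"] reduced_foldr_reduced_Cons[of "[]" u']
    by (fastforce simp: free_group_def lists_eq_set u'_def)
  moreover have "foldr reduced_Cons u' [] \<otimes>\<^bsub>free_group A\<^esub> u = \<one>\<^bsub>free_group A\<^esub>"
    using u red[of u] by (simp add: free_group_def foldr_reduced_Cons_assoc u'_def)
  ultimately show "\<exists>y\<in>carrier (free_group A). y \<otimes>\<^bsub>free_group A\<^esub> u = \<one>\<^bsub>free_group A\<^esub>" by blast
qed

section \<open>The lower central series of the free nilpotent group\<close>

lemma (in group) commutator_closed [simp]:
  "\<lbrakk>x \<in> carrier G; y \<in> carrier G\<rbrakk> \<Longrightarrow> commutator G x y \<in> carrier G"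
  by (simp add: commutator_def)

lemma (in group) lower_central_normal: "lower_central G i \<lhd> G"
proof (induction i)
  case 0
  then show ?case using normal_self by simp
next
  case IH: (Suc i)
  show ?case
  proof (cases i)
    case 0
    then show ?thesis using normal_self by simp
  next
    case (Suc j)
  with IH interpret N: normal "lower_central G (Suc j)" G by simp
  let ?C = "{commutator G x y | x y. x \<in> lower_central G (Suc j) \<and> y \<in> carrier G}"
  have "generate G ?C \<lhd> G"
  proof (rule normal_generateI)
    show "?C \<subseteq> carrier G" by auto
  next
    fix z g assume "z \<in> ?C" and g: "g \<in> carrier G"
    then obtain x y where x: "x \<in> lower_central G (Suc j)" and y: "y \<in> carrier G"
      and z: "z = commutator G x y" by blast
    have xc: "x \<in> carrier G" by (rule N.mem_carrier[OF x])
    have "g \<otimes> z \<otimes> inv g = commutator G (g \<otimes> x \<otimes> inv g) (g \<otimes> y \<otimes> inv g)"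
    proof -
      have "inv a \<otimes> (a \<otimes> b) = b" if "a \<in> carrier G" "b \<in> carrier G" for a b
        using that by (simp flip: m_assoc)
      then show ?thesis using g xc y by (simp add: z commutator_def inv_mult_group m_assoc)
    qed
    moreover have "g \<otimes> x \<otimes> inv g \<in> lower_central G (Suc j)" by (rule N.inv_op_closed2[OF g x])
    moreover have "g \<otimes> y \<otimes> inv g \<in> carrier G" using g y by simp
    ultimately show "g \<otimes> z \<otimes> inv g \<in> ?C" by blast
  qed
  with Suc show ?thesis by simp
  qed
qed

lemma (in group) commutator_lower_central:
  assumes "x \<in> lower_central G (Suc i)" "y \<in> carrier G"
  shows "commutator G x y \<in> lower_central G (Suc (Suc i))"
  using assms by (auto intro!: generate.incl)

lemma (in group) lower_central_Suc: "lower_central G (Suc i) \<subseteq> lower_central G i"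
proof (cases i)
  case 0
  then show ?thesis by simp
next
  case (Suc j)
  interpret N: normal "lower_central G (Suc j)" G by (rule lower_central_normal)
  have "{commutator G x y | x y. x \<in> lower_central G (Suc j) \<and> y \<in> carrier G} \<subseteq> lower_central G (Suc j)"
  proof
    fix z assume "z \<in> {commutator G x y | x y. x \<in> lower_central G (Suc j) \<and> y \<in> carrier G}"
    then obtain x y where x: "x \<in> lower_central G (Suc j)" and y: "y \<in> carrier G"
      and z: "z = commutator G x y" by blast
    have "inv x \<otimes> (inv y \<otimes> x \<otimes> y) \<in> lower_central G (Suc j)"
      using x y by (intro N.m_closed N.m_inv_closed N.inv_op_closed1)
    then show "z \<in> lower_central G (Suc j)" using x y by (simp add: z commutator_def m_assoc)
  qed
  then have "generate G {commutator G x y | x y. x \<in> lower_central G (Suc j) \<and> y \<in> carrier G}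
      \<subseteq> lower_central G (Suc j)"
    by (rule generate_subgroup_incl) (rule N.subgroup_axioms)
  then show ?thesis by (simp add: Suc)
qed

lemma (in group_hom) lower_central_image:
  assumes surj: "h ` carrier G = carrier H"
  shows "lower_central H i \<subseteq> h ` lower_central G i"
proof (induction i)
  case 0
  then show ?case using surj by simp
next
  case IH: (Suc i)
  show ?case
  proof (cases i)
    case 0
    then show ?thesis using surj by simp
  next
    case (Suc j)
  have sub: "subgroup (lower_central G k) G" for k by (rule normal_imp_subgroup[OF G.lower_central_normal])
  have "{commutator H x y | x y. x \<in> lower_central H (Suc j) \<and> y \<in> carrier H}
      \<subseteq> h ` lower_central G (Suc (Suc j))"
  proof
    fix z assume "z \<in> {commutator H x y | x y. x \<in> lower_central H (Suc j) \<and> y \<in> carrier H}"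
    then obtain x y where x: "x \<in> lower_central H (Suc j)" and y: "y \<in> carrier H"
      and z: "z = commutator H x y" by blast
    from x IH Suc obtain x' where x': "x' \<in> lower_central G (Suc j)" "x = h x'" by blast
    from y surj obtain y' where y': "y' \<in> carrier G" "y = h y'" by blast
    have "x' \<in> carrier G" using x'(1) sub subgroup.subset by blast
    then have "z = h (commutator G x' y')" using x'(2) y' by (simp add: z commutator_def)
    with G.commutator_lower_central[OF x'(1) y'(1)] show "z \<in> h ` lower_central G (Suc (Suc j))" by blast
  qed
  then have "generate H {commutator H x y | x y. x \<in> lower_central H (Suc j) \<and> y \<in> carrier H}
      \<subseteq> h ` lower_central G (Suc (Suc j))"
    by (rule H.generate_subgroup_incl) (rule subgroup_img_is_subgroup[OF sub])
  then show ?thesis using Suc by simp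
  qed
qed

lemma group_free_nilpotent: "group (free_nilpotent r c)"
  unfolding free_nilpotent_def
  by (rule normal.factorgroup_is_group[OF group.lower_central_normal[OF group_free_group]])

lemma free_nilpotent_class: "lower_central (free_nilpotent r c) (Suc c) = {\<one>\<^bsub>free_nilpotent r c\<^esub>}"
proof -
  let ?F = "free_group {1..r}" and ?G = "free_nilpotent r c"
  let ?N = "lower_central ?F (Suc c)"
  interpret F: group ?F by (rule group_free_group)
  interpret G: group ?G by (rule group_free_nilpotent)
  interpret N: normal ?N ?F by (rule F.lower_central_normal)
  interpret h: group_hom ?F ?G "\<lambda>x. ?N #>\<^bsub>?F\<^esub> x"
    by unfold_locales (unfold free_nilpotent_def, rule N.r_coset_hom_Mod)
  have "(\<lambda>x. ?N #>\<^bsub>?F\<^esub> x) ` carrier ?F = carrier ?G"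
    by (simp add: free_nilpotent_def carrier_FactGroup)
  from h.lower_central_image[OF this]
  have "lower_central ?G (Suc c) \<subseteq> (\<lambda>x. ?N #>\<^bsub>?F\<^esub> x) ` ?N" .
  also have "\<dots> \<subseteq> {\<one>\<^bsub>?G\<^esub>}"
    using F.coset_join2[OF _ N.subgroup_axioms] N.subset by (auto simp: free_nilpotent_def)
  finally show ?thesis
    using subgroup.one_closed[OF normal_imp_subgroup[OF G.lower_central_normal]] by blast
qed

lemma (in group) last_lower_central_central:
  assumes "lower_central G (Suc (Suc i)) = {\<one>}" "x \<in> lower_central G (Suc i)" "y \<in> carrier G"
  shows "x \<otimes> y = y \<otimes> x"
proof -
  have x: "x \<in> carrier G"
    using assms(2) subgroup.subset[OF normal_imp_subgroup[OF lower_central_normal]] by blast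
  have "commutator G x y = \<one>" using commutator_lower_central[OF assms(2,3)] assms(1) by blast
  then have "inv (y \<otimes> x) \<otimes> (x \<otimes> y) = \<one>"
    using x assms(3) by (simp add: commutator_def inv_mult_group m_assoc)
  then show ?thesis using x assms(3) by (metis inv_closed inv_equality inv_inv m_closed)
qed

section \<open>Uniqueness of exponents of ordered products\<close>

definition ordered_product :: "('a, 'm) monoid_scheme \<Rightarrow> ('i \<Rightarrow> 'a) \<Rightarrow> 'i list \<Rightarrow> ('i \<Rightarrow> int) \<Rightarrow> 'a" where
  "ordered_product G u L a = foldr (\<lambda>\<alpha> g. (u \<alpha> [^]\<^bsub>G\<^esub> a \<alpha>) \<otimes>\<^bsub>G\<^esub> g) L \<one>\<^bsub>G\<^esub>"

context group
begin

lemma ordered_product_Nil [simp]: "ordered_product G u [] a = \<one>"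
  by (simp add: ordered_product_def)

lemma ordered_product_Cons [simp]:
  "ordered_product G u (\<alpha> # L) a = u \<alpha> [^] a \<alpha> \<otimes> ordered_product G u L a"
  by (simp add: ordered_product_def)

lemma ordered_product_in_subgroup:
  assumes "subgroup H G" "\<And>\<alpha>. \<alpha> \<in> set L \<Longrightarrow> u \<alpha> \<in> H"
  shows "ordered_product G u L a \<in> H"
  using assms(2)
  by (induction L) (auto intro: subgroup.one_closed subgroup.m_closed subgroup_int_pow_closed assms(1))

lemma ordered_product_closed:
  "(\<And>\<alpha>. \<alpha> \<in> set L \<Longrightarrow> u \<alpha> \<in> carrier G) \<Longrightarrow> ordered_product G u L a \<in> carrier G"
  by (rule ordered_product_in_subgroup[OF subgroup_self])

lemma ordered_product_append:
  assumes "\<And>\<alpha>. \<alpha> \<in> set (L @ L') \<Longrightarrow> u \<alpha> \<in> carrier G"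
  shows "ordered_product G u (L @ L') a = ordered_product G u L a \<otimes> ordered_product G u L' a"
  using assms
proof (induction L)
  case (Cons \<alpha> L)
  then show ?case using ordered_product_closed[of L u a] ordered_product_closed[of L' u a]
    by (simp add: m_assoc)
qed (simp add: ordered_product_closed)

lemma ordered_product_cong:
  "(\<And>\<alpha>. \<alpha> \<in> set L \<Longrightarrow> a \<alpha> = b \<alpha>) \<Longrightarrow> ordered_product G u L a = ordered_product G u L b"
  by (induction L) auto

lemma ordered_product_zero:
  "(\<And>\<alpha>. \<alpha> \<in> set L \<Longrightarrow> a \<alpha> = 0) \<Longrightarrow> ordered_product G u L a = \<one>"
  by (induction L) auto

lemma ordered_product_add_central:
  assumes u: "\<And>\<alpha>. \<alpha> \<in> set L \<Longrightarrow> u \<alpha> \<in> carrier G"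
    and central: "\<And>\<alpha> x. \<lbrakk>\<alpha> \<in> set L; x \<in> carrier G\<rbrakk> \<Longrightarrow> u \<alpha> [^] z \<alpha> \<otimes> x = x \<otimes> u \<alpha> [^] z \<alpha>"
  shows "ordered_product G u L (\<lambda>\<alpha>. a \<alpha> + z \<alpha>) = ordered_product G u L a \<otimes> ordered_product G u L z"
  using assms
proof (induction L)
  case (Cons \<alpha> L)
  let ?P = "ordered_product G u L"
  have c: "?P a \<in> carrier G" "?P z \<in> carrier G" using Cons.prems(1) by (auto intro: ordered_product_closed)
  have u: "u \<alpha> \<in> carrier G" using Cons.prems(1) by simp
  have "u \<alpha> [^] z \<alpha> \<otimes> ?P a = ?P a \<otimes> u \<alpha> [^] z \<alpha>" using Cons.prems(2)[of \<alpha> "?P a"] c by simp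
  then have "u \<alpha> [^] z \<alpha> \<otimes> (?P a \<otimes> ?P z) = ?P a \<otimes> (u \<alpha> [^] z \<alpha> \<otimes> ?P z)"
    using c u by (simp flip: m_assoc)
  then show ?case using Cons c u by (simp add: int_pow_mult m_assoc)
qed simp

end

text \<open>What is used of a Hall basic sequence \<open>u\<close>: a descending chain of subgroups whose last term is central, and on
the \<open>i\<close>-th of them additive coordinates that vanish on the next one and are dual to the elements of
weight \<open>i\<close>.\<close>

locale layered_basis = group G for G (structure) +
  fixes c :: nat and n :: "nat \<Rightarrow> nat" and \<Gamma> :: "nat \<Rightarrow> 'a set" and u :: "nat \<times> nat \<Rightarrow> 'a"
    and coord :: "nat \<Rightarrow> nat \<Rightarrow> 'a \<Rightarrow> int"
  assumes c: "c \<ge> 1"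
    and \<Gamma>_subgroup: "subgroup (\<Gamma> i) G"
    and \<Gamma>_1: "\<Gamma> 1 = carrier G"
    and \<Gamma>_Suc: "\<Gamma> (Suc i) \<subseteq> \<Gamma> i"
    and \<Gamma>_c: "\<lbrakk>x \<in> \<Gamma> c; y \<in> carrier G\<rbrakk> \<Longrightarrow> x \<otimes> y = y \<otimes> x"
    and u_in: "(i, j) \<in> hall_index c n \<Longrightarrow> u (i, j) \<in> \<Gamma> i"
    and coord_mult: "\<lbrakk>i \<in> {1..c}; x \<in> \<Gamma> i; y \<in> \<Gamma> i\<rbrakk> \<Longrightarrow> coord i j (x \<otimes> y) = coord i j x + coord i j y"
    and coord_Suc: "\<lbrakk>i \<in> {1..c}; x \<in> \<Gamma> (Suc i)\<rbrakk> \<Longrightarrow> coord i j x = 0"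
    and coord_u: "(i, k) \<in> hall_index c n \<Longrightarrow> coord i j (u (i, k)) = (if j = k then 1 else 0)"
begin

abbreviation "I \<equiv> hall_index c n"

abbreviation "P \<equiv> ordered_product G u"

definition layer :: "nat \<Rightarrow> (nat \<times> nat) list" where "layer i = map (Pair i) [1..<Suc (n i)]"

definition tail :: "nat \<Rightarrow> (nat \<times> nat) list" where "tail i = concat (map layer [i..<Suc c])"

lemma hall_index_list_eq: "hall_index_list c n = tail 1"
  unfolding hall_index_list_def tail_def layer_def ..

lemma set_tail: "1 \<le> i \<Longrightarrow> set (tail i) = {\<alpha> \<in> I. i \<le> fst \<alpha>}"
  by (force simp: tail_def layer_def hall_index_def simp del: upt_Suc)

lemma set_layer: "i \<in> {1..c} \<Longrightarrow> set (layer i) = {\<alpha> \<in> I. fst \<alpha> = i}"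
  by (force simp: layer_def hall_index_def simp del: upt_Suc)

lemma tail_Cons: "i \<le> c \<Longrightarrow> tail i = layer i @ tail (Suc i)"
  unfolding tail_def by (subst upt_conv_Cons) auto

lemma \<Gamma>_mono: "i \<le> j \<Longrightarrow> \<Gamma> j \<subseteq> \<Gamma> i"
  by (rule lift_Suc_antimono_le[of \<Gamma>]) (rule \<Gamma>_Suc)

lemma u_closed: "\<alpha> \<in> I \<Longrightarrow> u \<alpha> \<in> carrier G"
  using u_in[of "fst \<alpha>" "snd \<alpha>"] subgroup.subset[OF \<Gamma>_subgroup] by auto

lemma P_tail: "1 \<le> i \<Longrightarrow> P (tail i) a \<in> \<Gamma> i"
proof (rule ordered_product_in_subgroup[OF \<Gamma>_subgroup])
  fix \<alpha> assume "1 \<le> i" "\<alpha> \<in> set (tail i)"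
  then have "\<alpha> \<in> I" "i \<le> fst \<alpha>" by (auto simp: set_tail)
  then show "u \<alpha> \<in> \<Gamma> i" using u_in[of "fst \<alpha>" "snd \<alpha>"] \<Gamma>_mono[of i "fst \<alpha>"] by auto
qed

lemma P_layer: "i \<in> {1..c} \<Longrightarrow> P (layer i) a \<in> \<Gamma> i"
proof (rule ordered_product_in_subgroup[OF \<Gamma>_subgroup])
  fix \<alpha> assume "i \<in> {1..c}" "\<alpha> \<in> set (layer i)"
  then have "\<alpha> \<in> I" "i = fst \<alpha>" by (auto simp: set_layer)
  then show "u \<alpha> \<in> \<Gamma> i" using u_in[of "fst \<alpha>" "snd \<alpha>"] by auto
qed

lemma coord_one: "i \<in> {1..c} \<Longrightarrow> coord i j \<one> = 0"
  by (rule coord_Suc) (auto intro: subgroup.one_closed[OF \<Gamma>_subgroup])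

lemma coord_int_pow:
  assumes i: "i \<in> {1..c}" and x: "x \<in> \<Gamma> i"
  shows "coord i j (x [^] (z::int)) = z * coord i j x"
proof -
  have xc: "x \<in> carrier G" using x subgroup.mem_carrier[OF \<Gamma>_subgroup] by blast
  have nat: "coord i j (x [^] int m) = int m * coord i j x" for m :: nat
  proof (induction m)
    case 0
    then show ?case using coord_one[OF i] by simp
  next
    case (Suc m)
    have "x [^] int (Suc m) = x [^] int m \<otimes> x" 
      using int_pow_mult[OF xc, of "int m" 1] xc by (simp add: add.commute)
    then show ?case
      using Suc coord_mult[OF i subgroup_int_pow_closed[OF \<Gamma>_subgroup x, of "int m"] x]
      by (simp add: algebra_simps)
  qed
  show ?thesis
  proof (cases z)
    case (nonneg m)
    then show ?thesis using nat by simp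
  next
    case (neg m)
    let ?m = "int (Suc m)"
    have "x [^] z \<otimes> x [^] ?m = \<one>" using xc neg by (simp flip: int_pow_mult)
    then have "coord i j (x [^] z) + coord i j (x [^] ?m) = 0"
      using coord_mult[OF i subgroup_int_pow_closed[OF \<Gamma>_subgroup x, of z]
          subgroup_int_pow_closed[OF \<Gamma>_subgroup x, of ?m]] coord_one[OF i] by simp
    then have "coord i j (x [^] z) = - (?m * coord i j x)" using nat[of "Suc m"] by linarith
    moreover have "z = - ?m" using neg by simp
    ultimately show ?thesis by (simp only: mult_minus_left)
  qed
qed

lemma coord_P_layer:
  assumes i: "i \<in> {1..c}" and j: "j \<in> {1..n i}"
  shows "coord i j (P (layer i) a) = a (i, j)"
proof -
  have "coord i j (P (map (Pair i) L) a) = (if j \<in> set L then a (i, j) else 0) \<and>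
      P (map (Pair i) L) a \<in> \<Gamma> i"
    if "distinct L" "set L \<subseteq> {1..n i}" for L
    using that
  proof (induction L)
    case Nil
    then show ?case using coord_one[OF i] by (auto intro: subgroup.one_closed[OF \<Gamma>_subgroup])
  next
    case (Cons k L)
    have k: "(i, k) \<in> I" using Cons.prems i by (auto simp: hall_index_def)
    have 1: "u (i, k) [^] a (i, k) \<in> \<Gamma> i"
      by (rule subgroup_int_pow_closed[OF \<Gamma>_subgroup u_in[OF k]])
    have 2: "P (map (Pair i) L) a \<in> \<Gamma> i" using Cons by simp
    have "coord i j (P (map (Pair i) (k # L)) a) =
        a (i, k) * (if j = k then 1 else 0) + (if j \<in> set L then a (i, j) else 0)"
      using Cons coord_mult[OF i 1 2] coord_int_pow[OF i u_in[OF k]] coord_u[OF k] by simp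
    then show ?case using Cons.prems 1 2 subgroup.m_closed[OF \<Gamma>_subgroup] by auto
  qed
  from this[of "[1..<Suc (n i)]"] show ?thesis
    using j by (auto simp: layer_def atLeastLessThanSuc_atLeastAtMost simp del: upt_Suc)
qed

lemma P_tail_Cons:
  assumes i: "i \<in> {1..c}"
  shows "P (tail i) a = P (layer i) a \<otimes> P (tail (Suc i)) a"
proof -
  have "tail i = layer i @ tail (Suc i)" using i by (intro tail_Cons) simp
  moreover have "u \<alpha> \<in> carrier G" if "\<alpha> \<in> set (layer i @ tail (Suc i))" for \<alpha>
    using that i by (auto simp: set_layer set_tail u_closed)
  ultimately show ?thesis using ordered_product_append by metis
qed

lemma coord_P_tail:
  assumes i: "i \<in> {1..c}" and j: "j \<in> {1..n i}"
  shows "coord i j (P (tail i) a) = a (i, j)"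
proof -
  have "P (tail (Suc i)) a \<in> \<Gamma> (Suc i)" by (rule P_tail) simp
  moreover from this have "P (tail (Suc i)) a \<in> \<Gamma> i" using \<Gamma>_Suc by blast
  ultimately show ?thesis
    using coord_mult[OF i P_layer[OF i]] coord_Suc[OF i] coord_P_layer[OF i j] P_tail_Cons[OF i] by simp
qed

text \<open>The coordinates of weight \<open>i\<close> read off the exponents of weight \<open>i\<close> from a product that
starts at this weight. Then the factors of weight \<open>i\<close> cancel, and the next weight is in reach.\<close>

theorem exponents_unique:
  assumes "P (tail 1) a = P (tail 1) b" "\<alpha> \<in> I"
  shows "a \<alpha> = b \<alpha>"
proof -
  have "\<forall>\<alpha>\<in>I. i \<le> fst \<alpha> \<longrightarrow> a \<alpha> = b \<alpha>" if "P (tail i) a = P (tail i) b" "i \<le> Suc c" "1 \<le> i" for i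
    using that(2,1,3)
  proof (induction i rule: inc_induct)
    case base
    then show ?case by (auto simp: hall_index_def)
  next
    case (step i)
    then have i: "i \<in> {1..c}" by simp
    have layer: "a (i, j) = b (i, j)" if "j \<in> {1..n i}" for j
      using coord_P_tail[OF i that, of a] coord_P_tail[OF i that, of b] step.prems by simp
    then have "P (layer i) a = P (layer i) b"
      by (intro ordered_product_cong) (auto simp: layer_def simp del: upt_Suc)
    moreover have "P (layer i) a \<in> carrier G" "P (tail (Suc i)) a \<in> carrier G" "P (tail (Suc i)) b \<in> carrier G"
      using P_layer[OF i] P_tail[of "Suc i"] subgroup.mem_carrier[OF \<Gamma>_subgroup] by auto
    ultimately have "P (tail (Suc i)) a = P (tail (Suc i)) b"
      using step.prems P_tail_Cons[OF i] by simp
    then have "\<forall>\<alpha>\<in>I. Suc i \<le> fst \<alpha> \<longrightarrow> a \<alpha> = b \<alpha>" using step.IH by simp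
    moreover have "a \<alpha> = b \<alpha>" if "\<alpha> \<in> I" "fst \<alpha> = i" for \<alpha>
      using layer[of "snd \<alpha>"] that by (cases \<alpha>) (auto simp: hall_index_def)
    ultimately show ?case by (metis Suc_leI le_neq_implies_less)
  qed
  from this[of 1] assms show ?thesis using hall_index_def c by auto
qed

lemma set_tail_1: "set (tail 1) = I"
  by (subst set_tail) (auto simp: hall_index_def)

lemma P_closed: "P (tail 1) a \<in> carrier G"
  using P_tail[of 1] \<Gamma>_1 by simp

lemma P_add_last_layer:
  assumes z: "\<And>\<alpha>. \<lbrakk>\<alpha> \<in> I; fst \<alpha> \<noteq> c\<rbrakk> \<Longrightarrow> z \<alpha> = 0"
  shows "P (tail 1) (\<lambda>\<alpha>. a \<alpha> + z \<alpha>) = P (tail 1) a \<otimes> P (tail 1) z"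
    and "x \<in> carrier G \<Longrightarrow> P (tail 1) z \<otimes> x = x \<otimes> P (tail 1) z"
proof -
  have uz: "u \<alpha> [^] z \<alpha> \<in> \<Gamma> c" if "\<alpha> \<in> I" for \<alpha>
  proof (cases "fst \<alpha> = c")
    case True
    then show ?thesis
      using u_in[of "fst \<alpha>" "snd \<alpha>"] that by (auto intro: subgroup_int_pow_closed[OF \<Gamma>_subgroup])
  next
    case False
    then show ?thesis using z[OF that] by (auto intro: subgroup.one_closed[OF \<Gamma>_subgroup])
  qed
  show "P (tail 1) (\<lambda>\<alpha>. a \<alpha> + z \<alpha>) = P (tail 1) a \<otimes> P (tail 1) z"
    by (rule ordered_product_add_central) (auto simp: set_tail_1[simplified] u_closed intro: \<Gamma>_c uz)
  have "P L z \<in> \<Gamma> c" if "set L \<subseteq> I" for L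
    using that by (induction L) (auto intro: subgroup.one_closed[OF \<Gamma>_subgroup] subgroup.m_closed[OF \<Gamma>_subgroup] uz)
  then show "x \<in> carrier G \<Longrightarrow> P (tail 1) z \<otimes> x = x \<otimes> P (tail 1) z"
    using set_tail_1 by (intro \<Gamma>_c) auto
qed

end

section \<open>Hall basic sequences as layered bases\<close>

lemma free_nilpotent_gen_closed:
  assumes "k \<in> {1..r}"
  shows "free_nilpotent_gen r c k \<in> carrier (free_nilpotent r c)"
proof -
  have "[(k, True)] \<in> carrier (free_group {1..r})" using assms by (simp add: free_group_def)
  then show ?thesis
    unfolding free_nilpotent_gen_def free_nilpotent_def carrier_FactGroup by (rule imageI)
qed

text \<open>The generators with an index outside \<open>{1..r}\<close> are not elements of the group, so membership has to be followed
through the recursive construction of the basic commutators.\<close>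

lemma hall_element_closed:
  assumes hall: "hall_basic_sequence r c n h" and \<alpha>: "\<alpha> \<in> hall_index c n"
  shows "hall_element r c h \<alpha> \<in> carrier (free_nilpotent r c)"
  using \<alpha>
proof (induction "fst \<alpha>" arbitrary: \<alpha> rule: less_induct)
  case less
  interpret G: group "free_nilpotent r c" by (rule group_free_nilpotent)
  obtain i j where \<alpha>: "\<alpha> = (i, j)" "i \<in> {1..c}" "j \<in> {1..n i}"
    using less.prems by (auto simp: hall_index_def)
  have "bij_betw (\<lambda>j. h (i, j)) {1..n i} (basic_commutators r n h i)"
    using hall \<alpha>(2) by (simp add: hall_basic_sequence_def)
  then have basic: "h \<alpha> \<in> basic_commutators r n h i"
    unfolding \<alpha>(1) using \<alpha>(3) by (rule bij_betw_apply)
  show ?case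
  proof (cases "i = 1")
    case True
    with basic obtain k where "h \<alpha> = Gen k" "k \<in> {1..r}" by (auto simp: basic_commutators_def)
    then show ?thesis by (simp add: hall_element_def free_nilpotent_gen_closed)
  next
    case False
    with basic obtain \<beta> \<gamma> where h: "h \<alpha> = Br (h \<beta>) (h \<gamma>)"
      and "\<beta> \<in> hall_index (i - 1) n" "\<gamma> \<in> hall_index (i - 1) n"
      by (auto simp: basic_commutators_def)
    then have "\<beta> \<in> hall_index c n" "fst \<beta> < i" "\<gamma> \<in> hall_index c n" "fst \<gamma> < i"
      using \<alpha>(2) by (auto simp: hall_index_def)
    with less.hyps[of \<beta>] less.hyps[of \<gamma>] \<alpha>(1)
    have "hall_element r c h \<beta> \<in> carrier (free_nilpotent r c)"
      "hall_element r c h \<gamma> \<in> carrier (free_nilpotent r c)" by auto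
    then show ?thesis by (simp add: hall_element_def h)
  qed
qed

text \<open>The coordinates on \<open>\<Gamma>\<^sub>i\<close> are obtained from the isomorphism of the free abelian group with
\<open>\<Gamma>\<^sub>i/\<Gamma>\<^sub>i\<^sub>+\<^sub>1\<close>, by composing its inverse with the coset map.\<close>

theorem layered_basis_of_hall_sequence:
  assumes hall: "hall_basic_sequence r c n h" and c: "c \<ge> 1"
  shows "\<exists>coord. layered_basis (free_nilpotent r c) c n (lower_central (free_nilpotent r c))
    (hall_element r c h) coord"
proof -
  let ?G = "free_nilpotent r c" and ?u = "hall_element r c h"
  let ?\<Gamma> = "lower_central ?G"
  interpret G: group ?G by (rule group_free_nilpotent)
  have normal: "?\<Gamma> i \<lhd> ?G" for i by (rule G.lower_central_normal)
  have sub: "subgroup (?\<Gamma> i) ?G" for i by (rule normal_imp_subgroup[OF normal])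
  have "\<exists>\<kappa>. (\<forall>j\<in>{1..n i}. ?u (i, j) \<in> ?\<Gamma> i \<and> \<kappa> (?u (i, j)) = frag_of j) \<and>
      (\<forall>x\<in>?\<Gamma> i. \<forall>y\<in>?\<Gamma> i. \<kappa> (x \<otimes>\<^bsub>?G\<^esub> y) = \<kappa> x + \<kappa> y) \<and> (\<forall>x\<in>?\<Gamma> (Suc i). \<kappa> x = 0)"
    if i: "i \<in> {1..c}" for i
  proof -
    let ?A = "free_Abelian_group {1..n i}" and ?Q = "?G\<lparr>carrier := ?\<Gamma> i\<rparr> Mod ?\<Gamma> (Suc i)"
    let ?\<pi> = "\<lambda>x. ?\<Gamma> (Suc i) #>\<^bsub>?G\<^esub> x"
    have Suc_le: "?\<Gamma> (Suc i) \<subseteq> ?\<Gamma> i" by (rule G.lower_central_Suc)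
    interpret N: normal "?\<Gamma> (Suc i)" ?G by (rule normal)
    interpret NH: normal "?\<Gamma> (Suc i)" "?G\<lparr>carrier := ?\<Gamma> i\<rparr>"
      by (rule G.normal_restrict_supergroup[OF sub normal Suc_le])
    interpret A: group ?A by (rule group_free_Abelian_group)
    interpret Q: group ?Q by (rule NH.factorgroup_is_group)
    have \<pi>: "?\<pi> \<in> hom (?G\<lparr>carrier := ?\<Gamma> i\<rparr>) ?Q"
      using NH.r_coset_hom_Mod by (simp add: r_coset_def)
    from hall i obtain \<phi> where \<phi>: "\<phi> \<in> iso ?A ?Q"
      and \<phi>_frag: "\<forall>j\<in>{1..n i}. \<phi> (frag_of j) = ?\<pi> (?u (i, j))"
      unfolding hall_basic_sequence_def Let_def by blast
    define \<psi> where "\<psi> = inv_into (carrier ?A) \<phi>"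
    have \<psi>: "\<psi> \<in> hom ?Q ?A" using A.iso_set_sym[OF \<phi>] by (simp add: \<psi>_def iso_def)
    define \<kappa> where "\<kappa> x = \<psi> (?\<pi> x)" for x
    have \<kappa>: "\<kappa> \<in> hom (?G\<lparr>carrier := ?\<Gamma> i\<rparr>) ?A"
      using Group.hom_compose[OF \<pi> \<psi>] by (simp add: \<kappa>_def[abs_def] comp_def)
    have "?u (i, j) \<in> ?\<Gamma> i \<and> \<kappa> (?u (i, j)) = frag_of j" if j: "j \<in> {1..n i}" for j
    proof
      have frag: "frag_of j \<in> carrier ?A" using j by simp
      have u: "?u (i, j) \<in> carrier ?G"
        using hall_element_closed[OF hall, of "(i, j)"] i j by (simp add: hall_index_def)
      have "\<phi> \<in> carrier ?A \<rightarrow> carrier ?Q" using \<phi> by (simp only: iso_def hom_def mem_Collect_eq)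
      from funcset_mem[OF this frag] have "?\<pi> (?u (i, j)) \<in> carrier ?Q"
        by (simp only: bspec[OF \<phi>_frag j])
      then obtain x where x: "x \<in> ?\<Gamma> i" "?\<pi> (?u (i, j)) = ?\<pi> x"
        by (auto simp: carrier_FactGroup r_coset_def)
      have "?u (i, j) \<in> ?\<pi> (?u (i, j))" by (rule G.rcos_self[OF u N.subgroup_axioms])
      then obtain y where y: "y \<in> ?\<Gamma> (Suc i)" "?u (i, j) = y \<otimes>\<^bsub>?G\<^esub> x"
        unfolding x(2) by (auto simp: r_coset_def)
      show "?u (i, j) \<in> ?\<Gamma> i"
        unfolding y(2) by (rule subgroup.m_closed[OF sub subsetD[OF Suc_le y(1)] x(1)])
      have "inj_on \<phi> (carrier ?A)" using \<phi> by (auto simp: iso_def bij_betw_def)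
      then show "\<kappa> (?u (i, j)) = frag_of j"
        using frag \<phi>_frag j unfolding \<kappa>_def \<psi>_def by (metis inv_into_f_f)
    qed
    moreover have "\<kappa> x = 0" if "x \<in> ?\<Gamma> (Suc i)" for x
    proof -
      have "?\<pi> x = ?\<Gamma> (Suc i)" using that by (intro G.coset_join2 N.subgroup_axioms) auto
      then show ?thesis using hom_one[OF \<psi> Q.is_group A.is_group] by (simp add: \<kappa>_def)
    qed
    moreover have "\<kappa> (x \<otimes>\<^bsub>?G\<^esub> y) = \<kappa> x + \<kappa> y" if "x \<in> ?\<Gamma> i" "y \<in> ?\<Gamma> i" for x y
      using \<kappa> that by (auto simp: hom_def)
    ultimately show ?thesis by (intro exI[of _ \<kappa>]) blast
  qed
  then have "\<forall>i. \<exists>\<kappa>. i \<in> {1..c} \<longrightarrow> (\<forall>j\<in>{1..n i}. ?u (i, j) \<in> ?\<Gamma> i \<and> \<kappa> (?u (i, j)) = frag_of j) \<and>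
      (\<forall>x\<in>?\<Gamma> i. \<forall>y\<in>?\<Gamma> i. \<kappa> (x \<otimes>\<^bsub>?G\<^esub> y) = \<kappa> x + \<kappa> y) \<and> (\<forall>x\<in>?\<Gamma> (Suc i). \<kappa> x = 0)"
    by blast
  then obtain \<kappa> where \<kappa>: "\<forall>i. i \<in> {1..c} \<longrightarrow>
      (\<forall>j\<in>{1..n i}. ?u (i, j) \<in> ?\<Gamma> i \<and> \<kappa> i (?u (i, j)) = frag_of j) \<and>
      (\<forall>x\<in>?\<Gamma> i. \<forall>y\<in>?\<Gamma> i. \<kappa> i (x \<otimes>\<^bsub>?G\<^esub> y) = \<kappa> i x + \<kappa> i y) \<and> (\<forall>x\<in>?\<Gamma> (Suc i). \<kappa> i x = 0)"
    unfolding choice_iff by (elim exE)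
  obtain d where d: "c = Suc d" using c by (cases c) auto
  have "layered_basis ?G c n ?\<Gamma> ?u (\<lambda>i j x. Poly_Mapping.lookup (\<kappa> i x) j)"
  proof (rule layered_basis.intro[OF G.is_group], rule layered_basis_axioms.intro)
    show "1 \<le> c" by (fact c)
    show "subgroup (?\<Gamma> i) ?G" for i by (rule sub)
    show "?\<Gamma> 1 = carrier ?G" by simp
    show "?\<Gamma> (Suc i) \<subseteq> ?\<Gamma> i" for i by (rule G.lower_central_Suc)
    show "x \<otimes>\<^bsub>?G\<^esub> y = y \<otimes>\<^bsub>?G\<^esub> x" if "x \<in> ?\<Gamma> c" "y \<in> carrier ?G" for x y
    proof (rule G.last_lower_central_central)
      show "?\<Gamma> (Suc (Suc d)) = {\<one>\<^bsub>?G\<^esub>}" using free_nilpotent_class[of r c] unfolding d .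
    qed (use that d in simp_all)
    show "?u (i, j) \<in> ?\<Gamma> i" if "(i, j) \<in> hall_index c n" for i j
      using \<kappa> that by (auto simp: hall_index_def)
    show "Poly_Mapping.lookup (\<kappa> i (x \<otimes>\<^bsub>?G\<^esub> y)) j =
        Poly_Mapping.lookup (\<kappa> i x) j + Poly_Mapping.lookup (\<kappa> i y) j"
      if "i \<in> {1..c}" "x \<in> ?\<Gamma> i" "y \<in> ?\<Gamma> i" for i j x y
      using \<kappa> that by (simp add: lookup_add)
    show "Poly_Mapping.lookup (\<kappa> i x) j = 0" if "i \<in> {1..c}" "x \<in> ?\<Gamma> (Suc i)" for i j x
      using \<kappa> that by simp
    show "Poly_Mapping.lookup (\<kappa> i (?u (i, k))) j = (if j = k then 1 else 0)"
      if "(i, k) \<in> hall_index c n" for i j k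
      using \<kappa> that by (auto simp: hall_index_def)
  qed
  then show ?thesis by (intro exI[where x = "\<lambda>i j x. Poly_Mapping.lookup (\<kappa> i x) j"])
qed

section \<open>Identities between the canonical polynomials\<close>

definition coordinate_mult ::
  "nat \<Rightarrow> (nat \<Rightarrow> nat) \<Rightarrow> (nat \<times> nat \<Rightarrow> (nat \<times> nat + nat \<times> nat) binom_poly) \<Rightarrow>
   ('a, 'm) ring_scheme \<Rightarrow> (nat \<times> nat \<Rightarrow> 'a) \<Rightarrow> (nat \<times> nat \<Rightarrow> 'a) \<Rightarrow> nat \<times> nat \<Rightarrow> 'a" where
  "coordinate_mult c n p R a b = (\<lambda>\<alpha>\<in>hall_index c n. eval_binom_poly R (p \<alpha>) (case_sum a b))"

text \<open>Inversion is the power with exponent \<open>-1\<close>.\<close>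

definition coordinate_inv ::
  "nat \<Rightarrow> (nat \<Rightarrow> nat) \<Rightarrow> (nat \<times> nat \<Rightarrow> (nat \<times> nat + unit) binom_poly) \<Rightarrow>
   ('a, 'm) ring_scheme \<Rightarrow> (nat \<times> nat \<Rightarrow> 'a) \<Rightarrow> nat \<times> nat \<Rightarrow> 'a" where
  "coordinate_inv c n q R a = (\<lambda>\<alpha>\<in>hall_index c n.
     eval_binom_poly R (q \<alpha>) (case_sum a (\<lambda>_. \<ominus>\<^bsub>R\<^esub> \<one>\<^bsub>R\<^esub>)))"

definition add_last_layer ::
  "nat \<Rightarrow> (nat \<Rightarrow> nat) \<Rightarrow> ('a, 'm) ring_scheme \<Rightarrow>
   (nat \<times> nat \<Rightarrow> 'a) \<Rightarrow> (nat \<times> nat \<Rightarrow> 'a) \<Rightarrow> nat \<times> nat \<Rightarrow> 'a" where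
  "add_last_layer c n R a z = (\<lambda>\<alpha>\<in>hall_index c n. if fst \<alpha> = c then a \<alpha> \<oplus>\<^bsub>R\<^esub> z \<alpha> else a \<alpha>)"

lemma add_last_layer_cong:
  "(\<And>\<alpha>. \<lbrakk>\<alpha> \<in> hall_index c n; fst \<alpha> = c\<rbrakk> \<Longrightarrow> z \<alpha> = w \<alpha>) \<Longrightarrow> add_last_layer c n R a z = add_last_layer c n R a w"
  by (auto simp: add_last_layer_def fun_eq_iff)

locale hall_polynomials =
  fixes r c :: nat and n :: "nat \<Rightarrow> nat" and h :: "nat \<times> nat \<Rightarrow> comm"
    and p :: "nat \<times> nat \<Rightarrow> (nat \<times> nat + nat \<times> nat) binom_poly"
    and q :: "nat \<times> nat \<Rightarrow> (nat \<times> nat + unit) binom_poly"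
  assumes c: "c \<ge> 1" and hall: "hall_basic_sequence r c n h"
    and canonical: "canonical_polynomials r c n h p q"
begin

abbreviation "\<mu> R \<equiv> coordinate_mult c n p R"
abbreviation "\<iota> R \<equiv> coordinate_inv c n q R"

text \<open>The two sides of an equation between tuples are exponents of the same element of the free nilpotent group, and
exponents are unique. For the first layer, the coordinates of weight 1 are additive on the whole group; for the last one, the
commutators of weight \<open>c\<close> are central.\<close>

lemma integer_identities:
  fixes a b d z w :: "nat \<times> nat \<Rightarrow> int"
  assumes a: "a \<in> hall_index c n \<rightarrow>\<^sub>E UNIV" and b: "b \<in> hall_index c n \<rightarrow>\<^sub>E UNIV" and d: "d \<in> hall_index c n \<rightarrow>\<^sub>E UNIV"
  shows mult_assoc_int: "\<mu> \<Z> (\<mu> \<Z> a b) d =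
      \<mu> \<Z> a (\<mu> \<Z> b d)"
    and mult_zero_int: "\<mu> \<Z> (\<lambda>\<alpha>\<in>hall_index c n. 0) a = a"
    and mult_inv_int: "\<mu> \<Z> (\<iota> \<Z> a) a = (\<lambda>\<alpha>\<in>hall_index c n. 0)"
    and mult_first_layer_int: "k \<in> {1..n 1} \<Longrightarrow> \<mu> \<Z> a b (1, k) = a (1, k) + b (1, k)"
    and mult_last_layer_int: "\<mu> \<Z> (add_last_layer c n \<Z> a z) (add_last_layer c n \<Z> b w) =
      add_last_layer c n \<Z> (\<mu> \<Z> a b) (\<lambda>\<alpha>. z \<alpha> + w \<alpha>)"
proof -
  let ?G = "free_nilpotent r c"
  obtain coord where "layered_basis ?G c n (lower_central ?G) (hall_element r c h) coord"
    using layered_basis_of_hall_sequence[OF hall c] by blast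
  then interpret L: layered_basis ?G c n "lower_central ?G" "hall_element r c h" coord .
  let ?I = "hall_index c n"
  define Pr where "Pr = L.P (L.tail 1)"
  let ?m = "\<mu> \<Z>"
  have P: "hall_product r c n h a = Pr a" for a
    by (simp add: Pr_def hall_product_def ordered_product_def L.hall_index_list_eq)
  have P_cong: "Pr f = Pr g" if "\<And>\<alpha>. \<alpha> \<in> ?I \<Longrightarrow> f \<alpha> = g \<alpha>" for f g
    unfolding Pr_def by (rule L.ordered_product_cong) (use that L.set_tail_1 in auto)
  have inj: "f = g" if "Pr f = Pr g" "f \<in> extensional ?I" "g \<in> extensional ?I" for f g
    by (rule extensionalityI[OF that(2,3)]) (rule L.exponents_unique[OF that(1)[unfolded Pr_def]])
  have mult: "Pr (?m f g) = Pr f \<otimes>\<^bsub>?G\<^esub> Pr g" if "f \<in> ?I \<rightarrow>\<^sub>E UNIV" "g \<in> ?I \<rightarrow>\<^sub>E UNIV" for f g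
    using canonical that by (simp add: canonical_polynomials_def P coordinate_mult_def)
  have m: "?m f g \<in> ?I \<rightarrow>\<^sub>E UNIV" for f g by (simp add: coordinate_mult_def)
  have P0: "Pr (\<lambda>\<alpha>\<in>?I. 0) = \<one>\<^bsub>?G\<^esub>"
    unfolding Pr_def by (rule L.ordered_product_zero) (use L.set_tail_1 in auto)
  have closed: "Pr f \<in> carrier ?G" for f unfolding Pr_def by (rule L.P_closed)
  have m_ext: "?m f g \<in> extensional ?I" for f g by (simp add: coordinate_mult_def)
  have zero: "(\<lambda>\<alpha>\<in>?I. 0) \<in> ?I \<rightarrow>\<^sub>E (UNIV :: int set)" by simp
  show "?m (?m a b) d = ?m a (?m b d)"
    by (rule inj) (use a b d in \<open>simp_all add: mult[OF a b] mult[OF b d] mult[OF m d] mult[OF a m] L.m_assoc closed m_ext\<close>)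
  show "?m (\<lambda>\<alpha>\<in>?I. 0) a = a"
    by (rule inj) (use a in \<open>simp_all add: mult[OF zero a] P0 closed m_ext PiE_def\<close>)
  show "?m (\<iota> \<Z> a) a = (\<lambda>\<alpha>\<in>?I. 0)"
  proof (rule inj)
    have "Pr (\<iota> \<Z> a) = Pr a [^]\<^bsub>?G\<^esub> (- 1 :: int)"
      using canonical a by (simp add: canonical_polynomials_def P coordinate_inv_def int_a_inv_eq)
    also have "\<dots> = inv\<^bsub>?G\<^esub> Pr a" using closed by (simp add: L.int_pow_neg)
    finally show "Pr (?m (\<iota> \<Z> a) a) = Pr (\<lambda>\<alpha>\<in>?I. 0)"
      using closed by (subst mult[OF _ a]) (simp_all add: P0 coordinate_inv_def)
  qed (simp_all add: m_ext)
  show "?m a b (1, k) = a (1, k) + b (1, k)" if k: "k \<in> {1..n 1}"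
  proof -
    have 1: "1 \<in> {1..c}" using c by simp
    have "?m a b (1, k) = coord 1 k (Pr (?m a b))" using L.coord_P_tail[OF 1 k] unfolding Pr_def by simp
    also have "\<dots> = coord 1 k (Pr a) + coord 1 k (Pr b)"
      unfolding mult[OF a b] using L.coord_mult[OF 1, of "Pr a" "Pr b" k] closed by simp
    also have "\<dots> = a (1, k) + b (1, k)" using L.coord_P_tail[OF 1 k] unfolding Pr_def by simp
    finally show ?thesis .
  qed
  show "?m (add_last_layer c n \<Z> a z) (add_last_layer c n \<Z> b w) =
      add_last_layer c n \<Z> (?m a b) (\<lambda>\<alpha>. z \<alpha> + w \<alpha>)"
  proof (rule inj)
    define last where "last z \<alpha> = (if fst \<alpha> = c then z \<alpha> else 0)" for z :: "nat \<times> nat \<Rightarrow> int" and \<alpha>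
    have shift: "Pr (add_last_layer c n \<Z> f z) = Pr f \<otimes>\<^bsub>?G\<^esub> Pr (last z)" for f z
    proof -
      have "Pr (add_last_layer c n \<Z> f z) = Pr (\<lambda>\<alpha>. f \<alpha> + last z \<alpha>)"
        by (rule P_cong) (simp add: add_last_layer_def last_def)
      also have "\<dots> = Pr f \<otimes>\<^bsub>?G\<^esub> Pr (last z)"
        unfolding Pr_def by (rule L.P_add_last_layer) (simp add: last_def)
      finally show ?thesis .
    qed
    have central: "Pr (last z) \<otimes>\<^bsub>?G\<^esub> x = x \<otimes>\<^bsub>?G\<^esub> Pr (last z)" if "x \<in> carrier ?G" for x z
      unfolding Pr_def by (rule L.P_add_last_layer) (simp_all add: last_def that)
    have add: "Pr (last (\<lambda>\<alpha>. z \<alpha> + w \<alpha>)) = Pr (last z) \<otimes>\<^bsub>?G\<^esub> Pr (last w)"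
    proof -
      have "last (\<lambda>\<alpha>. z \<alpha> + w \<alpha>) = (\<lambda>\<alpha>. last z \<alpha> + last w \<alpha>)" by (simp add: last_def fun_eq_iff)
      then show ?thesis
        unfolding Pr_def by (simp only:) (rule L.P_add_last_layer, simp add: last_def)
    qed
    have "Pr (?m (add_last_layer c n \<Z> a z) (add_last_layer c n \<Z> b w)) =
        (Pr a \<otimes>\<^bsub>?G\<^esub> Pr (last z)) \<otimes>\<^bsub>?G\<^esub> (Pr b \<otimes>\<^bsub>?G\<^esub> Pr (last w))"
      by (subst mult) (simp_all only: shift, simp_all add: add_last_layer_def)
    also have "\<dots> = Pr a \<otimes>\<^bsub>?G\<^esub> ((Pr (last z) \<otimes>\<^bsub>?G\<^esub> Pr b) \<otimes>\<^bsub>?G\<^esub> Pr (last w))"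
      using closed by (simp add: L.m_assoc)
    also have "\<dots> = (Pr a \<otimes>\<^bsub>?G\<^esub> Pr b) \<otimes>\<^bsub>?G\<^esub> (Pr (last z) \<otimes>\<^bsub>?G\<^esub> Pr (last w))"
      unfolding central[OF closed[of b], of z] using closed by (simp add: L.m_assoc)
    also have "\<dots> = Pr (add_last_layer c n \<Z> (?m a b) (\<lambda>\<alpha>. z \<alpha> + w \<alpha>))"
      by (simp only: shift add mult[OF a b])
    finally show "Pr (?m (add_last_layer c n \<Z> a z) (add_last_layer c n \<Z> b w)) =
        Pr (add_last_layer c n \<Z> (?m a b) (\<lambda>\<alpha>. z \<alpha> + w \<alpha>))" .
  qed (simp_all add: coordinate_mult_def add_last_layer_def)
qed

end

text \<open>A group variable \<open>k\<close> is represented by the ring variables whose numbers code pairs of \<open>k\<close> and an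
index.\<close>

definition assignment_tuple :: "nat \<Rightarrow> (nat \<Rightarrow> nat) \<Rightarrow> (nat \<Rightarrow> 'a) \<Rightarrow> nat \<Rightarrow> nat \<times> nat \<Rightarrow> 'a" where
  "assignment_tuple c n v k = (\<lambda>\<alpha>\<in>hall_index c n. v (prod_encode (k, prod_encode \<alpha>)))"

lemma finite_hall_index: "finite (hall_index c n)"
  by (simp add: hall_index_def)

lemma assignment_tuple_closed:
  "v \<in> UNIV \<rightarrow> D \<Longrightarrow> assignment_tuple c n v k \<in> hall_index c n \<rightarrow>\<^sub>E D"
  by (auto simp: assignment_tuple_def)

lemma assignment_tuple_surj:
  assumes a: "\<And>k. a k \<in> hall_index c n \<rightarrow>\<^sub>E D" and D: "x \<in> D"
  shows "\<exists>v\<in>UNIV \<rightarrow> D. assignment_tuple c n v = a"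
proof -
  define v where "v m = (case prod_decode m of (k, l) \<Rightarrow>
    if prod_decode l \<in> hall_index c n then a k (prod_decode l) else x)" for m
  have "assignment_tuple c n v k \<alpha> = a k \<alpha>" for k \<alpha>
    using PiE_arb[OF a[of k], of \<alpha>] by (simp add: assignment_tuple_def v_def)
  then have "assignment_tuple c n v = a" by blast
  moreover have "v m \<in> D" for m
    using a D by (auto simp: v_def PiE_iff split: prod.split)
  ultimately show ?thesis by blast
qed

context binomial_domain_pair
begin

definition rational_tuple ::
  "nat \<Rightarrow> (nat \<Rightarrow> nat) \<Rightarrow> ((nat \<Rightarrow> 'a) \<Rightarrow> nat \<times> nat \<Rightarrow> 'a) \<Rightarrow> ((nat \<Rightarrow> 'b) \<Rightarrow> nat \<times> nat \<Rightarrow> 'b) \<Rightarrow> bool" where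
  "rational_tuple c n A B \<longleftrightarrow>
     (\<forall>v\<in>sequences R. A v \<in> hall_index c n \<rightarrow>\<^sub>E carrier R) \<and>
     (\<forall>v\<in>sequences S. B v \<in> hall_index c n \<rightarrow>\<^sub>E carrier S) \<and>
     (\<forall>\<alpha>\<in>hall_index c n. rational (\<lambda>v. A v \<alpha>) (\<lambda>v. B v \<alpha>))"

lemma rational_tuple_restrict:
  assumes "\<And>\<alpha>. \<alpha> \<in> hall_index c n \<Longrightarrow> rational (F \<alpha>) (G \<alpha>)"
  shows "rational_tuple c n (\<lambda>v. \<lambda>\<alpha>\<in>hall_index c n. F \<alpha> v) (\<lambda>v. \<lambda>\<alpha>\<in>hall_index c n. G \<alpha> v)"
  using assms rational_closed[OF assms] by (auto simp: rational_tuple_def)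

lemma rational_tuple_assignment:
  "rational_tuple c n (\<lambda>v. assignment_tuple c n v k) (\<lambda>v. assignment_tuple c n v k)"
  unfolding assignment_tuple_def by (intro rational_tuple_restrict rational_var)

lemma rational_tuple_zero:
  "rational_tuple c n (\<lambda>v. \<lambda>\<alpha>\<in>hall_index c n. \<zero>\<^bsub>R\<^esub>) (\<lambda>v. \<lambda>\<alpha>\<in>hall_index c n. \<zero>\<^bsub>S\<^esub>)"
  by (intro rational_tuple_restrict rational_zero)

lemma rational_tuple_mult:
  assumes "rational_tuple c n A B" "rational_tuple c n A' B'"
    and p: "\<And>\<alpha>. \<alpha> \<in> hall_index c n \<Longrightarrow> poly_vars (p \<alpha>) \<subseteq> hall_index c n <+> hall_index c n"
  shows "rational_tuple c n (\<lambda>v. coordinate_mult c n p R (A v) (A' v)) (\<lambda>v. coordinate_mult c n p S (B v) (B' v))"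
  unfolding coordinate_mult_def
proof (intro rational_tuple_restrict rational_eval_binom_poly)
  fix \<alpha> x assume "\<alpha> \<in> hall_index c n" "x \<in> poly_vars (p \<alpha>)"
  then have "x \<in> hall_index c n <+> hall_index c n" using p by blast
  then show "rational (\<lambda>v. case_sum (A v) (A' v) x) (\<lambda>v. case_sum (B v) (B' v) x)"
    using assms(1,2) by (cases x) (auto simp: rational_tuple_def)
qed

lemma rational_tuple_inv:
  assumes "rational_tuple c n A B"
    and q: "\<And>\<alpha>. \<alpha> \<in> hall_index c n \<Longrightarrow> poly_vars (q \<alpha>) \<subseteq> hall_index c n <+> UNIV"
  shows "rational_tuple c n (\<lambda>v. coordinate_inv c n q R (A v)) (\<lambda>v. coordinate_inv c n q S (B v))"
  unfolding coordinate_inv_def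
proof (intro rational_tuple_restrict rational_eval_binom_poly)
  fix \<alpha> x assume "\<alpha> \<in> hall_index c n" "x \<in> poly_vars (q \<alpha>)"
  then have "x \<in> hall_index c n <+> UNIV" using q by blast
  then show "rational (\<lambda>v. case_sum (A v) (\<lambda>_. \<ominus>\<^bsub>R\<^esub> \<one>\<^bsub>R\<^esub>) x) (\<lambda>v. case_sum (B v) (\<lambda>_. \<ominus>\<^bsub>S\<^esub> \<one>\<^bsub>S\<^esub>) x)"
    using assms(1) rational_minus_one by (cases x) (auto simp: rational_tuple_def)
qed

lemma rational_tuple_add_last_layer:
  assumes A: "rational_tuple c n A B"
    and F: "\<And>\<alpha>. \<alpha> \<in> hall_index c n \<Longrightarrow> rational (\<lambda>v. F v \<alpha>) (\<lambda>v. G v \<alpha>)"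
  shows "rational_tuple c n (\<lambda>v. add_last_layer c n R (A v) (F v)) (\<lambda>v. add_last_layer c n S (B v) (G v))"
  unfolding add_last_layer_def
proof (rule rational_tuple_restrict)
  fix \<alpha> assume \<alpha>: "\<alpha> \<in> hall_index c n"
  then have "rational (\<lambda>v. A v \<alpha>) (\<lambda>v. B v \<alpha>)" using A by (simp add: rational_tuple_def)
  with rational_add[OF this F[OF \<alpha>]]
  show "rational (\<lambda>v. if fst \<alpha> = c then A v \<alpha> \<oplus>\<^bsub>R\<^esub> F v \<alpha> else A v \<alpha>)
      (\<lambda>v. if fst \<alpha> = c then B v \<alpha> \<oplus>\<^bsub>S\<^esub> G v \<alpha> else B v \<alpha>)"
    by (cases "fst \<alpha> = c") simp_all
qed

lemma rational_tuple_cong: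
  assumes "rational_tuple c n A B" "\<And>v. v \<in> sequences R \<Longrightarrow> A' v = A v"
    "\<And>v. v \<in> sequences S \<Longrightarrow> B' v = B v"
  shows "rational_tuple c n A' B'"
  unfolding rational_tuple_def
proof (intro conjI ballI)
  fix \<alpha> assume "\<alpha> \<in> hall_index c n"
  then have "rational (\<lambda>v. A v \<alpha>) (\<lambda>v. B v \<alpha>)" using assms(1) by (simp add: rational_tuple_def)
  then show "rational (\<lambda>v. A' v \<alpha>) (\<lambda>v. B' v \<alpha>)" by (rule rational_cong) (simp_all add: assms(2,3))
qed (use assms in \<open>simp_all add: rational_tuple_def\<close>)

end

lemma (in binomial_domain) tuple_identity_from_int:
  assumes A: "binomial_domain_pair.rational_tuple \<Z> R c n A B"
    and A': "binomial_domain_pair.rational_tuple \<Z> R c n A' B'" and eq: "\<forall>v. A v = A' v"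
    and v: "v \<in> sequences R"
  shows "B v = B' v"
proof -
  interpret Z: binomial_domain \<Z> by (rule binomial_domain_int)
  interpret P: binomial_domain_pair \<Z> R by unfold_locales
  have "B v \<in> extensional (hall_index c n)" "B' v \<in> extensional (hall_index c n)"
    using A A' v by (auto simp: P.rational_tuple_def PiE_def)
  then show ?thesis
  proof (rule extensionalityI)
    fix \<alpha> assume "\<alpha> \<in> hall_index c n"
    then show "B v \<alpha> = B' v \<alpha>"
      using A A' eq by (intro rational_identity_from_int[OF _ _ _ v]) (auto simp: P.rational_tuple_def)
  qed
qed

locale hall_polynomials_over = hall_polynomials + binomial_domain R for R :: "('a, 'm) ring_scheme" (structure)
begin

abbreviation "tuples \<equiv> hall_index c n \<rightarrow>\<^sub>E carrier R"

lemma p_vars: "\<alpha> \<in> hall_index c n \<Longrightarrow> poly_vars (p \<alpha>) \<subseteq> hall_index c n <+> hall_index c n"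
  and q_vars: "\<alpha> \<in> hall_index c n \<Longrightarrow> poly_vars (q \<alpha>) \<subseteq> hall_index c n <+> UNIV"
  using canonical by (auto simp: canonical_polynomials_def)

text \<open>The tuples \<open>a\<close>, \<open>b\<close>, \<open>d\<close>, \<open>e\<close> are values of four tuples of ring variables. So
these identities are instances of identities between uniformly rational functions.\<close>

lemma identities:
  assumes a: "a \<in> tuples" and b: "b \<in> tuples" and d: "d \<in> tuples" and e: "e \<in> tuples"
  shows mult_closed: "\<mu> R a b \<in> tuples"
    and inv_closed: "\<iota> R a \<in> tuples"
    and mult_assoc: "\<mu> R (\<mu> R a b) d =
      \<mu> R a (\<mu> R b d)"
    and mult_zero: "\<mu> R (\<lambda>\<alpha>\<in>hall_index c n. \<zero>) a = a"
    and mult_inv: "\<mu> R (\<iota> R a) a = (\<lambda>\<alpha>\<in>hall_index c n. \<zero>)"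
    and mult_first_layer: "k \<in> {1..n 1} \<Longrightarrow> \<mu> R a b (1, k) = a (1, k) \<oplus> b (1, k)"
    and mult_last_layer: "\<mu> R (add_last_layer c n R a d) (add_last_layer c n R b e) =
      add_last_layer c n R (\<mu> R a b) (\<lambda>\<alpha>. d \<alpha> \<oplus> e \<alpha>)"
proof -
  interpret Z: binomial_domain \<Z> by (rule binomial_domain_int)
  interpret P: binomial_domain_pair \<Z> R by unfold_locales
  let ?x = "\<lambda>k. case k of 0 \<Rightarrow> a | Suc 0 \<Rightarrow> b | Suc (Suc 0) \<Rightarrow> d | _ \<Rightarrow> e"
  have "?x k \<in> tuples" for k using a b d e by (auto split: nat.split)
  then obtain v where v: "v \<in> sequences R" and "assignment_tuple c n v = ?x"
    using assignment_tuple_surj[of ?x c n "carrier R" \<zero>] by blast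
  then have x: "a = assignment_tuple c n v 0" "b = assignment_tuple c n v 1"
    "d = assignment_tuple c n v 2" "e = assignment_tuple c n v 3"
    by (simp_all add: numeral_2_eq_2 numeral_3_eq_3)
  note rules = P.rational_tuple_mult P.rational_tuple_inv
    P.rational_tuple_zero P.rational_tuple_assignment p_vars q_vars
  have Z: "assignment_tuple c n v k \<in> hall_index c n \<rightarrow>\<^sub>E UNIV" for v :: "nat \<Rightarrow> int" and k
    by (rule assignment_tuple_closed) simp
  have "P.rational_tuple c n (\<lambda>v. \<mu> \<Z> (assignment_tuple c n v 0) (assignment_tuple c n v 1))
      (\<lambda>v. \<mu> R (assignment_tuple c n v 0) (assignment_tuple c n v 1))" (is "P.rational_tuple c n ?M ?M'")
    by (intro rules)
  note M = this
  show "\<mu> R a b \<in> tuples" unfolding x using M v by (simp add: P.rational_tuple_def)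
  have "P.rational_tuple c n (\<lambda>v. \<iota> \<Z> (assignment_tuple c n v 0))
      (\<lambda>v. \<iota> R (assignment_tuple c n v 0))"
    by (intro rules)
  then show "\<iota> R a \<in> tuples" unfolding x using v by (simp add: P.rational_tuple_def)
  have eq: "\<forall>v. \<mu> \<Z> (\<mu> \<Z> (assignment_tuple c n v 0) (assignment_tuple c n v 1)) (assignment_tuple c n v 2) =
      \<mu> \<Z> (assignment_tuple c n v 0) (\<mu> \<Z> (assignment_tuple c n v 1) (assignment_tuple c n v 2))"
    by (rule allI, rule mult_assoc_int[OF Z Z Z])
  show "\<mu> R (\<mu> R a b) d =
      \<mu> R a (\<mu> R b d)"
    unfolding x by (rule tuple_identity_from_int[where c = c and n = n, OF _ _ eq v]) (intro rules; assumption)+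
  have eq: "\<forall>v. \<mu> \<Z> (\<lambda>\<alpha>\<in>hall_index c n. 0) (assignment_tuple c n v 0) =
      (assignment_tuple c n v 0)"
    by (rule allI, rule mult_zero_int[OF Z Z Z])
  show "\<mu> R (\<lambda>\<alpha>\<in>hall_index c n. \<zero>) a = a"
    unfolding x by (rule tuple_identity_from_int[where c = c and n = n, OF _ _ eq v]) (intro rules[unfolded int_zero_eq]; assumption)+
  have eq: "\<forall>v. \<mu> \<Z> (\<iota> \<Z> (assignment_tuple c n v 0)) (assignment_tuple c n v 0) =
      (\<lambda>\<alpha>\<in>hall_index c n. 0)"
    by (rule allI, rule mult_inv_int[OF Z Z Z])
  show "\<mu> R (\<iota> R a) a = (\<lambda>\<alpha>\<in>hall_index c n. \<zero>)"
    unfolding x by (rule tuple_identity_from_int[where c = c and n = n, OF _ _ eq v]) (intro rules[unfolded int_zero_eq]; assumption)+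
  have coordinate: "P.rational (\<lambda>v. assignment_tuple c n v i \<alpha>) (\<lambda>v. assignment_tuple c n v i \<alpha>)"
    if "\<alpha> \<in> hall_index c n" for i \<alpha>
    using P.rational_tuple_assignment[of c n i] that by (auto simp: P.rational_tuple_def)
  have sum: "P.rational (\<lambda>v. assignment_tuple c n v i \<alpha> + assignment_tuple c n v j \<alpha>)
      (\<lambda>v. assignment_tuple c n v i \<alpha> \<oplus> assignment_tuple c n v j \<alpha>)" if "\<alpha> \<in> hall_index c n" for i j \<alpha>
    using P.rational_add[OF coordinate[OF that] coordinate[OF that]] by simp
  have eq: "\<forall>v. \<mu> \<Z> (add_last_layer c n \<Z> (assignment_tuple c n v 0) (assignment_tuple c n v 2))
        (add_last_layer c n \<Z> (assignment_tuple c n v 1) (assignment_tuple c n v 3)) =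
      add_last_layer c n \<Z> (\<mu> \<Z> (assignment_tuple c n v 0) (assignment_tuple c n v 1))
        (\<lambda>\<alpha>. assignment_tuple c n v 2 \<alpha> + assignment_tuple c n v 3 \<alpha>)"
    by (rule allI, rule mult_last_layer_int[OF Z Z Z])
  show "\<mu> R (add_last_layer c n R a d) (add_last_layer c n R b e) =
      add_last_layer c n R (\<mu> R a b) (\<lambda>\<alpha>. d \<alpha> \<oplus> e \<alpha>)"
    unfolding x
  proof (rule tuple_identity_from_int[where c = c and n = n, OF _ _ eq v])
    show "P.rational_tuple c n
        (\<lambda>v. \<mu> \<Z> (add_last_layer c n \<Z> (assignment_tuple c n v 0) (assignment_tuple c n v 2))
          (add_last_layer c n \<Z> (assignment_tuple c n v 1) (assignment_tuple c n v 3)))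
        (\<lambda>v. \<mu> R (add_last_layer c n R (assignment_tuple c n v 0) (assignment_tuple c n v 2))
          (add_last_layer c n R (assignment_tuple c n v 1) (assignment_tuple c n v 3)))"
      by (intro P.rational_tuple_mult P.rational_tuple_add_last_layer P.rational_tuple_assignment coordinate p_vars)
    show "P.rational_tuple c n
        (\<lambda>v. add_last_layer c n \<Z> (\<mu> \<Z> (assignment_tuple c n v 0) (assignment_tuple c n v 1))
          (\<lambda>\<alpha>. assignment_tuple c n v 2 \<alpha> + assignment_tuple c n v 3 \<alpha>))
        (\<lambda>v. add_last_layer c n R (\<mu> R (assignment_tuple c n v 0) (assignment_tuple c n v 1))
          (\<lambda>\<alpha>. assignment_tuple c n v 2 \<alpha> \<oplus> assignment_tuple c n v 3 \<alpha>))"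
      by (rule P.rational_tuple_add_last_layer[OF M sum])
  qed
  show "\<mu> R a b (1, k) = a (1, k) \<oplus> b (1, k)" if k: "k \<in> {1..n 1}"
  proof -
    have I: "(1, k) \<in> hall_index c n" using k c by (simp add: hall_index_def)
    have "P.rational (\<lambda>v. ?M v (1, k)) (\<lambda>v. ?M' v (1, k))"
      using M I by (auto simp: P.rational_tuple_def)
    from rational_identity_from_int[OF this sum[OF I] mult_first_layer_int[OF Z Z Z k] v]
    show ?thesis unfolding x .
  qed
qed

abbreviation "completion \<equiv> hall_completion c n p q R"

lemma hall_completion_simps:
  "carrier completion = tuples" "a \<otimes>\<^bsub>completion\<^esub> b = \<mu> R a b" "\<one>\<^bsub>completion\<^esub> = (\<lambda>\<alpha>\<in>hall_index c n. \<zero>)"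
  by (simp_all add: hall_completion_def coordinate_mult_def)

lemma zero_tuple: "(\<lambda>\<alpha>\<in>hall_index c n. \<zero>) \<in> tuples"
  by simp

theorem group_hall_completion: "group completion"
proof (rule groupI)
  fix a b d assume "a \<in> carrier completion" "b \<in> carrier completion" "d \<in> carrier completion"
  then have a: "a \<in> tuples" and b: "b \<in> tuples" and d: "d \<in> tuples" by (simp_all add: hall_completion_simps)
  show "a \<otimes>\<^bsub>completion\<^esub> b \<in> carrier completion" unfolding hall_completion_simps by (rule mult_closed[OF a b a a])
  show "a \<otimes>\<^bsub>completion\<^esub> b \<otimes>\<^bsub>completion\<^esub> d = a \<otimes>\<^bsub>completion\<^esub> (b \<otimes>\<^bsub>completion\<^esub> d)"
    unfolding hall_completion_simps by (rule mult_assoc[OF a b d a])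
next
  show "\<one>\<^bsub>completion\<^esub> \<in> carrier completion" unfolding hall_completion_simps by (rule zero_tuple)
next
  fix a assume "a \<in> carrier completion"
  then have a: "a \<in> tuples" by (simp add: hall_completion_simps)
  show "\<one>\<^bsub>completion\<^esub> \<otimes>\<^bsub>completion\<^esub> a = a" unfolding hall_completion_simps by (rule mult_zero[OF a a a a])
  show "\<exists>b\<in>carrier completion. b \<otimes>\<^bsub>completion\<^esub> a = \<one>\<^bsub>completion\<^esub>"
    unfolding hall_completion_simps 
    by (rule bexI[where x = "\<iota> R a"]) (rule mult_inv[OF a a a a], rule inv_closed[OF a a a a])
qed

lemma inv_hall_completion: "a \<in> tuples \<Longrightarrow> inv\<^bsub>completion\<^esub> a = \<iota> R a"
  using group.inv_equality[OF group_hall_completion, of "\<iota> R a" a]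
    mult_inv[of a a a a] inv_closed[of a a a a] by (simp add: hall_completion_simps)

end

section \<open>Interpretation of the Hall completion in the ring\<close>

lemma satisfies_foldr_Forall:
  "v \<in> UNIV \<rightarrow> D \<Longrightarrow> satisfies D val v (foldr Forall L \<phi>) \<longleftrightarrow>
    (\<forall>w\<in>UNIV \<rightarrow> D. (\<forall>m. m \<notin> set L \<longrightarrow> w m = v m) \<longrightarrow> satisfies D val w \<phi>)"
proof (induction L arbitrary: v)
  case Nil
  have "w = v" if "\<forall>m. w m = v m" for w :: "nat \<Rightarrow> 'a" using that by blast
  with Nil show ?case by auto
next
  case (Cons k L)
  have upd: "v(k := x) \<in> UNIV \<rightarrow> D" if "x \<in> D" for x using Cons.prems that by auto
  have "satisfies D val v (foldr Forall (k # L) \<phi>) \<longleftrightarrow>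
      (\<forall>x\<in>D. \<forall>w\<in>UNIV \<rightarrow> D. (\<forall>m. m \<notin> set L \<longrightarrow> w m = (v(k := x)) m) \<longrightarrow> satisfies D val w \<phi>)"
    by (simp only: foldr.simps comp_apply satisfies.simps Cons.IH[OF upd] cong: ball_cong)
  also have "\<dots> \<longleftrightarrow> (\<forall>w\<in>UNIV \<rightarrow> D. (\<forall>m. m \<notin> set (k # L) \<longrightarrow> w m = v m) \<longrightarrow> satisfies D val w \<phi>)"
  proof (intro iffI ballI impI)
    fix w assume *: "\<forall>x\<in>D. \<forall>w\<in>UNIV \<rightarrow> D. (\<forall>m. m \<notin> set L \<longrightarrow> w m = (v(k := x)) m) \<longrightarrow> satisfies D val w \<phi>"
      and w: "w \<in> UNIV \<rightarrow> D" "\<forall>m. m \<notin> set (k # L) \<longrightarrow> w m = v m"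
    have "w k \<in> D" using w(1) by auto
    moreover have "\<forall>m. m \<notin> set L \<longrightarrow> w m = (v(k := w k)) m" using w(2) by simp
    ultimately show "satisfies D val w \<phi>" using * w(1) by blast
  next
    fix x w assume *: "\<forall>w\<in>UNIV \<rightarrow> D. (\<forall>m. m \<notin> set (k # L) \<longrightarrow> w m = v m) \<longrightarrow> satisfies D val w \<phi>"
      and w: "w \<in> UNIV \<rightarrow> D" "\<forall>m. m \<notin> set L \<longrightarrow> w m = (v(k := x)) m"
    have "\<forall>m. m \<notin> set (k # L) \<longrightarrow> w m = v m" using w(2) by simp
    with * w(1) show "satisfies D val w \<phi>" by blast
  qed
  finally show ?case .
qed

lemma models_foldr_Forall: "models D val (foldr Forall L \<phi>) \<longleftrightarrow> models D val \<phi>"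
proof
  assume "models D val (foldr Forall L \<phi>)"
  then show "models D val \<phi>" by (simp add: models_def satisfies_foldr_Forall)
next
  assume "models D val \<phi>"
  then show "models D val (foldr Forall L \<phi>)" by (simp add: models_def satisfies_foldr_Forall)
qed

lemma finite_free_vars: "(\<And>t. finite (tv t)) \<Longrightarrow> finite (free_vars tv \<phi>)"
  by (induction \<phi>) auto

lemma free_vars_foldr_Forall: "free_vars tv (foldr Forall L \<phi>) = free_vars tv \<phi> - set L"
  by (induction L) auto

text \<open>Elementary equivalence speaks of sentences only, but a formula is valid if and only if its universal closure is.\<close>

lemma ring_elem_equiv_models:
  assumes "ring_elem_equiv R S"
  shows "models (carrier R) (ring_term_val R) \<phi> \<longleftrightarrow> models (carrier S) (ring_term_val S) \<phi>"
proof -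
  obtain L where L: "set L = free_vars ring_term_vars \<phi>"
    using finite_list[OF finite_free_vars[of ring_term_vars \<phi>, OF finite_ring_term_vars]] by blast
  have "free_vars ring_term_vars (foldr Forall L \<phi>) = {}"
    by (simp add: free_vars_foldr_Forall L)
  then have "models (carrier R) (ring_term_val R) (foldr Forall L \<phi>) \<longleftrightarrow>
      models (carrier S) (ring_term_val S) (foldr Forall L \<phi>)"
    using assms unfolding ring_elem_equiv_def by blast
  then show ?thesis by (simp add: models_foldr_Forall)
qed

locale hall_polynomials_over_pair = hall_polynomials + binomial_domain_pair R S
  for R :: "('a, 'm) ring_scheme" and S :: "('b, 'l) ring_scheme"
begin

sublocale R: hall_polynomials_over r c n h p q R ..
sublocale S: hall_polynomials_over r c n h p q S ..

abbreviation "NR \<equiv> hall_completion c n p q R"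
abbreviation "NS \<equiv> hall_completion c n p q S"

lemma rational_tuple_group_term:
  "rational_tuple c n (\<lambda>v. group_term_val NR (assignment_tuple c n v) t)
    (\<lambda>v. group_term_val NS (assignment_tuple c n v) t)"
proof (induction t)
  case (GVar k)
  then show ?case by (simp add: rational_tuple_assignment)
next
  case GOne
  show ?case
    unfolding group_term_val.simps R.hall_completion_simps S.hall_completion_simps by (rule rational_tuple_zero)
next
  case (GInv t)
  show ?case
  proof (rule rational_tuple_cong[OF rational_tuple_inv[OF GInv R.q_vars]])
    fix v :: "nat \<Rightarrow> 'a" assume "v \<in> sequences R"
    then show "group_term_val NR (assignment_tuple c n v) (GInv t) =
        \<iota> R (group_term_val NR (assignment_tuple c n v) t)"
      using GInv by (simp add: R.inv_hall_completion rational_tuple_def)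
  next
    fix v :: "nat \<Rightarrow> 'b" assume "v \<in> sequences S"
    then show "group_term_val NS (assignment_tuple c n v) (GInv t) =
        \<iota> S (group_term_val NS (assignment_tuple c n v) t)"
      using GInv by (simp add: S.inv_hall_completion rational_tuple_def)
  qed
next
  case (GMul s t)
  then show ?case
    by (simp add: R.hall_completion_simps S.hall_completion_simps rational_tuple_mult R.p_vars)
qed

lemma tuple_eq_iff_formula:
  assumes A: "rational_tuple c n A B" and A': "rational_tuple c n A' B'"
  shows "\<exists>\<psi>. (\<forall>v\<in>sequences R. A v = A' v \<longleftrightarrow> ring_satisfies R v \<psi>) \<and>
    (\<forall>v\<in>sequences S. B v = B' v \<longleftrightarrow> ring_satisfies S v \<psi>)"
proof -
  have "\<exists>\<psi>. (\<forall>v\<in>sequences R. (\<forall>\<alpha>\<in>J. A v \<alpha> = A' v \<alpha>) \<longleftrightarrow> ring_satisfies R v \<psi>) \<and>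
    (\<forall>v\<in>sequences S. (\<forall>\<alpha>\<in>J. B v \<alpha> = B' v \<alpha>) \<longleftrightarrow> ring_satisfies S v \<psi>)"
    if "finite J" "J \<subseteq> hall_index c n" for J
    using that
  proof (induction J rule: finite_induct)
    case empty
    show ?case by (rule exI[of _ "Equal RZero RZero"]) simp
  next
    case (insert \<alpha> J)
    then obtain \<psi> where \<psi>: "\<forall>v\<in>sequences R. (\<forall>\<alpha>\<in>J. A v \<alpha> = A' v \<alpha>) \<longleftrightarrow> ring_satisfies R v \<psi>"
      "\<forall>v\<in>sequences S. (\<forall>\<alpha>\<in>J. B v \<alpha> = B' v \<alpha>) \<longleftrightarrow> ring_satisfies S v \<psi>"
      by auto
    have "\<alpha> \<in> hall_index c n" using insert.prems by simp
    then have "rational (\<lambda>v. A v \<alpha>) (\<lambda>v. B v \<alpha>)" "rational (\<lambda>v. A' v \<alpha>) (\<lambda>v. B' v \<alpha>)"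
      using A A' by (simp_all add: rational_tuple_def)
    from rational_eq_iff_term_eq[OF this] obtain s t
      where "\<forall>v\<in>sequences R. A v \<alpha> = A' v \<alpha> \<longleftrightarrow> ring_term_val R v s = ring_term_val R v t"
        "\<forall>v\<in>sequences S. B v \<alpha> = B' v \<alpha> \<longleftrightarrow> ring_term_val S v s = ring_term_val S v t"
      by auto
    with \<psi> show ?case by (intro exI[of _ "Conj (Equal s t) \<psi>"]) simp
  qed
  from this[OF finite_hall_index[of c n] subset_refl] obtain \<psi>
    where \<psi>: "\<forall>v\<in>sequences R. (\<forall>\<alpha>\<in>hall_index c n. A v \<alpha> = A' v \<alpha>) \<longleftrightarrow> ring_satisfies R v \<psi>"
      "\<forall>v\<in>sequences S. (\<forall>\<alpha>\<in>hall_index c n. B v \<alpha> = B' v \<alpha>) \<longleftrightarrow> ring_satisfies S v \<psi>"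
    by auto
  have "A v = A' v \<longleftrightarrow> (\<forall>\<alpha>\<in>hall_index c n. A v \<alpha> = A' v \<alpha>)" if "v \<in> sequences R" for v
    using A A' that unfolding rational_tuple_def by (metis PiE_ext)
  moreover have "B v = B' v \<longleftrightarrow> (\<forall>\<alpha>\<in>hall_index c n. B v \<alpha> = B' v \<alpha>)" if "v \<in> sequences S" for v
    using A A' that unfolding rational_tuple_def by (metis PiE_ext)
  ultimately show ?thesis using \<psi> by (intro exI[of _ \<psi>]) simp
qed

end

definition block_vars :: "nat \<Rightarrow> (nat \<Rightarrow> nat) \<Rightarrow> nat \<Rightarrow> nat list" where
  "block_vars c n k = map (\<lambda>\<alpha>. prod_encode (k, prod_encode \<alpha>)) (hall_index_list c n)"

lemma set_block_vars: "set (block_vars c n k) = (\<lambda>\<alpha>. prod_encode (k, prod_encode \<alpha>)) ` hall_index c n"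
  unfolding block_vars_def set_map
  by (rule arg_cong[where f = "image _"]) (force simp: hall_index_list_def hall_index_def simp del: upt_Suc)

text \<open>A quantifier over tuples is a block of quantifiers over ring elements.\<close>

lemma satisfies_Forall_tuple:
  assumes v: "v \<in> UNIV \<rightarrow> D"
    and \<psi>: "\<And>v. v \<in> UNIV \<rightarrow> D \<Longrightarrow> Q (assignment_tuple c n v) \<longleftrightarrow> satisfies D val v \<psi>"
  shows "(\<forall>x \<in> hall_index c n \<rightarrow>\<^sub>E D. Q ((assignment_tuple c n v)(k := x))) \<longleftrightarrow>
    satisfies D val v (foldr Forall (block_vars c n k) \<psi>)"
  unfolding satisfies_foldr_Forall[OF v] set_block_vars
proof (intro iffI ballI impI)
  fix w assume Q: "\<forall>x \<in> hall_index c n \<rightarrow>\<^sub>E D. Q ((assignment_tuple c n v)(k := x))"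
    and w: "w \<in> UNIV \<rightarrow> D"
      "\<forall>m. m \<notin> (\<lambda>\<alpha>. prod_encode (k, prod_encode \<alpha>)) ` hall_index c n \<longrightarrow> w m = v m"
  have "w (prod_encode (j, prod_encode \<alpha>)) = v (prod_encode (j, prod_encode \<alpha>))" if "j \<noteq> k" for j \<alpha>
    by (rule w(2)[rule_format]) (use that in \<open>auto simp: prod_encode_eq\<close>)
  then have "assignment_tuple c n w j = ((assignment_tuple c n v)(k := assignment_tuple c n w k)) j" for j
    by (auto simp: assignment_tuple_def fun_eq_iff restrict_def)
  then have "assignment_tuple c n w = (assignment_tuple c n v)(k := assignment_tuple c n w k)" by blast
  moreover have "Q ((assignment_tuple c n v)(k := assignment_tuple c n w k))"
    by (rule bspec[OF Q assignment_tuple_closed[OF w(1)]])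
  ultimately have "Q (assignment_tuple c n w)" by (simp only:)
  then show "satisfies D val w \<psi>" using \<psi>[OF w(1)] by simp
next
  fix x assume sat: "\<forall>w\<in>UNIV \<rightarrow> D.
      (\<forall>m. m \<notin> (\<lambda>\<alpha>. prod_encode (k, prod_encode \<alpha>)) ` hall_index c n \<longrightarrow> w m = v m) \<longrightarrow> satisfies D val w \<psi>"
    and x: "x \<in> hall_index c n \<rightarrow>\<^sub>E D"
  define w where "w m = (case prod_decode m of (k', l) \<Rightarrow>
    if k' = k \<and> prod_decode l \<in> hall_index c n then x (prod_decode l) else v m)" for m
  have w: "w \<in> UNIV \<rightarrow> D" using v x by (auto simp: w_def PiE_iff split: prod.split)
  have "w m = v m" if m: "m \<notin> (\<lambda>\<alpha>. prod_encode (k, prod_encode \<alpha>)) ` hall_index c n" for m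
  proof -
    obtain k' \<alpha> where m': "m = prod_encode (k', prod_encode \<alpha>)"
      by (metis prod_decode_inverse surj_pair)
    show ?thesis using m by (auto simp: w_def m')
  qed
  with sat w have "satisfies D val w \<psi>" by blast
  moreover have "assignment_tuple c n w j = ((assignment_tuple c n v)(k := x)) j" for j
    using PiE_arb[OF x] by (auto simp: assignment_tuple_def w_def fun_eq_iff restrict_def)
  then have "assignment_tuple c n w = (assignment_tuple c n v)(k := x)" by blast
  ultimately show "Q ((assignment_tuple c n v)(k := x))" using \<psi>[OF w] by (simp only:)
qed

context hall_polynomials_over_pair
begin

definition translates :: "group_term fo_formula \<Rightarrow> ring_term fo_formula \<Rightarrow> bool" where
  "translates \<phi> \<psi> \<longleftrightarrow>
    (\<forall>v\<in>sequences R. group_satisfies NR (assignment_tuple c n v) \<phi> \<longleftrightarrow>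
      ring_satisfies R v \<psi>) \<and>
    (\<forall>v\<in>sequences S. group_satisfies NS (assignment_tuple c n v) \<phi> \<longleftrightarrow>
      ring_satisfies S v \<psi>)"

lemma group_formula_translation: "\<exists>\<psi>. translates \<phi> \<psi>"
proof (induction \<phi>)
  case (Equal s t)
  show ?case
    using tuple_eq_iff_formula[OF rational_tuple_group_term[of s] rational_tuple_group_term[of t]]
    by (simp add: translates_def)
next
  case (Neg \<phi>)
  then obtain \<psi> where "translates \<phi> \<psi>" ..
  then show ?case by (intro exI[of _ "Neg \<psi>"]) (simp add: translates_def)
next
  case (Conj \<phi> \<phi>')
  then obtain \<psi> \<psi>' where "translates \<phi> \<psi>" "translates \<phi>' \<psi>'" by blast
  then show ?case by (intro exI[of _ "Conj \<psi> \<psi>'"]) (simp add: translates_def)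
next
  case (Forall k \<phi>)
  then obtain \<psi> where "translates \<phi> \<psi>" ..
  then have \<psi>: "\<And>v. v \<in> sequences R \<Longrightarrow>
      group_satisfies NR (assignment_tuple c n v) \<phi> \<longleftrightarrow>
      ring_satisfies R v \<psi>"
    "\<And>v. v \<in> sequences S \<Longrightarrow> group_satisfies NS (assignment_tuple c n v) \<phi> \<longleftrightarrow>
      ring_satisfies S v \<psi>"
    by (simp_all add: translates_def)
  have "group_satisfies NR (assignment_tuple c n v) (Forall k \<phi>) \<longleftrightarrow>
      ring_satisfies R v (foldr Forall (block_vars c n k) \<psi>)"
    if v: "v \<in> sequences R" for v
    using satisfies_Forall_tuple[where c = c and n = n and k = k and
      Q = "\<lambda>w. group_satisfies NR w \<phi>", OF v \<psi>(1)]
    by (simp only: satisfies.simps R.hall_completion_simps(1))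
  moreover have "group_satisfies NS (assignment_tuple c n v) (Forall k \<phi>) \<longleftrightarrow>
      ring_satisfies S v (foldr Forall (block_vars c n k) \<psi>)"
    if v: "v \<in> sequences S" for v
    using satisfies_Forall_tuple[where c = c and n = n and k = k and
      Q = "\<lambda>w. group_satisfies NS w \<phi>", OF v \<psi>(2)]
    by (simp only: satisfies.simps S.hall_completion_simps(1))
  ultimately show ?case unfolding translates_def by blast
qed

text \<open>Since each assignment of tuples to the group variables comes from an assignment of ring elements, a group formula
is valid in the completion if and only if its translation is valid in the ring.\<close>

theorem hall_completion_models_iff:
  assumes "ring_elem_equiv R S"
  shows "models (carrier NR) (group_term_val NR) \<phi> \<longleftrightarrow> models (carrier NS) (group_term_val NS) \<phi>"
proof -
  have tuples: "(\<forall>w\<in>UNIV \<rightarrow> (hall_index c n \<rightarrow>\<^sub>E D). Q w) \<longleftrightarrow> (\<forall>v\<in>UNIV \<rightarrow> D. Q (assignment_tuple c n v))"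
    if x: "x \<in> D" for D :: "'x set" and x Q
  proof
    assume "\<forall>w\<in>UNIV \<rightarrow> (hall_index c n \<rightarrow>\<^sub>E D). Q w"
    then show "\<forall>v\<in>UNIV \<rightarrow> D. Q (assignment_tuple c n v)"
      using assignment_tuple_closed[of _ D c n] by blast
  next
    assume *: "\<forall>v\<in>UNIV \<rightarrow> D. Q (assignment_tuple c n v)"
    show "\<forall>w\<in>UNIV \<rightarrow> (hall_index c n \<rightarrow>\<^sub>E D). Q w"
    proof
      fix w :: "nat \<Rightarrow> nat \<times> nat \<Rightarrow> 'x" assume "w \<in> UNIV \<rightarrow> (hall_index c n \<rightarrow>\<^sub>E D)"
      then obtain v where "v \<in> UNIV \<rightarrow> D" "assignment_tuple c n v = w"
        using assignment_tuple_surj[of w c n D, OF _ x] by blast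
      with * show "Q w" by blast
    qed
  qed
  obtain \<psi> where \<psi>: "translates \<phi> \<psi>" using group_formula_translation ..
  have "models (carrier NR) (group_term_val NR) \<phi> \<longleftrightarrow> models (carrier R) (ring_term_val R) \<psi>"
    unfolding models_def using tuples[OF R.zero_closed] \<psi> by (simp add: R.hall_completion_simps translates_def)
  moreover have "models (carrier NS) (group_term_val NS) \<phi> \<longleftrightarrow> models (carrier S) (ring_term_val S) \<psi>"
    unfolding models_def using tuples[OF S.zero_closed] \<psi> by (simp add: S.hall_completion_simps translates_def)
  ultimately show ?thesis using ring_elem_equiv_models[OF assms] by simp
qed

end

section \<open>Binomial domains form an elementary class\<close>

primrec falling_factorial_term :: "nat \<Rightarrow> ring_term" where
  "falling_factorial_term 0 = ROne"
| "falling_factorial_term (Suc k) = RMul (falling_factorial_term k) (RAdd (RVar 0) (RNeg (nat_term k)))"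

lemma (in cring) falling_factorial_term_val:
  assumes "v \<in> sequences R"
  shows "ring_term_val R v (falling_factorial_term k) = falling_factorial R (v 0) k"
proof (induction k)
  case 0
  then show ?case by (simp add: falling_factorial_def)
next
  case (Suc k)
  have v: "v 0 \<in> carrier R" using assms by auto
  have "falling_factorial R (v 0) (Suc k) = (v 0 \<ominus> [k] \<cdot> \<one>) \<otimes> falling_factorial R (v 0) k"
    unfolding falling_factorial_def lessThan_Suc by (subst finprod_insert) (use v in auto)
  moreover have "falling_factorial R (v 0) k \<in> carrier R"
    unfolding falling_factorial_def by (rule finprod_closed) (use v in auto)
  ultimately show ?case using v Suc by (simp add: nat_term_val a_minus_def m_comm)
qed

lemma models_ring_cong:
  assumes "ring_elem_equiv S R" "\<And>v. v \<in> sequences R \<Longrightarrow> ring_satisfies R v \<phi>"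
    and "v \<in> sequences S"
  shows "ring_satisfies S v \<phi>"
  using ring_elem_equiv_models[OF assms(1), of \<phi>] assms(2,3) by (simp add: models_def)

text \<open>Characteristic zero and the existence of binomial coefficients are schemes of sentences, one for each \<open>k\<close>.
Uniqueness of binomial coefficients follows from cancellation of \<open>k!\<close>.\<close>

theorem binomial_domain_elementary:
  assumes R: "binomial_domain R" and S: "ring S" and equiv: "ring_elem_equiv S R"
  shows "binomial_domain S"
proof -
  interpret R: binomial_domain R by (rule R)
  interpret S: ring S by (rule S)
  note transfer = models_ring_cong[OF equiv]
  let ?v = "\<lambda>x y k::nat. if k = 0 then x else y"
  have v: "?v x y \<in> UNIV \<rightarrow> D" if "x \<in> D" "y \<in> D" for x y :: 'x and D using that by auto
  have comm: "x \<otimes>\<^bsub>S\<^esub> y = y \<otimes>\<^bsub>S\<^esub> x" if xy: "x \<in> carrier S" "y \<in> carrier S" for x y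
    using transfer[of "Equal (RMul (RVar 0) (RVar 1)) (RMul (RVar 1) (RVar 0))", OF _ v[OF xy]]
    by (simp add: R.m_comm Pi_iff)
  interpret S: cring S by unfold_locales (rule comm)
  have one: "\<one>\<^bsub>S\<^esub> \<noteq> \<zero>\<^bsub>S\<^esub>"
    using transfer[of "Neg (Equal ROne RZero)", OF _ v[OF S.zero_closed S.zero_closed]] by simp
  have integral: "x = \<zero>\<^bsub>S\<^esub> \<or> y = \<zero>\<^bsub>S\<^esub>" if "x \<otimes>\<^bsub>S\<^esub> y = \<zero>\<^bsub>S\<^esub>" and xy: "x \<in> carrier S" "y \<in> carrier S" for x y
    using transfer[of "Neg (Conj (Equal (RMul (RVar 0) (RVar 1)) RZero)
      (Conj (Neg (Equal (RVar 0) RZero)) (Neg (Equal (RVar 1) RZero))))", OF _ v[OF xy]] that(1)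
      R.integral by (auto simp: Pi_iff)
  interpret S: domain S by unfold_locales (fact one, fact integral)
  have char_zero: "[k] \<cdot>\<^bsub>S\<^esub> \<one>\<^bsub>S\<^esub> \<noteq> \<zero>\<^bsub>S\<^esub>" if "k > 0" for k :: nat
    using transfer[of "Neg (Equal (nat_term k) RZero)", OF _ v[OF S.zero_closed S.zero_closed]]
      R.char_zero[OF that] by (simp add: R.nat_term_val S.nat_term_val)
  show ?thesis
  proof
    show "[k] \<cdot>\<^bsub>S\<^esub> \<one>\<^bsub>S\<^esub> \<noteq> \<zero>\<^bsub>S\<^esub>" if "k > 0" for k :: nat by (rule char_zero[OF that])
    fix a and k :: nat assume a: "a \<in> carrier S" and k: "k > 0"
    \<comment> \<open>the variable \<open>0\<close> stays free and carries the upper argument of the binomial coefficient\<close>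
    let ?\<phi> = "Neg (Forall 1 (Neg (Equal (falling_factorial_term k) (RMul (RVar 1) (nat_term (fact k))))))"
    have R\<phi>: "ring_satisfies R v ?\<phi>" if v: "v \<in> sequences R" for v
    proof -
      have v0: "v 0 \<in> carrier R" using v by auto
      obtain x where x: "x \<in> carrier R"
        "falling_factorial R (v 0) k = x \<otimes>\<^bsub>R\<^esub> ([(fact k :: nat)] \<cdot>\<^bsub>R\<^esub> \<one>\<^bsub>R\<^esub>)"
        using R.ex1_binom[OF v0 k] by blast
      have "v(1 := x) \<in> sequences R" using v x by auto
      from R.falling_factorial_term_val[OF this] x show ?thesis
        by (auto simp: R.nat_term_val intro!: bexI[of _ x])
    qed
    have "ring_satisfies S (\<lambda>_. a) ?\<phi>"
      by (rule transfer[OF R\<phi>]) (use a in auto)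
    then obtain x where x: "x \<in> carrier S"
      "ring_term_val S ((\<lambda>_. a)(1 := x)) (falling_factorial_term k) = x \<otimes>\<^bsub>S\<^esub> ([(fact k :: nat)] \<cdot>\<^bsub>S\<^esub> \<one>\<^bsub>S\<^esub>)"
      by (auto simp: S.nat_term_val)
    have "(\<lambda>_. a)(1 := x) \<in> sequences S" using a x by auto
    from S.falling_factorial_term_val[OF this] x
    have ff: "falling_factorial S a k = x \<otimes>\<^bsub>S\<^esub> ([(fact k :: nat)] \<cdot>\<^bsub>S\<^esub> \<one>\<^bsub>S\<^esub>)" by simp
    show "\<exists>!x. x \<in> carrier S \<and> falling_factorial S a k = x \<otimes>\<^bsub>S\<^esub> ([(fact k :: nat)] \<cdot>\<^bsub>S\<^esub> \<one>\<^bsub>S\<^esub>)"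
    proof (rule ex1I[of _ x])
      show "x \<in> carrier S \<and> falling_factorial S a k = x \<otimes>\<^bsub>S\<^esub> ([(fact k :: nat)] \<cdot>\<^bsub>S\<^esub> \<one>\<^bsub>S\<^esub>)" using x ff by blast
      fix y assume "y \<in> carrier S \<and> falling_factorial S a k = y \<otimes>\<^bsub>S\<^esub> ([(fact k :: nat)] \<cdot>\<^bsub>S\<^esub> \<one>\<^bsub>S\<^esub>)"
      then show "y = x"
        using ff x(1) S.m_rcancel[OF char_zero[of "fact k"] S.nat_embed_closed] by auto
    qed
  qed
qed

section \<open>The deformed product splits up to an ultrafilter\<close>

lemma deformation_mult:
  fixes S (structure)
  shows "a \<otimes>\<^bsub>deformation r c n p q S f\<^esub> b =
    add_last_layer c n S (coordinate_mult c n p S a b) (\<lambda>\<alpha>. \<Oplus>k\<in>{1..r}. f k (a (1, k)) (b (1, k)) (snd \<alpha>))"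
proof
  fix \<alpha> :: "nat \<times> nat"
  obtain i j where \<alpha>: "\<alpha> = (i, j)" by force
  show "(a \<otimes>\<^bsub>deformation r c n p q S f\<^esub> b) \<alpha> =
      add_last_layer c n S (coordinate_mult c n p S a b) (\<lambda>\<alpha>. \<Oplus>k\<in>{1..r}. f k (a (1, k)) (b (1, k)) (snd \<alpha>)) \<alpha>"
  proof (cases "(i, j) \<in> hall_index c n")
    case True
    then have "i \<le> c" by (simp add: hall_index_def)
    then show ?thesis using True
      by (cases "i = c") (auto simp: \<alpha> deformation_def coordinate_mult_def add_last_layer_def)
  qed (simp add: \<alpha> deformation_def add_last_layer_def)
qed

locale cocycle_deformation = free_ultrafilter U + hall_polynomials_over r c n h p q S
  for U r c n h p q and S :: "('b, 'k) ring_scheme" (structure) +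
  fixes f :: "nat \<Rightarrow> 'b \<Rightarrow> 'b \<Rightarrow> nat \<Rightarrow> 'b"
  assumes c2: "c \<ge> 2"
    and f: "k \<in> {1..r} \<Longrightarrow> symmetric_cocycle (add_monoid S) (sum_group {1..n c} (\<lambda>_. add_monoid S)) (f k)"
begin

abbreviation "D \<equiv> deformation r c n p q S f"

lemma n_1: "n 1 = r"
  using hall by (simp add: hall_basic_sequence_def)

lemma first_layer_index: "k \<in> {1..r} \<Longrightarrow> (1, k) \<in> hall_index c n"
  using n_1 c2 by (auto simp: hall_index_def)

lemma component_cocycle:
  assumes k: "k \<in> {1..r}" and j: "j \<in> {1..n c}"
  shows "symmetric_cocycle (add_monoid S) (add_monoid S) (\<lambda>x y. f k x y j)"
proof -
  have eval: "x j = y j" if "x = y" for x y :: "nat \<Rightarrow> 'b" using that by simp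
  have closed: "f k x y j \<in> carrier S" if "x \<in> carrier S" "y \<in> carrier S" for x y
  proof -
    have "f k x y \<in> carrier (sum_group {1..n c} (\<lambda>_. add_monoid S))"
      using f[OF k] that by (auto simp: symmetric_cocycle_def)
    then have "f k x y \<in> {1..n c} \<rightarrow>\<^sub>E carrier S"
      by (subst (asm) carrier_sum_group) (auto intro: add.is_group)
    then show ?thesis using j by (rule PiE_mem)
  qed
  show ?thesis
    unfolding symmetric_cocycle_def
  proof (intro conjI ballI)
    show "(\<lambda>x y. f k x y j) \<in> carrier (add_monoid S) \<rightarrow> carrier (add_monoid S) \<rightarrow> carrier (add_monoid S)"
      using closed by auto
  next
    fix x y z assume "x \<in> carrier (add_monoid S)" "y \<in> carrier (add_monoid S)" "z \<in> carrier (add_monoid S)"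
    with f[OF k] have "f k (x \<otimes>\<^bsub>add_monoid S\<^esub> y) z \<otimes>\<^bsub>sum_group {1..n c} (\<lambda>_. add_monoid S)\<^esub> f k x y =
        f k x (y \<otimes>\<^bsub>add_monoid S\<^esub> z) \<otimes>\<^bsub>sum_group {1..n c} (\<lambda>_. add_monoid S)\<^esub> f k y z"
      unfolding symmetric_cocycle_def by blast
    from eval[OF this] j
    show "f k (x \<otimes>\<^bsub>add_monoid S\<^esub> y) z j \<otimes>\<^bsub>add_monoid S\<^esub> f k x y j =
        f k x (y \<otimes>\<^bsub>add_monoid S\<^esub> z) j \<otimes>\<^bsub>add_monoid S\<^esub> f k y z j" by simp
  next
    fix x assume "x \<in> carrier (add_monoid S)"
    with f[OF k] have "f k \<zero> x = \<one>\<^bsub>sum_group {1..n c} (\<lambda>_. add_monoid S)\<^esub>"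
      "f k x \<zero> = \<one>\<^bsub>sum_group {1..n c} (\<lambda>_. add_monoid S)\<^esub>"
      by (simp_all add: symmetric_cocycle_def)
    from this[THEN eval] j
    show "f k \<one>\<^bsub>add_monoid S\<^esub> x j = \<one>\<^bsub>add_monoid S\<^esub>" "f k x \<one>\<^bsub>add_monoid S\<^esub> j = \<one>\<^bsub>add_monoid S\<^esub>"
      by simp_all
  next
    fix x y assume "x \<in> carrier (add_monoid S)" "y \<in> carrier (add_monoid S)"
    with f[OF k] show "f k x y j = f k y x j" by (simp add: symmetric_cocycle_def)
  qed
qed

lemma additive_torsion_free:
  assumes x: "x \<in> carrier (add_monoid S)" and m: "m \<noteq> 0"
    and xm: "x [^]\<^bsub>add_monoid S\<^esub> (m::int) = \<one>\<^bsub>add_monoid S\<^esub>"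
  shows "x = \<one>\<^bsub>add_monoid S\<^esub>"
proof -
  have x: "x \<in> carrier S" using x by simp
  have "[m] \<cdot> \<one> \<otimes> x = \<zero>"
    using xm x int_embed_scale[OF x, of m] by (simp add: add_pow_def)
  moreover have "[m] \<cdot> \<one> \<noteq> \<zero>"
  proof (cases "m \<ge> 0")
    case True
    then show ?thesis using m char_zero[of "nat m"] by (simp add: add_pow_int_ge)
  next
    case False
    then show ?thesis using char_zero[of "nat (- m)"] by (simp add: add_pow_int_lt)
  qed
  ultimately show ?thesis using x integral by auto
qed

text \<open>Up to \<open>U\<close>, the \<open>j\<close>-th component of \<open>f k\<close> is the coboundary of \<open>g\<close>, and
\<open>g\<close> is well defined on the ultrapower.\<close>

definition splits :: "nat \<Rightarrow> nat \<Rightarrow> ((nat \<Rightarrow> 'b) \<Rightarrow> nat \<Rightarrow> 'b) \<Rightarrow> bool" where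
  "splits k j g \<longleftrightarrow> (\<forall>x\<in>sequences S. g x \<in> sequences S) \<and>
    (\<forall>x\<in>sequences S. \<forall>y\<in>sequences S. eventually (\<lambda>i.
       f k (x i) (y i) j \<oplus> g (\<lambda>i. x i \<oplus> y i) i = g x i \<oplus> g y i) U) \<and>
    (\<forall>x\<in>sequences S. \<forall>y\<in>sequences S.
       eventually (\<lambda>i. x i = y i) U \<longrightarrow> eventually (\<lambda>i. g x i = g y i) U)"

lemma splittings_exist: "\<exists>g. \<forall>k\<in>{1..r}. \<forall>j\<in>{1..n c}. splits k j (g k j)"
proof -
  have "\<exists>g. splits k j g" if "k \<in> {1..r}" "j \<in> {1..n c}" for k j
    using cocycle_splits_in_ultrapower[OF a_comm_group a_comm_group additive_torsion_free component_cocycle[OF that]]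
    by (simp add: splits_def)
  then show ?thesis by metis
qed

text \<open>The correction of a tuple \<open>a\<close> adds the sum over \<open>k\<close> of \<open>g k j\<close> at \<open>a (1, k)\<close> to the
coordinate \<open>(c, j)\<close>. The deformed product exceeds the product of the completion by the sum of the values of \<open>f k\<close> in
the last layer. Since the first layer of a product is the sum of the first layers, and the last layers of the
factors enter it additively, \<open>splits\<close> says that the correction turns the deformed product into the product of
the completion. As \<open>c \<ge> 2\<close>, it leaves the first layer alone and can be undone.\<close>

lemma ultra_iso_to_completion:
  fixes H :: "('g, 'l) monoid_scheme"
  assumes H: "group H" and \<phi>: "\<phi> \<in> iso H D"
  shows "\<exists>t. ultra_iso U H completion t"
proof -
  interpret H: group H by (rule H)
  obtain g where "\<forall>k\<in>{1..r}. \<forall>j\<in>{1..n c}. splits k j (g k j)" using splittings_exist by (rule exE)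
  then have g:
    "\<And>k j x. \<lbrakk>k \<in> {1..r}; j \<in> {1..n c}; x \<in> sequences S\<rbrakk> \<Longrightarrow> g k j x \<in> sequences S"
    "\<And>k j x y. \<lbrakk>k \<in> {1..r}; j \<in> {1..n c}; x \<in> sequences S; y \<in> sequences S\<rbrakk> \<Longrightarrow>
       eventually (\<lambda>i. f k (x i) (y i) j \<oplus> g k j (\<lambda>i. x i \<oplus> y i) i = g k j x i \<oplus> g k j y i) U"
    "\<And>k j x y. \<lbrakk>k \<in> {1..r}; j \<in> {1..n c}; x \<in> sequences S; y \<in> sequences S;
       eventually (\<lambda>i. x i = y i) U\<rbrakk> \<Longrightarrow> eventually (\<lambda>i. g k j x i = g k j y i) U"
    by (simp_all add: splits_def)
  let ?I = "hall_index c n"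
  let ?m = "\<mu> S"
  define corr where "corr a i \<alpha> = (\<Oplus>k\<in>{1..r}. g k (snd \<alpha>) (\<lambda>i. a i (1, k)) i)"
    for a :: "nat \<Rightarrow> nat \<times> nat \<Rightarrow> 'b" and i :: nat and \<alpha> :: "nat \<times> nat"
  define shift where "shift a i = add_last_layer c n S (a i) (corr a i)"
    for a :: "nat \<Rightarrow> nat \<times> nat \<Rightarrow> 'b" and i
  have last: "snd \<alpha> \<in> {1..n c}" if "\<alpha> \<in> ?I" "fst \<alpha> = c" for \<alpha> using that by (auto simp: hall_index_def)
  have first: "(\<lambda>i. a i (1, k)) \<in> sequences S" if "a \<in> UNIV \<rightarrow> tuples" "k \<in> {1..r}" for a k
    using that first_layer_index[OF that(2)] by (auto simp: PiE_iff Pi_iff)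
  have g_closed: "g k (snd \<alpha>) (\<lambda>i. a i (1, k)) i \<in> carrier S"
    if "a \<in> UNIV \<rightarrow> tuples" "k \<in> {1..r}" "\<alpha> \<in> ?I" "fst \<alpha> = c" for a k \<alpha> i
    using g(1)[OF that(2) last[OF that(3,4)] first[OF that(1,2)]] by auto
  have corr_closed: "corr a i \<alpha> \<in> carrier S" if "a \<in> UNIV \<rightarrow> tuples" "\<alpha> \<in> ?I" "fst \<alpha> = c" for a i \<alpha>
    unfolding corr_def using g_closed that by (intro finsum_closed) auto
  have a_closed: "a i \<alpha> \<in> carrier S" if "a \<in> UNIV \<rightarrow> tuples" "\<alpha> \<in> ?I" for a and i :: nat and \<alpha>
    using that by (auto simp: PiE_iff Pi_iff)
  have shift_eval: "shift a i \<alpha> = (if fst \<alpha> = c then a i \<alpha> \<oplus> corr a i \<alpha> else a i \<alpha>)"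
    if "a \<in> UNIV \<rightarrow> tuples" "\<alpha> \<in> ?I" for a i \<alpha>
    using a_closed[OF that] that by (simp add: shift_def add_last_layer_def)
  have shift_closed: "shift a \<in> UNIV \<rightarrow> tuples" if a: "a \<in> UNIV \<rightarrow> tuples" for a
  proof (intro funcsetI PiE_I)
    fix i \<alpha> assume "\<alpha> \<in> ?I"
    then show "shift a i \<alpha> \<in> carrier S" using a_closed[OF a] corr_closed[OF a] by (simp add: shift_eval[OF a])
  qed (simp add: shift_def add_last_layer_def)
  have m_closed: "?m a b \<in> tuples" if "a \<in> tuples" "b \<in> tuples" for a b by (rule mult_closed[OF that that])
  have D_mult: "a \<otimes>\<^bsub>D\<^esub> b = add_last_layer c n S (?m a b)
      (\<lambda>\<alpha>. \<Oplus>k\<in>{1..r}. f k (a (1, k)) (b (1, k)) (snd \<alpha>))" for a b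
    by (rule deformation_mult)
  have f_closed: "f k x y j \<in> carrier S"
    if "k \<in> {1..r}" "j \<in> {1..n c}" "x \<in> carrier S" "y \<in> carrier S" for k j x y
    using component_cocycle[OF that(1,2)] that(3,4) by (auto simp: symmetric_cocycle_def)
  have corr_cong: "eventually (\<lambda>i. \<forall>\<alpha>\<in>?I. fst \<alpha> = c \<longrightarrow> corr a i \<alpha> = corr b i \<alpha>) U"
    if a: "a \<in> UNIV \<rightarrow> tuples" and b: "b \<in> UNIV \<rightarrow> tuples"
      and ev: "eventually (\<lambda>i. \<forall>k\<in>{1..r}. a i (1, k) = b i (1, k)) U" for a b
  proof -
    have "eventually (\<lambda>i. g k j (\<lambda>i. a i (1, k)) i = g k j (\<lambda>i. b i (1, k)) i) U"
      if "k \<in> {1..r}" "j \<in> {1..n c}" for k j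
      by (rule g(3)[OF that first[OF a that(1)] first[OF b that(1)]])
        (rule eventually_mono[OF ev], use that in blast)
    then have "eventually (\<lambda>i. \<forall>k\<in>{1..r}. \<forall>j\<in>{1..n c}.
        g k j (\<lambda>i. a i (1, k)) i = g k j (\<lambda>i. b i (1, k)) i) U"
      by (intro eventually_ball_finite ballI) auto
    then show ?thesis
    proof (rule eventually_mono, intro ballI impI)
      fix i \<alpha> assume *: "\<forall>k\<in>{1..r}. \<forall>j\<in>{1..n c}. g k j (\<lambda>i. a i (1, k)) i = g k j (\<lambda>i. b i (1, k)) i"
        and \<alpha>: "\<alpha> \<in> ?I" "fst \<alpha> = c"
      show "corr a i \<alpha> = corr b i \<alpha>"
        unfolding corr_def by (rule finsum_cong') (use * last[OF \<alpha>] g_closed[OF b _ \<alpha>] in auto)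
    qed
  qed
  have shift_mult: "eventually (\<lambda>i. shift (\<lambda>i. a i \<otimes>\<^bsub>D\<^esub> b i) i = ?m (shift a i) (shift b i)) U"
    if a: "a \<in> UNIV \<rightarrow> tuples" and b: "b \<in> UNIV \<rightarrow> tuples" for a b
  proof -
    let ?ab = "\<lambda>i. a i \<otimes>\<^bsub>D\<^esub> b i"
    have aT: "a i \<in> tuples" and bT: "b i \<in> tuples" for i using a b by auto
    have m: "?m (a i) (b i) \<alpha> \<in> carrier S" if "\<alpha> \<in> ?I" for i \<alpha>
      using PiE_mem[OF m_closed[OF aT bT] that] .
    have ab_eval: "?ab i \<alpha> = (if fst \<alpha> = c then ?m (a i) (b i) \<alpha> \<oplus>
        (\<Oplus>k\<in>{1..r}. f k (a i (1, k)) (b i (1, k)) (snd \<alpha>)) else ?m (a i) (b i) \<alpha>)"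
      if "\<alpha> \<in> ?I" for i \<alpha>
      using m[OF that] that by (simp add: D_mult add_last_layer_def)
    have fS: "f k (a i (1, k)) (b i (1, k)) (snd \<alpha>) \<in> carrier S"
      if "k \<in> {1..r}" "\<alpha> \<in> ?I" "fst \<alpha> = c" for k i \<alpha>
      using first[OF a that(1)] first[OF b that(1)] by (intro f_closed that(1) last that(2,3)) auto
    have ab: "?ab \<in> UNIV \<rightarrow> tuples"
    proof (intro funcsetI PiE_I)
      fix i \<alpha> assume "\<alpha> \<in> ?I"
      then show "?ab i \<alpha> \<in> carrier S" using m fS by (auto simp: ab_eval intro!: finsum_closed)
    qed (simp add: D_mult add_last_layer_def)
    have first_ab: "?ab i (1, k) = a i (1, k) \<oplus> b i (1, k)" if k: "k \<in> {1..r}" for i k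
      using mult_first_layer[OF aT bT aT aT, of k i] k c2 n_1 ab_eval[OF first_layer_index[OF k]] by simp
    have "eventually (\<lambda>i. f k (a i (1, k)) (b i (1, k)) j \<oplus> g k j (\<lambda>i. ?ab i (1, k)) i =
        g k j (\<lambda>i. a i (1, k)) i \<oplus> g k j (\<lambda>i. b i (1, k)) i) U"
      if "k \<in> {1..r}" "j \<in> {1..n c}" for k j
      unfolding first_ab[OF that(1)] by (rule g(2)[OF that first[OF a that(1)] first[OF b that(1)]])
    then have "eventually (\<lambda>i. \<forall>k\<in>{1..r}. \<forall>j\<in>{1..n c}.
        f k (a i (1, k)) (b i (1, k)) j \<oplus> g k j (\<lambda>i. ?ab i (1, k)) i =
        g k j (\<lambda>i. a i (1, k)) i \<oplus> g k j (\<lambda>i. b i (1, k)) i) U"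
      by (intro eventually_ball_finite ballI) auto
    then show ?thesis
    proof (rule eventually_mono)
      fix i assume split: "\<forall>k\<in>{1..r}. \<forall>j\<in>{1..n c}.
        f k (a i (1, k)) (b i (1, k)) j \<oplus> g k j (\<lambda>i. ?ab i (1, k)) i =
        g k j (\<lambda>i. a i (1, k)) i \<oplus> g k j (\<lambda>i. b i (1, k)) i"
      \<comment> \<open>the corrections, continued by zero to tuples\<close>
      define z where "z a = (\<lambda>\<alpha>\<in>?I. if fst \<alpha> = c then corr a i \<alpha> else \<zero>)" for a
      have z: "z a \<in> tuples" if "a \<in> UNIV \<rightarrow> tuples" for a
        using corr_closed[OF that] by (auto simp: z_def)
      have shift_z: "shift a i = add_last_layer c n S (a i) (z a)" for a
        unfolding shift_def by (rule add_last_layer_cong) (simp add: z_def)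
      have rhs: "?m (shift a i) (shift b i) =
          add_last_layer c n S (?m (a i) (b i)) (\<lambda>\<alpha>. z a \<alpha> \<oplus> z b \<alpha>)"
        unfolding shift_z by (rule mult_last_layer[OF aT bT z[OF a] z[OF b]])
      show "shift ?ab i = ?m (shift a i) (shift b i)"
      proof (rule PiE_ext)
        show "shift ?ab i \<in> tuples" using shift_closed[OF ab] by auto
        show "?m (shift a i) (shift b i) \<in> tuples" using shift_closed[OF a] shift_closed[OF b] by (intro m_closed) auto
        fix \<alpha> assume \<alpha>: "\<alpha> \<in> ?I"
        show "shift ?ab i \<alpha> = ?m (shift a i) (shift b i) \<alpha>"
        proof (cases "fst \<alpha> = c")
          case True
          have gc: "g k (snd \<alpha>) (\<lambda>i. d i (1, k)) i \<in> carrier S" if "d \<in> UNIV \<rightarrow> tuples" "k \<in> {1..r}" for d k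
            by (rule g_closed[OF that \<alpha> True])
          have "(\<Oplus>k\<in>{1..r}. f k (a i (1, k)) (b i (1, k)) (snd \<alpha>)) \<oplus> corr ?ab i \<alpha> =
              (\<Oplus>k\<in>{1..r}. f k (a i (1, k)) (b i (1, k)) (snd \<alpha>) \<oplus> g k (snd \<alpha>) (\<lambda>i. ?ab i (1, k)) i)"
            unfolding corr_def
            by (rule finsum_addf[symmetric]) (use fS[OF _ \<alpha> True] gc[OF ab] in auto)
          also have "\<dots> = (\<Oplus>k\<in>{1..r}. g k (snd \<alpha>) (\<lambda>i. a i (1, k)) i \<oplus> g k (snd \<alpha>) (\<lambda>i. b i (1, k)) i)"
            by (rule finsum_cong') (use split last[OF \<alpha> True] gc[OF a] gc[OF b] in auto)
          also have "\<dots> = corr a i \<alpha> \<oplus> corr b i \<alpha>"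
            unfolding corr_def by (rule finsum_addf) (use gc[OF a] gc[OF b] in auto)
          finally have sum: "(\<Oplus>k\<in>{1..r}. f k (a i (1, k)) (b i (1, k)) (snd \<alpha>)) \<oplus> corr ?ab i \<alpha> =
              corr a i \<alpha> \<oplus> corr b i \<alpha>" .
          have "shift ?ab i \<alpha> = ?m (a i) (b i) \<alpha> \<oplus>
              ((\<Oplus>k\<in>{1..r}. f k (a i (1, k)) (b i (1, k)) (snd \<alpha>)) \<oplus> corr ?ab i \<alpha>)"
            unfolding shift_eval[OF ab \<alpha>] ab_eval[OF \<alpha>] if_P[OF True]
            by (rule a_assoc) (use m[OF \<alpha>] fS[OF _ \<alpha> True] corr_closed[OF ab \<alpha> True] in \<open>auto intro!: finsum_closed\<close>)
          also have "\<dots> = ?m (shift a i) (shift b i) \<alpha>"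
            unfolding sum rhs using \<alpha> True by (simp add: add_last_layer_def z_def)
          finally show ?thesis .
        next
          case False
          then show ?thesis
            unfolding rhs shift_eval[OF ab \<alpha>] ab_eval[OF \<alpha>]
            using \<alpha> m[OF \<alpha>] by (simp add: add_last_layer_def)
        qed
      qed
    qed
  qed
  have shift_eq: "eventually (\<lambda>i. shift a i = shift b i) U \<longleftrightarrow> eventually (\<lambda>i. a i = b i) U"
    if a: "a \<in> UNIV \<rightarrow> tuples" and b: "b \<in> UNIV \<rightarrow> tuples" for a b
  proof -
    have first_shift: "shift d i (1, k) = d i (1, k)" if "d \<in> UNIV \<rightarrow> tuples" "k \<in> {1..r}" for d i k
      using shift_eval[OF that(1) first_layer_index[OF that(2)]] c2 by simp
    have cancel: "(shift a i = shift b i) = (a i = b i)"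
      if *: "\<forall>\<alpha>\<in>?I. fst \<alpha> = c \<longrightarrow> corr a i \<alpha> = corr b i \<alpha>" for i
    proof -
      have "shift a i \<alpha> = shift b i \<alpha> \<longleftrightarrow> a i \<alpha> = b i \<alpha>" if \<alpha>: "\<alpha> \<in> ?I" for \<alpha>
        using * \<alpha> a_closed[OF a \<alpha>] a_closed[OF b \<alpha>] corr_closed[OF b \<alpha>]
        by (simp add: shift_eval[OF a] shift_eval[OF b])
      moreover have "a i \<in> tuples" "b i \<in> tuples" "shift a i \<in> tuples" "shift b i \<in> tuples"
        using a b shift_closed by blast+
      ultimately show ?thesis by (metis PiE_ext)
    qed
    show ?thesis
    proof
      assume ev: "eventually (\<lambda>i. shift a i = shift b i) U"
      then have "eventually (\<lambda>i. \<forall>k\<in>{1..r}. a i (1, k) = b i (1, k)) U"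
        by (rule eventually_mono) (metis first_shift a b)
      from corr_cong[OF a b this] ev show "eventually (\<lambda>i. a i = b i) U"
        by eventually_elim (simp add: cancel)
    next
      assume ev: "eventually (\<lambda>i. a i = b i) U"
      then have "eventually (\<lambda>i. \<forall>k\<in>{1..r}. a i (1, k) = b i (1, k)) U"
        by (rule eventually_mono) simp
      from corr_cong[OF a b this] ev show "eventually (\<lambda>i. shift a i = shift b i) U"
        by eventually_elim (simp add: cancel)
    qed
  qed
  have shift_surj: "\<exists>a\<in>UNIV \<rightarrow> tuples. shift a = z" if z: "z \<in> UNIV \<rightarrow> tuples" for z
  proof -
    define a where "a i = (\<lambda>\<alpha>\<in>?I. if fst \<alpha> = c then z i \<alpha> \<ominus> corr z i \<alpha> else z i \<alpha>)" for i
    have a: "a \<in> UNIV \<rightarrow> tuples" using a_closed[OF z] corr_closed[OF z] by (auto simp: a_def)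
    have "a i (1, k) = z i (1, k)" if "k \<in> {1..r}" for i k
      using first_layer_index[OF that] c2 by (simp add: a_def)
    then have corr: "corr a i \<alpha> = corr z i \<alpha>" if "\<alpha> \<in> ?I" "fst \<alpha> = c" for i \<alpha>
      unfolding corr_def by (intro finsum_cong') (use g_closed[OF z _ that] in auto)
    have "shift a i = z i" for i
    proof (rule PiE_ext)
      show "shift a i \<in> tuples" using shift_closed[OF a] by auto
      show "z i \<in> tuples" using z by auto
      fix \<alpha> assume \<alpha>: "\<alpha> \<in> ?I"
      show "shift a i \<alpha> = z i \<alpha>"
        using \<alpha> a_closed[OF z \<alpha>, of i] corr_closed[OF z \<alpha>, of i]
        by (simp add: shift_eval[OF a] corr) (simp add: a_def a_minus_def a_assoc l_neg)
    qed
    with a show ?thesis by blast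
  qed
  have \<phi>_hom: "\<phi> (x \<otimes>\<^bsub>H\<^esub> y) = \<phi> x \<otimes>\<^bsub>D\<^esub> \<phi> y" if "x \<in> carrier H" "y \<in> carrier H" for x y
    using \<phi> that by (auto simp: iso_def hom_def)
  have bij: "bij_betw \<phi> (carrier H) tuples" using \<phi> by (simp add: iso_def deformation_def)
  have \<phi>_closed: "(\<lambda>i. \<phi> (x i)) \<in> UNIV \<rightarrow> tuples" if "x \<in> sequences H" for x
    using that bij by (auto simp: bij_betw_def)
  have inj: "inj_on \<phi> (carrier H)" using bij by (simp add: bij_betw_def)
  have "ultra_iso U H completion (\<lambda>x. shift (\<lambda>i. \<phi> (x i)))"
  proof (rule ultra_iso.intro[OF free_ultrafilter_axioms H group_hall_completion], rule ultra_iso_axioms.intro)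
    fix x :: "nat \<Rightarrow> 'g" assume x: "x \<in> sequences H"
    show "shift (\<lambda>i. \<phi> (x i)) \<in> sequences completion"
      unfolding hall_completion_simps by (rule shift_closed[OF \<phi>_closed[OF x]])
    fix y :: "nat \<Rightarrow> 'g" assume y: "y \<in> sequences H"
    have "(\<phi> (x i) = \<phi> (y i)) = (x i = y i)" for i
      by (rule inj_on_eq_iff[OF inj]) (use x y in auto)
    then show "eventually (\<lambda>i. shift (\<lambda>i. \<phi> (x i)) i = shift (\<lambda>i. \<phi> (y i)) i) U \<longleftrightarrow> eventually (\<lambda>i. x i = y i) U"
      unfolding shift_eq[OF \<phi>_closed[OF x] \<phi>_closed[OF y]] by simp
    have "\<phi> (x i \<otimes>\<^bsub>H\<^esub> y i) = \<phi> (x i) \<otimes>\<^bsub>D\<^esub> \<phi> (y i)" for i using x y by (intro \<phi>_hom) auto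
    then show "eventually (\<lambda>i. shift (\<lambda>i. \<phi> (x i \<otimes>\<^bsub>H\<^esub> y i)) i =
        shift (\<lambda>i. \<phi> (x i)) i \<otimes>\<^bsub>completion\<^esub> shift (\<lambda>i. \<phi> (y i)) i) U"
      unfolding hall_completion_simps using shift_mult[OF \<phi>_closed[OF x] \<phi>_closed[OF y]] by simp
  next
    fix z :: "nat \<Rightarrow> nat \<times> nat \<Rightarrow> 'b" assume "z \<in> sequences completion"
    then obtain a where a: "a \<in> UNIV \<rightarrow> tuples" "shift a = z"
      unfolding hall_completion_simps using shift_surj[of z] by blast
    let ?x = "\<lambda>i. inv_into (carrier H) \<phi> (a i)"
    have "a i \<in> \<phi> ` carrier H" for i using a(1) bij by (auto simp: bij_betw_def)
    then have "?x \<in> sequences H" "(\<lambda>i. \<phi> (?x i)) = a" by (auto simp: inv_into_into f_inv_into_f)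
    with a(2) show "\<exists>x\<in>sequences H. eventually (\<lambda>i. shift (\<lambda>i. \<phi> (x i)) i = z i) U"
      by (intro bexI[of _ ?x]) auto
  qed
  then show ?thesis by blast
qed

end

section \<open>Elementary equivalence of abelian deformations\<close>

theorem theorem1p2:
  fixes r c :: nat
    and n :: "nat \<Rightarrow> nat"
    and h :: "nat \<times> nat \<Rightarrow> comm"
    and p :: "nat \<times> nat \<Rightarrow> (nat \<times> nat + nat \<times> nat) binom_poly"
    and q :: "nat \<times> nat \<Rightarrow> (nat \<times> nat + unit) binom_poly"
    and R :: "('a, 'm) ring_scheme"
    and S :: "('b, 'k) ring_scheme"
    and H :: "('g, 'l) monoid_scheme"
  assumes "r \<ge> 2" and "c \<ge> 2"
    and "hall_basic_sequence r c n h"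
    and "canonical_polynomials r c n h p q"
    and "binomial_domain R"
    and "ring S"
    and "ring_elem_equiv S R"
    and "abelian_deformation r c n p q S H"
  shows "group_elem_equiv H (hall_completion c n p q R)"
proof -
  interpret R: binomial_domain R by fact
  have "binomial_domain S"
    using binomial_domain_elementary[OF assms(5,6,7)] .
  then interpret S: binomial_domain S .
  have polys: "hall_polynomials r c n h p q"
    using assms by (simp add: hall_polynomials_def)
  interpret SR: hall_polynomials_over_pair r c n h p q S R
    by (intro hall_polynomials_over_pair.intro polys binomial_domain_pair.intro) unfold_locales
  from assms(8) obtain f \<phi> where H: "group H"
    and f: "\<forall>k\<in>{1..r}. symmetric_cocycle (add_monoid S) (sum_group {1..n c} (\<lambda>_. add_monoid S)) (f k)"
    and \<phi>: "\<phi> \<in> iso H (deformation r c n p q S f)"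
    unfolding abelian_deformation_def by blast
  obtain U where "free_ultrafilter U" using free_ultrafilter_exists by blast
  then interpret C: cocycle_deformation U r c n h p q S f
    by (intro cocycle_deformation.intro cocycle_deformation_axioms.intro)
      (use assms(2) f SR.R.hall_polynomials_over_axioms in auto)
  obtain t where "ultra_iso U H (hall_completion c n p q S) t"
    using C.ultra_iso_to_completion[OF H \<phi>] by blast
  then have "models (carrier H) (group_term_val H) \<psi> \<longleftrightarrow>
      models (carrier (hall_completion c n p q S)) (group_term_val (hall_completion c n p q S)) \<psi>" for \<psi>
    by (rule ultra_iso.models_iff)
  then show ?thesis
    using SR.hall_completion_models_iff[OF assms(7)] by (simp add: group_elem_equiv_def)
qed

end
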